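(* Fix an integer $p\ge2$ (not necessarily prime). Then $[S^3\setminus\Sigma_p(h),S^2]=[S^3\setminus\Sigma_p(h),S^2]_\infty$ is a definable set, and there is a basepoint-preserving definable bijection between $[S^3\setminus\Sigma_p(h),S^2]$ and $\mathrm{Ext}(\mathbb Z[1/p],\mathbb Z)$.
   Context: **Solenoids.** Let $\mathbb T$ be the unit circle in $\mathbb C$, $D$ a closed disc in $\mathbb C$ centred at $0$, and $e:\mathbb T\times D\to\mathbb T\times D$, $e(\zeta,z)=(\zeta^p,\zeta+\varepsilon z\zeta^{1-p})$, where the radius of $D$ and the small $\varepsilon>0$ are chosen so that $e$ is well defined into the interior of $\mathbb T\times D$ and injective. There exist an orientation-preserving diffeomorphism $h$ of $S^3$ and a smooth embedding $j^+:\mathbb T\times D\to S^3$ with $h\circ j^+=j^+\circ e$ such that, with $T^+=j^+(\mathbb T\times D)$ and $T^-$ the closure of $S^3\setminus T^+$, there is a diffeomorphism $j^-:\mathbb T\times D\to T^-$ with $h^{-1}\circ j^-=j^-\circ e$. Fix such data and set $\Sigma_p(h)=\bigcap_nh^n(T^+)$, which is homeomorphic to the $p$-adic solenoid (the Pontryagin dual of $\mathbb Z[1/p]$). **Homotopy classes.** $[X,S^2]$ is the quotient of the Polish space of continuous maps $X\to S^2$ (compact-open topology) by homotopy, with basepoint the class of a constant map. $[X,S^2]_\infty$ is the set of homotopy classes of phantom maps, i.e. maps whose restriction to every compact subset of $X$ is homotopic to a constant map. **Definable sets.** An equivalence relation $E$ on a Polish space $Y$ is idealistic if there are an assignment of a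 $\sigma$-filter $\mathcal F_{[y]}$ of subsets of $[y]$ to each class and a Borel $\zeta:Y\to Y$ with $\zeta(y)\,E\,y$ such that for every Borel $A\subseteq Y\times Y$ the set $\{y:\{y'\in[y]:(\zeta(y),y')\in A\}\in\mathcal F_{[y]}\}$ is Borel ($\sigma$-filter: nonempty family of nonempty sets closed under supersets and countable intersections). A definable set is a quotient $Y/E$ with $Y$ Polish and $E$ Borel and idealistic; a function $Y/E\to Z/F$ is definable if it lifts to a Borel function $Y\to Z$. **Ext.** For countable abelian groups $C,A$, $\mathrm{Ext}(C,A)=\mathrm Z(C,A)/\mathrm B(C,A)$, where $\mathrm Z(C,A)\subseteq A^{C\times C}$ (product topology, $A$ discrete) is the closed subgroup of functions $g$ with $g(x,0)=g(0,y)=0$, $g(x,y)+g(x+y,z)=g(x,y+z)+g(y,z)$, $g(x,y)=g(y,x)$, and $\mathrm B(C,A)$ is the subgroup of functions $(x,y)\mapsto k(x)+k(y)-k(x+y)$ with $k:C\to A$, $k(0)=0$; it is a definable set via the coset relation, with basepoint $0$. *)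

theory Defs
  imports "HOL-Analysis.Analysis"
begin

section \<open>Smooth maps between subsets of Euclidean spaces\<close>

(* Meant for open U only. In finite dimension, being C^(k+1) amounts to being differentiable
   with all directional derivatives C^k. *)
primrec Ck_on :: "nat \<Rightarrow> 'a::euclidean_space set \<Rightarrow> ('a \<Rightarrow> 'b::euclidean_space) \<Rightarrow> bool" where
  "Ck_on 0 U f \<longleftrightarrow> continuous_on U f"
| "Ck_on (Suc k) U f \<longleftrightarrow>
     f differentiable_on U \<and> (\<forall>v. Ck_on k U (\<lambda>x. frechet_derivative f (at x) v))"

(* Smoothness on an arbitrary subset: local smooth extendability to the ambient space. On
   submanifolds with boundary this is the usual notion. *)
definition smooth_map :: "'a::euclidean_space set \<Rightarrow> 'b::euclidean_space set \<Rightarrow> ('a \<Rightarrow> 'b) \<Rightarrow> bool" where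
  "smooth_map X Y f \<longleftrightarrow> f \<in> X \<rightarrow> Y \<and>
     (\<forall>x\<in>X. \<exists>U F. open U \<and> x \<in> U \<and> (\<forall>k. Ck_on k U F) \<and> (\<forall>y\<in>X \<inter> U. F y = f y))"

definition diffeomorphism :: "'a::euclidean_space set \<Rightarrow> 'b::euclidean_space set \<Rightarrow> ('a \<Rightarrow> 'b) \<Rightarrow> bool" where
  "diffeomorphism X Y f \<longleftrightarrow>
     bij_betw f X Y \<and> smooth_map X Y f \<and> smooth_map Y X (inv_into X f)"

definition smooth_embedding :: "'a::euclidean_space set \<Rightarrow> 'b::euclidean_space set \<Rightarrow> ('a \<Rightarrow> 'b) \<Rightarrow> bool" where
  "smooth_embedding X Y f \<longleftrightarrow> f ` X \<subseteq> Y \<and> diffeomorphism X (f ` X) f"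

abbreviation S2 :: "(real^3) set" where "S2 \<equiv> sphere 0 1"
abbreviation S3 :: "(real^4) set" where "S3 \<equiv> sphere 0 1"

(* S3 is oriented as the boundary of the ball: a basis v1, v2, v3 of the tangent space at x (the
   orthogonal complement of x) is positive iff det (x, v1, v2, v3) > 0. The derivative D of h
   within S3 is determined on tangent vectors only. *)
definition orientation_preserving_S3 :: "(real^4 \<Rightarrow> real^4) \<Rightarrow> bool" where
  "orientation_preserving_S3 h \<longleftrightarrow>
     (\<forall>x\<in>S3. \<exists>D. (h has_derivative D) (at x within S3) \<and>
        (\<forall>v1 v2 v3. x \<bullet> v1 = 0 \<and> x \<bullet> v2 = 0 \<and> x \<bullet> v3 = 0 \<and>
           det (vector [x, v1, v2, v3] :: real^4^4) > 0 \<longrightarrow>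
           det (vector [h x, D v1, D v2, D v3] :: real^4^4) > 0))"


section \<open>Solenoids\<close>

definition solid_torus :: "real \<Rightarrow> (complex \<times> complex) set" where
  "solid_torus r = sphere 0 1 \<times> cball 0 r"

definition solenoid_map :: "nat \<Rightarrow> real \<Rightarrow> complex \<times> complex \<Rightarrow> complex \<times> complex" where
  "solenoid_map p \<epsilon> = (\<lambda>(\<zeta>, z). (\<zeta> ^ p, \<zeta> + of_real \<epsilon> * z * \<zeta> powi (1 - int p)))"

definition solenoid :: "('a \<Rightarrow> 'a) \<Rightarrow> 'a set \<Rightarrow> 'a set" where
  "solenoid h T = (\<Inter>n::nat. (h ^^ n) ` T)"


section \<open>Definable sets\<close>

definition polish :: "'a topology \<Rightarrow> bool" where
  "polish Y \<longleftrightarrow> completely_metrizable_space Y \<and> second_countable Y"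

definition borel_of :: "'a topology \<Rightarrow> 'a measure" where
  "borel_of Y = sigma (topspace Y) {U. openin Y U}"

definition sigma_filter :: "'a set \<Rightarrow> 'a set set \<Rightarrow> bool" where
  "sigma_filter C F \<longleftrightarrow> F \<noteq> {} \<and> F \<subseteq> Pow C - {{}} \<and>
     (\<forall>S T. S \<in> F \<and> S \<subseteq> T \<and> T \<subseteq> C \<longrightarrow> T \<in> F) \<and>
     (\<forall>S :: nat \<Rightarrow> 'a set. range S \<subseteq> F \<longrightarrow> (\<Inter>n. S n) \<in> F)"

definition idealistic :: "'a topology \<Rightarrow> ('a \<times> 'a) set \<Rightarrow> bool" where
  "idealistic Y E \<longleftrightarrow> (\<exists>F \<zeta>.
     (\<forall>C\<in>topspace Y // E. sigma_filter C (F C)) \<and>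
     \<zeta> \<in> measurable (borel_of Y) (borel_of Y) \<and>
     (\<forall>y\<in>topspace Y. (\<zeta> y, y) \<in> E) \<and>
     (\<forall>A\<in>sets (borel_of (prod_topology Y Y)).
        {y \<in> topspace Y. {y' \<in> E `` {y}. (\<zeta> y, y') \<in> A} \<in> F (E `` {y})} \<in> sets (borel_of Y)))"

(* A definable set Y/E is represented by the pair (Y, E); its set of elements is topspace Y // E. *)
definition definable_set :: "'a topology \<Rightarrow> ('a \<times> 'a) set \<Rightarrow> bool" where
  "definable_set Y E \<longleftrightarrow> polish Y \<and> equiv (topspace Y) E \<and>
     E \<in> sets (borel_of (prod_topology Y Y)) \<and> idealistic Y E"

definition definable_map ::
  "'a topology \<Rightarrow> ('a \<times> 'a) set \<Rightarrow> 'b topology \<Rightarrow> ('b \<times> 'b) set \<Rightarrow> ('a set \<Rightarrow> 'b set) \<Rightarrow> bool" where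
  "definable_map Y E Z F \<phi> \<longleftrightarrow> \<phi> \<in> topspace Y // E \<rightarrow> topspace Z // F \<and>
     (\<exists>f \<in> measurable (borel_of Y) (borel_of Z). \<forall>y\<in>topspace Y. \<phi> (E `` {y}) = F `` {f y})"

definition definable_bijection ::
  "'a topology \<Rightarrow> ('a \<times> 'a) set \<Rightarrow> 'b topology \<Rightarrow> ('b \<times> 'b) set \<Rightarrow> ('a set \<Rightarrow> 'b set) \<Rightarrow> bool" where
  "definable_bijection Y E Z F \<phi> \<longleftrightarrow>
     definable_map Y E Z F \<phi> \<and> bij_betw \<phi> (topspace Y // E) (topspace Z // F)"


section \<open>Spaces of maps and homotopy classes\<close>

(* Maps on X are represented by their extensional versions, undefined outside X. *)
definition cmaps :: "'a::topological_space set \<Rightarrow> 'b::topological_space set \<Rightarrow> ('a \<Rightarrow> 'b) set" where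
  "cmaps X Y = {f \<in> X \<rightarrow>\<^sub>E Y. continuous_on X f}"

definition map_space :: "'a::topological_space set \<Rightarrow> 'b::topological_space set \<Rightarrow> ('a \<Rightarrow> 'b) topology" where
  "map_space X Y = topology_generated_by
     {{f \<in> cmaps X Y. f ` K \<subseteq> U} | K U. compact K \<and> K \<subseteq> X \<and> open U}"

definition homotopy_rel ::
  "'a::topological_space set \<Rightarrow> 'b::topological_space set \<Rightarrow> (('a \<Rightarrow> 'b) \<times> ('a \<Rightarrow> 'b)) set" where
  "homotopy_rel X Y = {(f, g). f \<in> cmaps X Y \<and> g \<in> cmaps X Y \<and>
     homotopic_with_canon (\<lambda>_. True) X Y f g}"

definition homotopy_classes ::
  "'a::topological_space set \<Rightarrow> 'b::topological_space set \<Rightarrow> ('a \<Rightarrow> 'b) set set" where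
  "homotopy_classes X Y = cmaps X Y // homotopy_rel X Y"

definition phantom :: "'a::topological_space set \<Rightarrow> 'b::topological_space set \<Rightarrow> ('a \<Rightarrow> 'b) \<Rightarrow> bool" where
  "phantom X Y f \<longleftrightarrow> f \<in> cmaps X Y \<and>
     (\<forall>K. compact K \<and> K \<subseteq> X \<longrightarrow> (\<exists>c\<in>Y. homotopic_with_canon (\<lambda>_. True) K Y f (\<lambda>_. c)))"

definition phantom_classes ::
  "'a::topological_space set \<Rightarrow> 'b::topological_space set \<Rightarrow> ('a \<Rightarrow> 'b) set set" where
  "phantom_classes X Y = {homotopy_rel X Y `` {f} | f. phantom X Y f}"


section \<open>Ext\<close>

(* C and A are subgroups of the ambient groups; functions are extensional on C \<times> C. *)
definition ext_cocycles :: "'c::ab_group_add set \<Rightarrow> 'a::ab_group_add set \<Rightarrow> ('c \<times> 'c \<Rightarrow> 'a) set" where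
  "ext_cocycles C A = {g \<in> C \<times> C \<rightarrow>\<^sub>E A.
     (\<forall>x\<in>C. g (x, 0) = 0 \<and> g (0, x) = 0) \<and>
     (\<forall>x\<in>C. \<forall>y\<in>C. \<forall>z\<in>C. g (x, y) + g (x + y, z) = g (x, y + z) + g (y, z)) \<and>
     (\<forall>x\<in>C. \<forall>y\<in>C. g (x, y) = g (y, x))}"

definition ext_coboundaries :: "'c::ab_group_add set \<Rightarrow> 'a::ab_group_add set \<Rightarrow> ('c \<times> 'c \<Rightarrow> 'a) set" where
  "ext_coboundaries C A =
     {(\<lambda>(x, y) \<in> C \<times> C. k x + k y - k (x + y)) | k. k \<in> C \<rightarrow> A \<and> k 0 = 0}"

definition ext_space :: "'c::ab_group_add set \<Rightarrow> 'a::ab_group_add set \<Rightarrow> ('c \<times> 'c \<Rightarrow> 'a) topology" where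
  "ext_space C A =
     subtopology (product_topology (\<lambda>_. discrete_topology A) (C \<times> C)) (ext_cocycles C A)"

definition ext_rel ::
  "'c::ab_group_add set \<Rightarrow> 'a::ab_group_add set \<Rightarrow> (('c \<times> 'c \<Rightarrow> 'a) \<times> ('c \<times> 'c \<Rightarrow> 'a)) set" where
  "ext_rel C A = {(g, g'). g \<in> ext_cocycles C A \<and> g' \<in> ext_cocycles C A \<and>
     (\<lambda>u \<in> C \<times> C. g u - g' u) \<in> ext_coboundaries C A}"

definition Z_inv :: "nat \<Rightarrow> rat set" where
  "Z_inv p = {of_int k / of_nat p ^ n | (k::int) (n::nat). True}"

end

theory Submission
  imports Defs
begin

text \<open>
  The complement of the solenoid is the increasing union of the solid tori \<open>h\<^sup>n(T\<^sup>-)\<close>, each embedded in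
  the next one by \<open>e\<close>. Write the two-sphere as the base of the Hopf fibration. On a solid torus every
  map to the two-sphere is null-homotopic, so it lifts to the three-sphere, uniquely up to a map to the
  circle; comparing the lifts on consecutive tori gives a sequence of degrees \<open>d\<^sub>n\<close>, well defined up to
  the sequences \<open>p a\<^sub>n\<^sub>+\<^sub>1 - a\<^sub>n\<close>, because \<open>e\<close> has degree \<open>p\<close> on the core circle. All sequences occur,
  since maps to the three-sphere extend from closed subsets of a three-dimensional space. If two maps
  have the same degree sequence, their lifts can be adjusted to differ by the same circle-valued maps;
  then their quaternionic quotient is a global map to the three-sphere. It is null-homotopic, because
  null-homotopies on one torus prolong to the next, and a null-homotopy of the quotient is a homotopy
  between the two maps.

  Thus homotopy classes correspond to integer sequences modulo \<open>p a\<^sub>n\<^sub>+\<^sub>1 - a\<^sub>n\<close>, which is the usual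
  presentation of \<open>Ext(Z[1/p], Z)\<close>: the sequence \<open>d\<close> corresponds to the coboundary of a rational
  function \<open>s\<close> on \<open>Z[1/p]\<close> with \<open>p s(p\<^sup>-\<^sup>n\<^sup>-\<^sup>1) - s(p\<^sup>-\<^sup>n) = d\<^sub>n\<close>. Measurability holds because the lifts can
  be chosen from countably many by proximity, and the equivalence relation is idealistic because every
  class contains countably many sequences of digits between \<open>0\<close> and \<open>p - 1\<close>, enumerated by their
  initial carry.
\<close>

section \<open>The Hopf map and lifts through it\<close>

text \<open>Every map is trivial on each single torus, so a homotopy class consists only of the
  mismatch between choices made on consecutive tori. For maps into the two-sphere this mismatch is a
  genuine invariant, because two null-homotopies on a torus can differ by a loop of maps that does
  not contract. For maps into the three-sphere it disappears: a loop of maps on a torus reduces to a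
  map on the circle times a segment, and filling it is an extension problem over the circle times a
  square, of dimension three. Hence null-homotopies can be chosen one after another, each prolonging
  the previous one, and the comparison of two maps is moved to the three-sphere. The circle acts
  there by left multiplication, so in the quotient of two lifts a common phase cancels on the left;
  this is why the degrees have to be matched before the quotient is formed. The relation between two
  degree sequences leaves one integer of freedom, the initial term of \<open>a\<close>, since each
  later term is determined by the one before it. This single fact makes homotopy a Borel relation
  and makes the set of digit sequences in a class countable.\<close>

abbreviation S3c :: "(complex \<times> complex) set" where "S3c \<equiv> sphere 0 1"
abbreviation Circ :: "complex set" where "Circ \<equiv> sphere 0 1"

definition hopf :: "complex \<times> complex \<Rightarrow> real^3" where
  "hopf g = vector [2 * Re (fst g * cnj (snd g)), 2 * Im (fst g * cnj (snd g)),
     (cmod (fst g))\<^sup>2 - (cmod (snd g))\<^sup>2]"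

definition csc :: "complex \<Rightarrow> complex \<times> complex \<Rightarrow> complex \<times> complex" where
  "csc u g = (u * fst g, u * snd g)"

text \<open>For a unit vector \<open>g\<close> and \<open>g' = csc u g\<close> the value
  \<open>herm g' g\<close> is \<open>u\<close>: a continuous formula for the phase by which two
  lifts differ.\<close>

definition herm :: "complex \<times> complex \<Rightarrow> complex \<times> complex \<Rightarrow> complex" where
  "herm g g' = fst g * cnj (fst g') + snd g * cnj (snd g')"

lemma norm_csc: "norm (csc u g) = cmod u * norm g"
  by (simp add: csc_def norm_Pair norm_mult power_mult_distrib real_sqrt_mult flip: distrib_left)
     (metis norm_Pair prod.collapse)

lemma csc_in_S3c: "u \<in> Circ \<Longrightarrow> g \<in> S3c \<Longrightarrow> csc u g \<in> S3c"
  by (simp add: norm_csc)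

lemma csc_csc [simp]: "csc u (csc v g) = csc (u * v) g"
  by (simp add: csc_def)

lemma csc_1 [simp]: "csc 1 g = g"
  by (simp add: csc_def)

lemma S3c_iff: "g \<in> S3c \<longleftrightarrow> (cmod (fst g))\<^sup>2 + (cmod (snd g))\<^sup>2 = 1"
  by (cases g) (simp add: norm_Pair)

lemma hopf_csc: "u \<in> Circ \<Longrightarrow> hopf (csc u g) = hopf g"
proof -
  assume "u \<in> Circ"
  then have "u * cnj u = 1"
    by (simp add: complex_norm_square [symmetric])
  then have "u * a * cnj (u * b) = a * cnj b" for a b
    by (metis (no_types, opaque_lifting) complex_cnj_mult mult.assoc mult.left_commute mult_1)
  then show ?thesis
    using \<open>u \<in> Circ\<close> unfolding hopf_def csc_def fst_conv snd_conv by (simp only: norm_mult) simp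
qed

lemma continuous_on_hopf [continuous_intros]:
  assumes "continuous_on S g" shows "continuous_on S (\<lambda>x. hopf (g x))"
proof -
  have "continuous_on S (\<lambda>x. hopf (g x) $ i)" for i
  proof -
    have "continuous_on S (\<lambda>x. hopf (g x) $ 1)" "continuous_on S (\<lambda>x. hopf (g x) $ 2)"
      "continuous_on S (\<lambda>x. hopf (g x) $ 3)"
      unfolding hopf_def vector_3 by (intro continuous_intros assms)+
    then show ?thesis using exhaust_3[of i] by auto
  qed
  then show ?thesis
    using continuous_on_vec_lambda[of S "\<lambda>i x. hopf (g x) $ i"] by (simp add: vec_lambda_eta)
qed

lemma norm_vec3: "norm (v :: real^3) = sqrt ((v$1)\<^sup>2 + (v$2)\<^sup>2 + (v$3)\<^sup>2)"
  by (simp add: norm_vec_def L2_set_def sum_3)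

lemma hopf_in_S2: "g \<in> S3c \<Longrightarrow> hopf g \<in> S2"
proof -
  assume "g \<in> S3c"
  obtain a1 a2 b1 b2 where g: "g = (Complex a1 a2, Complex b1 b2)"
    by (metis complex.collapse prod.collapse)
  have "a1\<^sup>2 + a2\<^sup>2 + (b1\<^sup>2 + b2\<^sup>2) = 1"
    using \<open>g \<in> S3c\<close>[unfolded S3c_iff] by (simp add: g cmod_power2)
  moreover have "hopf g $ 1 = 2 * (a1 * b1 + a2 * b2)" "hopf g $ 2 = 2 * (a2 * b1 - a1 * b2)"
    "hopf g $ 3 = a1\<^sup>2 + a2\<^sup>2 - (b1\<^sup>2 + b2\<^sup>2)"
    by (simp_all add: hopf_def g cmod_power2)
  then have "(hopf g $ 1)\<^sup>2 + (hopf g $ 2)\<^sup>2 + (hopf g $ 3)\<^sup>2 = (a1\<^sup>2 + a2\<^sup>2 + (b1\<^sup>2 + b2\<^sup>2))\<^sup>2"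
    by algebra
  ultimately show ?thesis
    by (simp only: norm_vec3 mem_sphere_0 power_one real_sqrt_one)
qed

text \<open>The first two coordinates of \<open>hopf\<close> give \<open>a * cnj c\<close>; the
  third one and the unit norm give both moduli. So all products of a coordinate with a conjugate
  coordinate agree, and projecting \<open>g'\<close> onto the line of \<open>g\<close> returns
  \<open>g'\<close>.\<close>

lemma hopf_fibre:
  assumes "g \<in> S3c" "g' \<in> S3c" "hopf g = hopf g'"
  shows "g' = csc (herm g' g) g" "herm g' g \<in> Circ"
proof -
  obtain a c where "g = (a, c)" by (cases g)
  moreover obtain a' c' where "g' = (a', c')" by (cases g')
  ultimately have g: "g = (a, c)" "g' = (a', c')" by auto
  have eq: "a * cnj c = a' * cnj c'"
    using arg_cong[OF assms(3), of "\<lambda>v. v$1"] arg_cong[OF assms(3), of "\<lambda>v. v$2"]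
    by (auto simp: hopf_def g complex_eq_iff)
  have d: "(cmod a)\<^sup>2 - (cmod c)\<^sup>2 = (cmod a')\<^sup>2 - (cmod c')\<^sup>2"
    using arg_cong[OF assms(3), of "\<lambda>v. v$3"] by (simp add: hopf_def g)
  have s: "(cmod a)\<^sup>2 + (cmod c)\<^sup>2 = 1" "(cmod a')\<^sup>2 + (cmod c')\<^sup>2 = 1"
    using assms(1,2)[unfolded S3c_iff] by (simp_all add: g)
  then have n: "(cmod a)\<^sup>2 = (cmod a')\<^sup>2" "(cmod c)\<^sup>2 = (cmod c')\<^sup>2" using d by linarith+
  have N: "a * cnj a = a' * cnj a'" "c * cnj c = c' * cnj c'" "a' * cnj a' + c' * cnj c' = 1"
    using n s(2) by (simp_all only: complex_norm_square [symmetric] of_real_add [symmetric] of_real_1)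
  have eq': "cnj a * c = cnj a' * c'"
    using arg_cong[OF eq, of cnj] by simp
  have 1: "(a' * cnj a + c' * cnj c) * a = a'" "(a' * cnj a + c' * cnj c) * c = c'"
    using N eq eq' by algebra+
  then show *: "g' = csc (herm g' g) g"
    by (simp add: g csc_def herm_def)
  show "herm g' g \<in> Circ"
    using arg_cong[OF *, of norm] assms by (simp add: norm_csc)
qed

lemma continuous_on_csc [continuous_intros]:
  "continuous_on S u \<Longrightarrow> continuous_on S g \<Longrightarrow> continuous_on S (\<lambda>x. csc (u x) (g x))"
  unfolding csc_def by (intro continuous_intros)

lemma continuous_on_herm [continuous_intros]:
  "continuous_on S u \<Longrightarrow> continuous_on S g \<Longrightarrow> continuous_on S (\<lambda>x. herm (u x) (g x))"
  unfolding herm_def by (intro continuous_intros)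

text \<open>The (unnormalised) Hermitian projection of \<open>complex \<times> complex\<close> onto the line with Hopf image \<open>b\<close>;
  normalising it moves a point of the three-sphere to the fibre over \<open>b\<close>, continuously in \<open>b\<close> as long
  as \<open>b\<close> is not antipodal to the Hopf image of the point.\<close>

definition spin_proj :: "real^3 \<Rightarrow> complex \<times> complex \<Rightarrow> complex \<times> complex" where
  "spin_proj b g = (of_real (1 + b$3) * fst g + Complex (b$1) (b$2) * snd g,
     Complex (b$1) (- (b$2)) * fst g + of_real (1 - b$3) * snd g)"

definition transport :: "real^3 \<Rightarrow> complex \<times> complex \<Rightarrow> complex \<times> complex" where
  "transport b g = csc (of_real (inverse (norm (spin_proj b g)))) (spin_proj b g)"

text \<open>For a unit vector \<open>b\<close> the matrix of \<open>spin_proj b\<close> is the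
  identity plus a Hermitian matrix with square 1, that is, twice a rank-one projection. The square
  norm is therefore 2 times (1 plus the inner product of \<open>b\<close> and
  \<open>hopf g\<close>), which vanishes exactly at the antipode.\<close>

lemma norm_spin_proj:
  assumes "g \<in> S3c" "b \<in> S2"
  shows "norm (spin_proj b g) = norm (b + hopf g)"
proof -
  obtain a1 a2 c1 c2 where g: "g = (Complex a1 a2, Complex c1 c2)"
    by (metis complex.collapse prod.collapse)
  have 1: "a1\<^sup>2 + a2\<^sup>2 + (c1\<^sup>2 + c2\<^sup>2) = 1"
    using \<open>g \<in> S3c\<close>[unfolded S3c_iff] by (simp add: g cmod_power2)
  have 2: "(b$1)\<^sup>2 + (b$2)\<^sup>2 + (b$3)\<^sup>2 = 1"
    using assms by (simp add: norm_vec3)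
  let ?A = "a1\<^sup>2 + a2\<^sup>2 + (c1\<^sup>2 + c2\<^sup>2)" and ?B = "(b$1)\<^sup>2 + (b$2)\<^sup>2 + (b$3)\<^sup>2"
  let ?I = "b$1 * hopf g $ 1 + b$2 * hopf g $ 2 + b$3 * hopf g $ 3"
  have h: "hopf g $ 1 = 2 * (a1 * c1 + a2 * c2)" "hopf g $ 2 = 2 * (a2 * c1 - a1 * c2)"
    "hopf g $ 3 = a1\<^sup>2 + a2\<^sup>2 - (c1\<^sup>2 + c2\<^sup>2)"
    by (simp_all add: hopf_def g cmod_power2)
  have n: "(norm (spin_proj b g))\<^sup>2 =
     (((1 + b$3) * a1 + (b$1 * c1 - b$2 * c2))\<^sup>2 + ((1 + b$3) * a2 + (b$1 * c2 + b$2 * c1))\<^sup>2) +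
     ((b$1 * a1 + b$2 * a2 + (1 - b$3) * c1)\<^sup>2 + (b$1 * a2 - b$2 * a1 + (1 - b$3) * c2)\<^sup>2)"
    by (simp add: spin_proj_def g norm_Pair cmod_power2)
  have "(norm (spin_proj b g))\<^sup>2 = ?A * (1 + ?B) + 2 * ?I"
    unfolding n h by algebra
  also have "\<dots> = ?B + ?A\<^sup>2 + 2 * ?I"
    using 1 2 by simp
  also have "\<dots> = (norm (b + hopf g))\<^sup>2"
  proof -
    have "(norm (b + hopf g))\<^sup>2 =
        (b$1 + hopf g $ 1)\<^sup>2 + (b$2 + hopf g $ 2)\<^sup>2 + (b$3 + hopf g $ 3)\<^sup>2"
      by (simp add: norm_vec3)
    then show ?thesis using h by algebra
  qed
  finally have "(norm (spin_proj b g))\<^sup>2 = (norm (b + hopf g))\<^sup>2" .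
  then show ?thesis by simp
qed

lemma hopf_spin_proj:
  assumes "b \<in> S2" shows "hopf (spin_proj b g) = (norm (spin_proj b g))\<^sup>2 *\<^sub>R b"
proof -
  define w z P Q where "w = Complex (b$1) (b$2)" and "z = complex_of_real (b$3)"
    and "P = fst (spin_proj b g)" and "Q = snd (spin_proj b g)"
  have "(b$1)\<^sup>2 + (b$2)\<^sup>2 = 1 - (b$3)\<^sup>2"
    using assms by (simp add: norm_vec3)
  moreover have "w * cnj w = of_real ((b$1)\<^sup>2 + (b$2)\<^sup>2)"
    by (simp add: w_def complex_eq_iff power2_eq_square)
  ultimately have ww: "w * cnj w = 1 - z * z"
    by (simp add: z_def power2_eq_square)
  have PQ: "P = (1 + z) * fst g + w * snd g" "Q = cnj w * fst g + (1 - z) * snd g"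
    by (simp_all add: P_def Q_def spin_proj_def w_def z_def complex_eq_iff)
  have z: "cnj z = z" by (simp add: z_def)
  \<comment> \<open>Rank one: since \<open>w * cnj w = 1 - z * z\<close>, every image vector
    \<open>(P, Q)\<close> lies on the complex line determined by \<open>b\<close>.\<close>
  have 1: "(1 + z) * Q = cnj w * P" "w * Q = (1 - z) * P"
    using ww unfolding PQ by algebra+
  have 2: "(1 + z) * cnj Q = w * cnj P"
    using arg_cong[OF 1(1), of cnj] by (simp add: z)
  define N where "N = (norm (spin_proj b g))\<^sup>2"
  have N: "complex_of_real N = P * cnj P + Q * cnj Q"
    by (simp add: N_def norm_prod_def P_def Q_def flip: complex_norm_square)
  have "2 * (P * cnj Q) = of_real N * w"
    using 1 2 unfolding N by algebra
  then have 3: "2 * Re (P * cnj Q) = N * b$1" "2 * Im (P * cnj Q) = N * b$2"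
    by (simp_all add: complex_eq_iff w_def)
  have "P * cnj P - Q * cnj Q = of_real N * z"
    using 1 2 unfolding N by algebra
  then have "(cmod P)\<^sup>2 - (cmod Q)\<^sup>2 = N * b$3"
    unfolding complex_norm_square [symmetric] z_def by (metis of_real_diff of_real_eq_iff of_real_mult)
  with 3 show ?thesis
    unfolding N_def [symmetric] by (simp add: vec_eq_iff forall_3 hopf_def P_def Q_def)
qed

lemma hopf_csc_real: "hopf (csc (of_real t) g) = t\<^sup>2 *\<^sub>R hopf g"
  by (simp add: vec_eq_iff forall_3 hopf_def csc_def norm_mult power_mult_distrib algebra_simps power2_eq_square)

lemma transport:
  assumes "g \<in> S3c" "b \<in> S2" "b \<noteq> - hopf g"
  shows "transport b g \<in> S3c" "hopf (transport b g) = b"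
proof -
  have "b + hopf g \<noteq> 0"
    using assms(3) by (simp add: eq_neg_iff_add_eq_0)
  then have nz: "norm (spin_proj b g) \<noteq> 0"
    using norm_spin_proj[OF assms(1,2)] by simp
  show "transport b g \<in> S3c"
    using nz by (simp add: transport_def norm_csc norm_inverse)
  show "hopf (transport b g) = b"
    using nz unfolding transport_def hopf_csc_real hopf_spin_proj[OF assms(2)] scaleR_scaleR
    by (metis power_inverse left_inverse power_eq_0_iff scaleR_one)
qed

lemma continuous_on_spin_proj:
  assumes "continuous_on S b" "continuous_on S g"
  shows "continuous_on S (\<lambda>x. spin_proj (b x) (g x))"
  unfolding spin_proj_def Complex_eq by (intro continuous_intros assms)

lemma continuous_on_transport:
  assumes "continuous_on S b" "continuous_on S g"
    "\<And>x. x \<in> S \<Longrightarrow> g x \<in> S3c" "\<And>x. x \<in> S \<Longrightarrow> b x \<in> S2" "\<And>x. x \<in> S \<Longrightarrow> b x \<noteq> - hopf (g x)"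
  shows "continuous_on S (\<lambda>x. transport (b x) (g x))"
proof -
  have "norm (spin_proj (b x) (g x)) \<noteq> 0" if "x \<in> S" for x
    using assms(5)[OF that] norm_spin_proj[OF assms(3,4)[OF that]] by (simp add: eq_neg_iff_add_eq_0)
  then show ?thesis
    unfolding transport_def by (intro continuous_intros continuous_on_spin_proj assms) auto
qed

text \<open>Transport from \<open>(1, 0)\<close> reaches every point except the antipode of its Hopf
  image, and over that point lies \<open>(0, 1)\<close>.\<close>

lemma hopf_surj: assumes "b \<in> S2" obtains g where "g \<in> S3c" "hopf g = b"
proof (cases "b = - hopf (1, 0)")
  case True
  then have "hopf (0, 1) = b" by (simp add: hopf_def vec_eq_iff forall_3)
  then show ?thesis by (intro that[of "(0, 1)"]) (auto simp: norm_Pair)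
next
  case False
  then show ?thesis
    using transport[of "(1, 0)" b] assms by (intro that[of "transport b (1, 0)"]) (auto simp: norm_Pair)
qed

definition hopf_lift :: "'a::topological_space set \<Rightarrow> ('a \<Rightarrow> real^3) \<Rightarrow> ('a \<Rightarrow> complex \<times> complex) \<Rightarrow> bool" where
  "hopf_lift S f g \<longleftrightarrow> continuous_on S g \<and> g ` S \<subseteq> S3c \<and> (\<forall>x\<in>S. hopf (g x) = f x)"

text \<open>The new lift is an explicit pointwise function of the old one. This serves twice: for
  following a homotopy in small steps, and for a measurable choice of lifts.\<close>

lemma hopf_lift_near:
  assumes "hopf_lift S f g" "continuous_on S f'" "f' ` S \<subseteq> S2" "\<And>x. x \<in> S \<Longrightarrow> f' x \<noteq> - f x"
  shows "hopf_lift S f' (\<lambda>x. transport (f' x) (g x))"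
  unfolding hopf_lift_def
proof (intro conjI ballI)
  have *: "g x \<in> S3c" "f' x \<in> S2" "f' x \<noteq> - hopf (g x)" if "x \<in> S" for x
    using assms that by (auto simp: hopf_lift_def)
  then show "(\<lambda>x. transport (f' x) (g x)) ` S \<subseteq> S3c"
    using transport(1) by blast
  show "hopf (transport (f' x) (g x)) = f' x" if "x \<in> S" for x
    using * that transport(2) by blast
  show "continuous_on S (\<lambda>x. transport (f' x) (g x))"
    using * assms by (intro continuous_on_transport) (auto simp: hopf_lift_def)
qed

text \<open>No lifting of the whole homotopy is needed: it is cut into \<open>N\<close> time steps
  so short that no point moves to its antipode, and the lift is transported from one step to the
  next.\<close>

lemma hopf_lift_homotopic:
  fixes S :: "'a::metric_space set"
  assumes "homotopic_with_canon (\<lambda>_. True) S S2 f f'" "compact S" "hopf_lift S f g"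
  obtains g' where "hopf_lift S f' g'"
proof -
  obtain H :: "real \<times> 'a \<Rightarrow> real^3" where H: "continuous_on ({0..1} \<times> S) H" "H ` ({0..1} \<times> S) \<subseteq> S2"
      "\<And>x. H (0, x) = f x" "\<And>x. H (1, x) = f' x"
    using assms(1) unfolding homotopic_with_def by (auto simp: image_subset_iff_funcset)
  have "uniformly_continuous_on ({0..1} \<times> S) H"
    using H(1) assms(2) by (intro compact_uniformly_continuous compact_Times) auto
  \<comment> \<open>The bound 2 is the distance between antipodal points of the unit sphere.\<close>
  then obtain \<delta> where \<delta>: "\<delta> > 0" "\<And>y z. \<lbrakk>y \<in> {0..1} \<times> S; z \<in> {0..1} \<times> S; dist z y < \<delta>\<rbrakk> \<Longrightarrow> dist (H z) (H y) < 2"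
    unfolding uniformly_continuous_on_def by (metis zero_less_numeral)
  obtain N :: nat where N: "N > 0" "inverse (real N) < \<delta>"
    using ex_inverse_of_nat_less[OF \<delta>(1)] by auto
  have contH: "continuous_on S (\<lambda>x. H (t, x))" if "t \<in> {0..1}" for t
    by (rule continuous_on_compose2[OF H(1)]) (use that in \<open>auto intro!: continuous_intros\<close>)
  have "i \<le> N \<Longrightarrow> \<exists>g. hopf_lift S (\<lambda>x. H (real i / real N, x)) g" for i
  proof (induction i)
    case 0
    then show ?case using assms(3) H(3) by auto
  next
    case (Suc i)
    then obtain g where g: "hopf_lift S (\<lambda>x. H (real i / real N, x)) g" by auto
    have i: "real i / N \<in> {0..1}" "real (Suc i) / N \<in> {0..1}" using Suc N by auto
    have "hopf_lift S (\<lambda>x. H (real (Suc i) / real N, x)) (\<lambda>x. transport (H (real (Suc i) / real N, x)) (g x))"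
    proof (rule hopf_lift_near[OF g])
      show "continuous_on S (\<lambda>x. H (real (Suc i) / real N, x))" using contH i by blast
      show "(\<lambda>x. H (real (Suc i) / real N, x)) ` S \<subseteq> S2" using i H(2) by blast
      fix x assume x: "x \<in> S"
      have "dist (real (Suc i) / real N, x) (real i / N, x) < \<delta>"
      proof -
        have "dist (real (Suc i) / real N) (real i / N) = inverse (real N)"
          using N by (simp add: dist_real_def field_simps)
        then show ?thesis
          unfolding dist_Pair_Pair using N by simp
      qed
      then have "dist (H (real (Suc i) / real N, x)) (H (real i / N, x)) < 2"
        using \<delta>(2) i x by blast
      moreover have "norm (H (real i / N, x)) = 1"
      proof -
        have "(real i / N, x) \<in> {0..1} \<times> S" using i x by simp
        then have "H (real i / N, x) \<in> S2" using H(2) by blast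
        then show ?thesis by simp
      qed
      moreover have "dist (- v) v = 2 * norm v" for v :: "real^3"
      proof -
        have "- v - v = - (2 *\<^sub>R v)" by (simp add: scaleR_2)
        then show ?thesis by (metis dist_norm norm_minus_cancel norm_scaleR abs_numeral)
      qed
      ultimately show "H (real (Suc i) / real N, x) \<noteq> - H (real i / N, x)" by force
    qed
    then show ?case by blast
  qed
  from this[of N] N H(4) that show ?thesis by auto
qed

text \<open>The convex factor contracts to a point, and a map from the circle to the two-sphere is
  inessential for reasons of dimension. The factor is kept general so that the time interval of a
  homotopy can later be absorbed into it.\<close>

lemma homotopic_const_Circ_Times_convex:
  fixes C :: "'c::euclidean_space set" and f :: "complex \<times> 'c \<Rightarrow> real^3"
  assumes "convex C" "continuous_on (Circ \<times> C) f" "f ` (Circ \<times> C) \<subseteq> S2"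
  shows "\<exists>c\<in>S2. homotopic_with_canon (\<lambda>_. True) (Circ \<times> C) S2 f (\<lambda>_. c)"
proof (cases "C = {}")
  case True
  have "hopf (1, 0) \<in> S2" by (rule hopf_in_S2) (simp add: norm_Pair)
  then show ?thesis using True by (intro bexI[of _ "hopf (1, 0)"]) (simp_all add: homotopic_on_emptyI)
next
  case False
  then obtain c0 where c0: "c0 \<in> C" by blast
  have 1: "homotopic_with_canon (\<lambda>_. True) (Circ \<times> C) (Circ \<times> C) (\<lambda>y. y) (\<lambda>y. (fst y, c0))"
  proof (rule homotopic_with_linear)
    show "continuous_on (Circ \<times> C) (\<lambda>y. (fst y, c0))" by (intro continuous_intros)
    show "closed_segment y (fst y, c0) \<subseteq> Circ \<times> C" if "y \<in> Circ \<times> C" for y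
    proof
      fix z assume "z \<in> closed_segment y (fst y, c0)"
      then obtain t where t: "0 \<le> t" "t \<le> 1" "z = (1 - t) *\<^sub>R y + t *\<^sub>R (fst y, c0)"
        unfolding in_segment by blast
      have "fst z = fst y" "snd z = (1 - t) *\<^sub>R snd y + t *\<^sub>R c0"
        by (simp_all add: t(3) flip: scaleR_left_distrib)
      moreover have "(1 - t) *\<^sub>R snd y + t *\<^sub>R c0 \<in> C"
        using assms(1) that c0 t unfolding convex_alt by auto
      ultimately show "z \<in> Circ \<times> C"
        using that by (metis mem_Times_iff)
    qed
  qed (intro continuous_intros)
  have 2: "homotopic_with_canon (\<lambda>_. True) (Circ \<times> C) S2 (f \<circ> (\<lambda>y. y)) (f \<circ> (\<lambda>y. (fst y, c0)))"
    by (rule homotopic_with_compose_continuous_left[OF 1]) (use assms in auto)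
  obtain c where c: "homotopic_with_canon (\<lambda>_. True) Circ S2 (\<lambda>z. f (z, c0)) (\<lambda>_. c)"
  proof (rule inessential_spheremap_lowdim[where f = "\<lambda>z. f (z, c0)" and a = 0 and r = 1 and b = 0 and s = 1])
    show "continuous_on Circ (\<lambda>z. f (z, c0))"
      by (rule continuous_on_compose2[OF assms(2)]) (use c0 in \<open>auto intro!: continuous_intros\<close>)
    show "(\<lambda>z. f (z, c0)) \<in> Circ \<rightarrow> S2"
      using assms(3) c0 by auto
  qed (use that in auto)
  have 3: "homotopic_with_canon (\<lambda>_. True) (Circ \<times> C) S2 ((\<lambda>z. f (z, c0)) \<circ> fst) ((\<lambda>_. c) \<circ> fst)"
    by (rule homotopic_with_compose_continuous_right[OF c]) (auto intro!: continuous_intros)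
  have "homotopic_with_canon (\<lambda>_. True) (Circ \<times> C) S2 f (\<lambda>_. c)"
    using homotopic_with_trans[OF 2[unfolded o_def]] 3[unfolded o_def] by simp
  moreover have "c \<in> S2"
  proof -
    have "(1::complex) \<in> Circ" by simp
    then show ?thesis using homotopic_with_imp_subset2[OF c] by blast
  qed
  ultimately show ?thesis by blast
qed

text \<open>A constant map has a constant lift, which is carried backwards along a
  null-homotopy.\<close>

lemma hopf_lift_exists:
  fixes C :: "'c::euclidean_space set" and f :: "complex \<times> 'c \<Rightarrow> real^3"
  assumes "convex C" "compact C" "continuous_on (Circ \<times> C) f" "f ` (Circ \<times> C) \<subseteq> S2"
  obtains g where "hopf_lift (Circ \<times> C) f g"
proof -
  obtain c where c: "c \<in> S2" "homotopic_with_canon (\<lambda>_. True) (Circ \<times> C) S2 f (\<lambda>_. c)"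
    using homotopic_const_Circ_Times_convex[OF assms(1,3,4)] by blast
  obtain g0 where g0: "g0 \<in> S3c" "hopf g0 = c"
    using hopf_surj[OF c(1)] by blast
  have "hopf_lift (Circ \<times> C) (\<lambda>_. c) (\<lambda>_. g0)"
    using g0 by (auto simp: hopf_lift_def)
  moreover have "compact (Circ \<times> C)" using assms(2) by (intro compact_Times) auto
  ultimately show ?thesis
    using hopf_lift_homotopic[OF homotopic_with_symD[OF c(2)]] that by blast
qed

section \<open>Degrees of maps to the circle\<close>

lemma cis_eq_cis_imp:
  assumes "cis a = cis b" obtains n :: int where "a - b = of_int n * (2 * pi)"
proof -
  have "exp (\<i> * of_real a - \<i> * of_real b) = 1"
    using assms by (simp add: cis_conv_exp exp_diff)
  then show ?thesis using that unfolding exp_eq_1 by auto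
qed

lemma continuous_Ints_constant_on:
  fixes f :: "'a::topological_space \<Rightarrow> real"
  assumes "connected S" "continuous_on S f" "\<And>x. x \<in> S \<Longrightarrow> f x \<in> \<int>"
  shows "f constant_on S"
proof (rule continuous_discrete_range_constant[OF assms(1,2)])
  fix s assume s: "s \<in> S"
  have "1 \<le> norm (f y - f s)" if "y \<in> S \<and> f y \<noteq> f s" for y
    using Ints_nonzero_abs_ge1[OF Ints_diff[OF assms(3) assms(3)], of y s] s that by simp
  then show "\<exists>e>0. \<forall>y. y \<in> S \<and> f y \<noteq> f s \<longrightarrow> e \<le> norm (f y - f s)" by (intro exI[of _ 1]) simp
qed

text \<open>The degree is encoded by a normal form, a power of the circle coordinate times a
  globally defined phase, so that products, inverses and compositions become arithmetic of
  exponents. The real phase is also needed for itself: maps of equal degree differ by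
  \<open>cis\<close> of a real function, and such functions extend.\<close>

definition has_degree :: "'c::topological_space set \<Rightarrow> (complex \<times> 'c \<Rightarrow> complex) \<Rightarrow> int \<Rightarrow> bool" where
  "has_degree C u d \<longleftrightarrow> (\<exists>\<theta>::complex \<times> 'c \<Rightarrow> real. continuous_on (Circ \<times> C) \<theta> \<and>
     (\<forall>y\<in>Circ \<times> C. u y = fst y powi d * cis (\<theta> y)))"

lemma has_degreeI:
  assumes "continuous_on (Circ \<times> C) \<theta>" "\<And>y. y \<in> Circ \<times> C \<Longrightarrow> u y = fst y powi d * cis (\<theta> y)"
  shows "has_degree C u d"
  using assms unfolding has_degree_def by blast

lemma has_degree_powi: "has_degree C (\<lambda>y. fst y powi d) d"
  by (rule has_degreeI[where \<theta> = "\<lambda>_. 0"]) (auto intro: continuous_intros)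

lemma has_degree_mult:
  assumes "has_degree C u d" "has_degree C v k"
  shows "has_degree C (\<lambda>y. u y * v y) (d + k)"
proof -
  obtain \<theta> \<phi> where *: "continuous_on (Circ \<times> C) \<theta>" "continuous_on (Circ \<times> C) \<phi>"
    "\<And>y. y \<in> Circ \<times> C \<Longrightarrow> u y = fst y powi d * cis (\<theta> y)"
    "\<And>y. y \<in> Circ \<times> C \<Longrightarrow> v y = fst y powi k * cis (\<phi> y)"
    using assms unfolding has_degree_def by blast
  show ?thesis
  proof (rule has_degreeI)
    show "continuous_on (Circ \<times> C) (\<lambda>y. \<theta> y + \<phi> y)" using * by (intro continuous_intros)
    fix y assume y: "y \<in> Circ \<times> C"
    then have "fst y \<noteq> 0" by auto
    then show "u y * v y = fst y powi (d + k) * cis (\<theta> y + \<phi> y)"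
      using *(3,4)[OF y] by (simp add: power_int_add cis_mult [symmetric])
  qed
qed

lemma has_degree_inverse:
  assumes "has_degree C u d" shows "has_degree C (\<lambda>y. inverse (u y)) (- d)"
proof -
  obtain \<theta> where *: "continuous_on (Circ \<times> C) \<theta>"
    "\<And>y. y \<in> Circ \<times> C \<Longrightarrow> u y = fst y powi d * cis (\<theta> y)"
    using assms unfolding has_degree_def by blast
  show ?thesis
    by (rule has_degreeI[where \<theta> = "\<lambda>y. - \<theta> y"])
      (use * in \<open>auto simp: power_int_minus intro: continuous_intros\<close>)
qed

text \<open>Besides the bonding map, this covers \<open>p = 1\<close>, which freezes the parameter
  of a family of maps.\<close>

lemma has_degree_compose:
  assumes "has_degree C u d" "continuous_on (Circ \<times> D) e" "e ` (Circ \<times> D) \<subseteq> Circ \<times> C"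
    "\<And>y. y \<in> Circ \<times> D \<Longrightarrow> fst (e y) = fst y powi p"
  shows "has_degree D (\<lambda>y. u (e y)) (p * d)"
proof -
  obtain \<theta> where *: "continuous_on (Circ \<times> C) \<theta>"
    "\<And>y. y \<in> Circ \<times> C \<Longrightarrow> u y = fst y powi d * cis (\<theta> y)"
    using assms unfolding has_degree_def by blast
  show ?thesis
  proof (rule has_degreeI)
    show "continuous_on (Circ \<times> D) (\<lambda>y. \<theta> (e y))"
      using assms(3) by (intro continuous_on_compose2[OF *(1) assms(2)]) auto
    show "u (e y) = fst y powi (p * d) * cis (\<theta> (e y))" if "y \<in> Circ \<times> D" for y
      using *(2)[of "e y"] assms(3) assms(4)[OF that] that by (force simp: power_int_mult)
  qed
qed

text \<open>Unrolling the circle to a line makes the domain contractible, so a logarithm exists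
  there. Its increment over one period is an integer multiple of \<open>2 * pi\<close>, constant by
  connectedness, and this integer is the degree.\<close>

lemma has_degree_exists:
  fixes C :: "'c::euclidean_space set"
  assumes C: "convex C" "compact C" and u: "continuous_on (Circ \<times> C) u" "u ` (Circ \<times> C) \<subseteq> Circ"
  obtains d where "has_degree C u d"
proof -
  define f where "f = (\<lambda>s::real \<times> 'c. u (cis (fst s), snd s))"
  have cf: "continuous_on (UNIV \<times> C) f"
    unfolding f_def by (rule continuous_on_compose2[OF u(1)]) (auto intro!: continuous_intros)
  have fC: "f s \<in> Circ" if "s \<in> UNIV \<times> C" for s
    using u(2) that by (force simp: f_def)
  have conv: "convex ((UNIV::real set) \<times> C)"
    using C by (intro convex_Times) auto
  have nz: "f s \<noteq> 0" if "s \<in> UNIV \<times> C" for s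
    using fC[OF that] by auto
  obtain \<phi> where \<phi>: "continuous_on (UNIV \<times> C) \<phi>" "\<And>s. s \<in> UNIV \<times> C \<Longrightarrow> f s = exp (\<phi> s)"
    using continuous_logarithm_on_contractible[OF cf convex_imp_contractible[OF conv]] nz by blast
  define \<eta> where "\<eta> = (\<lambda>s. Im (\<phi> s))"
  have c\<eta>: "continuous_on (UNIV \<times> C) \<eta>" unfolding \<eta>_def by (intro continuous_intros \<phi>)
  have f\<eta>: "f s = cis (\<eta> s)" if "s \<in> UNIV \<times> C" for s
  proof -
    have "exp (Re (\<phi> s)) = 1" using fC[OF that] \<phi>(2)[OF that] by (simp add: norm_exp_eq_Re)
    then show ?thesis using \<phi>(2)[OF that] by (simp add: exp_eq_polar \<eta>_def)
  qed
  define D where "D = (\<lambda>s. (\<eta> (fst s + 2 * pi, snd s) - \<eta> s) / (2 * pi))"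
  have cD: "continuous_on (UNIV \<times> C) D"
    unfolding D_def by (intro continuous_intros c\<eta> continuous_on_compose2[OF c\<eta>]) auto
  have Dint: "D s \<in> \<int>" if "s \<in> UNIV \<times> C" for s
  proof -
    have "f (fst s + 2 * pi, snd s) = f s" by (simp add: f_def flip: cis_mult)
    then have "cis (\<eta> (fst s + 2 * pi, snd s)) = cis (\<eta> s)"
      using f\<eta>[OF that] f\<eta>[of "(fst s + 2 * pi, snd s)"] that by auto
    then obtain n :: int where "\<eta> (fst s + 2 * pi, snd s) - \<eta> s = of_int n * (2 * pi)"
      by (rule cis_eq_cis_imp)
    then show ?thesis by (simp add: D_def)
  qed
  have "D constant_on (UNIV \<times> C)"
    by (rule continuous_Ints_constant_on[OF convex_connected[OF conv] cD Dint])
  then obtain d' where d': "\<And>s. s \<in> UNIV \<times> C \<Longrightarrow> D s = d'" unfolding constant_on_def by blast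
  obtain d :: int where d: "\<And>s. s \<in> UNIV \<times> C \<Longrightarrow> D s = of_int d"
  proof (cases "C = {}")
    case False
    then show ?thesis using d' Dint Ints_cases that
      by (metis SigmaI UNIV_I ex_in_conv)
  qed (use that in auto)
  \<comment> \<open>Subtracting the linear growth makes the phase periodic, so that it descends to
    the circle.\<close>
  define \<theta>0 where "\<theta>0 = (\<lambda>s. \<eta> s - of_int d * fst s)"
  let ?e = "\<lambda>s::real \<times> 'c. (cis (fst s), snd s)"
  have img: "?e ` ({0..2*pi} \<times> C) = Circ \<times> C"
  proof
    show "Circ \<times> C \<subseteq> ?e ` ({0..2*pi} \<times> C)"
    proof
      fix y assume y: "y \<in> Circ \<times> C"
      then have "cis (Arg2pi (fst y)) = fst y" "0 \<le> Arg2pi (fst y)" "Arg2pi (fst y) < 2 * pi"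
        using Arg2pi[of "fst y"] by (auto simp: cis_conv_exp is_Arg_def)
      then show "y \<in> ?e ` ({0..2*pi} \<times> C)"
        using y by (intro image_eqI[of _ _ "(Arg2pi (fst y), snd y)"]) auto
    qed
  qed auto
  \<comment> \<open>A continuous surjection from a compact space to a Hausdorff space is a quotient
    map; a function that agrees over the two ends of the period therefore descends
    continuously.\<close>
  have q: "quotient_map (top_of_set ({0..2*pi} \<times> C)) (top_of_set (Circ \<times> C)) ?e"
  proof (rule T1_Spaces.continuous_imp_quotient_map)
    show "continuous_map (top_of_set ({0..2*pi} \<times> C)) (top_of_set (Circ \<times> C)) ?e"
      using img by (auto intro!: continuous_intros)
    show "compact_space (top_of_set ({0..2*pi} \<times> C))"
      using C compact_Times[of "{0..2*pi}" C] by (simp add: compact_space_subtopology)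
    show "Hausdorff_space (top_of_set (Circ \<times> C))"
      by (simp add: Hausdorff_space_subtopology)
  qed (use img in auto)
  have c: "continuous_map (top_of_set ({0..2*pi} \<times> C)) euclidean \<theta>0"
    unfolding \<theta>0_def by (auto intro!: continuous_intros continuous_on_subset[OF c\<eta>])
  have i: "\<theta>0 s = \<theta>0 t" if "s \<in> {0..2*pi} \<times> C" "t \<in> {0..2*pi} \<times> C" "?e s = ?e t" for s t
  proof -
    have per: "\<theta>0 (2 * pi, z) = \<theta>0 (0, z)" if "z \<in> C" for z
      using d[of "(0, z)"] that by (simp add: \<theta>0_def D_def field_simps)
    have eq: "snd s = snd t" "cis (fst s) = cis (fst t)" using that(3) by auto
    from eq(2) obtain n :: int where n: "fst s - fst t = of_int n * (2 * pi)"
      by (rule cis_eq_cis_imp)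
    have "fst s - fst t \<le> 2 * pi" "fst s - fst t \<ge> - (2 * pi)"
      using that(1,2) by auto
    then have "of_int n * (2 * pi) \<le> 1 * (2 * pi)" "of_int n * (2 * pi) \<ge> (- 1) * (2 * pi)"
      using n by simp_all
    then have "real_of_int n \<le> 1" "real_of_int n \<ge> - 1"
      by (simp_all only: mult_le_cancel_right) auto
    then have "n \<in> {-1, 0, 1}" by auto
    then have "fst s = fst t \<or> (fst s = 2 * pi \<and> fst t = 0) \<or> (fst s = 0 \<and> fst t = 2 * pi)"
      using n that(1,2) by auto
    then show ?thesis
      using per[of "snd s"] eq that(1,2) by (cases s; cases t) auto
  qed
  obtain \<theta> where \<theta>: "continuous_map (top_of_set (Circ \<times> C)) euclidean \<theta>"
      "\<And>s. s \<in> {0..2*pi} \<times> C \<Longrightarrow> \<theta> (?e s) = \<theta>0 s"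
  proof (rule quotient_map_lift_exists[OF q c])
    show "\<theta>0 s = \<theta>0 t" if "s \<in> topspace (top_of_set ({0..2*pi} \<times> C))"
        "t \<in> topspace (top_of_set ({0..2*pi} \<times> C))" "?e s = ?e t" for s t
      using that(1,2) unfolding topspace_euclidean_subtopology by (rule i) (rule that(3))
    fix g assume "continuous_map (top_of_set (Circ \<times> C)) euclidean g"
      "\<And>s. s \<in> topspace (top_of_set ({0..2*pi} \<times> C)) \<Longrightarrow> g (?e s) = \<theta>0 s"
    then show thesis
      unfolding topspace_euclidean_subtopology by (rule that)
  qed
  have "has_degree C u d"
  proof (rule has_degreeI)
    show "continuous_on (Circ \<times> C) \<theta>" using \<theta>(1) by simp
    fix y assume "y \<in> Circ \<times> C"
    then obtain s where s: "s \<in> {0..2*pi} \<times> C" "y = ?e s" using img by blast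
    then have "u y = cis (\<eta> s)" using f\<eta>[of s] by (auto simp: f_def)
    also have "\<eta> s = of_int d * fst s + \<theta> y" using \<theta>(2)[OF s(1)] s(2) by (simp add: \<theta>0_def)
    finally show "u y = fst y powi d * cis (\<theta> y)"
      using s(2) by (simp add: cis_power_int cis_mult [symmetric])
  qed
  then show ?thesis using that by blast
qed

text \<open>The quotient of \<open>u\<close> by itself is 1 and has degree \<open>d - k\<close>.
  Along the unrolled circle the total angle, measured in full turns, is then an integer, hence
  constant, while over one period it grows by \<open>d - k\<close>.\<close>

lemma has_degree_unique:
  assumes "has_degree C u d" "has_degree C u k" "C \<noteq> {}"
  shows "d = k"
proof -
  obtain c where c: "c \<in> C" using assms(3) by blast
  have "has_degree C (\<lambda>y. u y * inverse (u y)) (d + - k)"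
    using has_degree_mult[OF assms(1) has_degree_inverse[OF assms(2)]] .
  then obtain \<theta> where \<theta>: "continuous_on (Circ \<times> C) \<theta>"
    "\<And>y. y \<in> Circ \<times> C \<Longrightarrow> u y * inverse (u y) = fst y powi (d - k) * cis (\<theta> y)"
    unfolding has_degree_def by auto
  define m where "m = (\<lambda>t. (of_int (d - k) * t + \<theta> (cis t, c)) / (2 * pi))"
  have cm: "continuous_on UNIV m"
    unfolding m_def using c
    by (intro continuous_intros continuous_on_compose2[OF \<theta>(1)]) auto
  have mint: "m t \<in> \<int>" for t
  proof -
    have "(cis t, c) \<in> Circ \<times> C" using c by simp
    note e = \<theta>(2)[OF this]
    have "fst (cis t, c) powi (d - k) * cis (\<theta> (cis t, c)) \<noteq> 0" by simp
    with e have "u (cis t, c) \<noteq> 0" by auto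
    with e have "cis (of_int (d - k) * t + \<theta> (cis t, c)) = 1"
      by (simp add: cis_power_int cis_mult)
    then obtain n :: int where "of_int (d - k) * t + \<theta> (cis t, c) - 0 = of_int n * (2 * pi)"
      using cis_eq_cis_imp[of _ 0] by (metis cis_zero)
    then show ?thesis unfolding m_def by simp
  qed
  have "m constant_on UNIV"
    by (rule continuous_Ints_constant_on[OF connected_UNIV cm mint])
  then have "m (2 * pi) = m 0" unfolding constant_on_def by (metis UNIV_I)
  then show ?thesis by (simp add: m_def)
qed

lemma has_degree_cong:
  "(\<And>y. y \<in> Circ \<times> C \<Longrightarrow> u y = v y) \<Longrightarrow> has_degree C u d \<longleftrightarrow> has_degree C v d"
  unfolding has_degree_def by auto

section \<open>Extending maps into the three-sphere\<close>

text \<open>Quaternion multiplication, with \<open>(a, b)\<close> standing for a + b j. In this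
  convention \<open>csc u\<close> is left multiplication by the complex number \<open>u\<close>,
  which commutes with multiplication from the right.\<close>

definition qmul :: "complex \<times> complex \<Rightarrow> complex \<times> complex \<Rightarrow> complex \<times> complex" where
  "qmul g x = (fst g * fst x - snd g * cnj (snd x), fst g * snd x + snd g * cnj (fst x))"

definition qinv :: "complex \<times> complex \<Rightarrow> complex \<times> complex" where
  "qinv g = (cnj (fst g), - snd g)"

lemma S3c_iff_cnj: "g \<in> S3c \<longleftrightarrow> fst g * cnj (fst g) + snd g * cnj (snd g) = 1"
  unfolding S3c_iff complex_norm_square [symmetric] of_real_add [symmetric] of_real_eq_1_iff ..

lemma qmul_in_S3c: assumes "g \<in> S3c" "x \<in> S3c" shows "qmul g x \<in> S3c"
  using assms unfolding S3c_iff_cnj qmul_def by simp algebra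

lemma qinv_in_S3c: "g \<in> S3c \<Longrightarrow> qinv g \<in> S3c"
  by (simp add: qinv_def norm_prod_def)

lemma qmul_qinv_left: "g \<in> S3c \<Longrightarrow> qmul (qinv g) (qmul g x) = x"
  unfolding S3c_iff_cnj qmul_def qinv_def by (intro prod_eqI) (simp_all, algebra+)

lemma qmul_qinv_right: "g \<in> S3c \<Longrightarrow> qmul g (qmul (qinv g) x) = x"
  unfolding S3c_iff_cnj qmul_def qinv_def by (intro prod_eqI) (simp_all, algebra+)

lemma qmul_csc: "qmul (csc u g) x = csc u (qmul g x)"
  by (simp add: qmul_def csc_def algebra_simps)

lemma qmul_one [simp]: "qmul g (1, 0) = g"
  by (simp add: qmul_def)

text \<open>A common phase on the left cancels in the quotient. If two lifts pick up the same phase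
  from one torus to the next, their quotients fit together.\<close>

lemma qmul_qinv_csc:
  assumes "u \<in> Circ" "g \<in> S3c" shows "qmul (qinv (csc u g)) (csc u x) = qmul (qinv g) x"
  by (metis assms csc_in_S3c qmul_csc qmul_qinv_left qmul_qinv_right)

lemma continuous_on_qmul [continuous_intros]:
  "continuous_on S g \<Longrightarrow> continuous_on S x \<Longrightarrow> continuous_on S (\<lambda>y. qmul (g y) (x y))"
  unfolding qmul_def by (intro continuous_intros)

lemma continuous_on_qinv [continuous_intros]:
  "continuous_on S g \<Longrightarrow> continuous_on S (\<lambda>y. qinv (g y))"
  unfolding qinv_def by (intro continuous_intros)

lemma one_in_S3c: "(1, 0) \<in> S3c"
  by (simp add: norm_Pair)

text \<open>Polar coordinates: the real part of the disc coordinate becomes the logarithm of the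
  radius, the imaginary part the height. The circle times the plane is thus identified with the
  punctured plane times a line.\<close>

definition flatten :: "complex \<times> complex \<Rightarrow> complex \<times> real" where
  "flatten y = (of_real (exp (Re (snd y))) * fst y, Im (snd y))"

definition unflatten :: "complex \<times> real \<Rightarrow> complex \<times> complex" where
  "unflatten x = (fst x / of_real (norm (fst x)), Complex (ln (norm (fst x))) (snd x))"

lemma unflatten_flatten: "y \<in> Circ \<times> UNIV \<Longrightarrow> unflatten (flatten y) = y"
  by (auto simp: flatten_def unflatten_def norm_mult complex_eq_iff)

lemma continuous_on_flatten: "continuous_on S flatten"
  unfolding flatten_def by (intro continuous_intros)

text \<open>The thickened circle is three-dimensional although it sits in a four-dimensional space;
  flattening it into \<open>complex \<times> real\<close> brings the obstruction-free range of the extension theorem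
  for cell complexes into play.\<close>

lemma extend_to_box:
  fixes C :: "complex set"
  assumes S: "compact S" "S \<subseteq> Circ \<times> UNIV" and C: "compact C"
    and f: "continuous_on S f" "f ` S \<subseteq> S3c"
  obtains B g where "convex B" "flatten ` (Circ \<times> C) \<subseteq> B" "continuous_on B g" "g ` B \<subseteq> S3c"
    "\<And>y. y \<in> S \<Longrightarrow> g (flatten y) = f y"
proof -
  have "compact (flatten ` (S \<union> Circ \<times> C))"
    using S C by (intro compact_continuous_image continuous_on_flatten compact_Un compact_Times) auto
  then obtain a where a: "flatten ` (S \<union> Circ \<times> C) \<subseteq> cbox (- a) a"
    using bounded_subset_cbox_symmetric compact_imp_bounded by blast
  have uf: "unflatten (flatten y) = y" if "y \<in> S" for y
    using S(2) that by (intro unflatten_flatten) blast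
  have cf: "continuous_on (flatten ` S) (f \<circ> unflatten)"
  proof (rule continuous_on_compose)
    have nz: "fst x \<noteq> 0" if "x \<in> flatten ` S" for x
      using that S(2) by (auto simp: flatten_def)
    show "continuous_on (flatten ` S) unflatten"
      unfolding unflatten_def Complex_eq using nz by (intro continuous_intros) auto
    have "unflatten ` flatten ` S = S"
      using uf by (simp add: image_image)
    then show "continuous_on (unflatten ` flatten ` S) f" using f(1) by simp
  qed
  obtain g where g: "continuous_on (\<Union>{cbox (- a) a}) g"
      "g ` \<Union>{cbox (- a) a} \<subseteq> rel_frontier (cball 0 1)" "\<And>x. x \<in> flatten ` S \<Longrightarrow> g x = (f \<circ> unflatten) x"
  proof (rule extend_map_cell_complex_to_sphere[where \<F> = "{cbox (- a) a}" and S = "flatten ` S"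
        and T = "cball (0::complex \<times> complex) 1" and f = "f \<circ> unflatten"])
    show "closed (flatten ` S)"
      using S by (intro compact_imp_closed compact_continuous_image continuous_on_flatten)
    \<comment> \<open>The cell complex consists of one box of dimension at most 3; the sphere bounds
      a ball of dimension 4. This strict inequality is the whole reason why the extension
      exists.\<close>
    show "aff_dim X < aff_dim (cball (0::complex \<times> complex) 1)" if "X \<in> {cbox (- a) a}" for X
      using aff_dim_le_DIM[of X] by (simp add: aff_dim_cball)
    show "f \<circ> unflatten \<in> flatten ` S \<rightarrow> rel_frontier (cball 0 1)"
      using f(2) uf by auto
    show "polytope X" if "X \<in> {cbox (- a) a}" for X
      using that by (simp add: polytope_interval)
    show "X \<inter> Y face_of X" if "X \<in> {cbox (- a) a}" "Y \<in> {cbox (- a) a}" for X Y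
      using that by (simp add: face_of_refl)
    show "flatten ` S \<subseteq> \<Union>{cbox (- a) a}" using a by auto
  qed (use cf that in \<open>auto simp: image_subset_iff_funcset\<close>)
  show ?thesis
  proof
    show "flatten ` (Circ \<times> C) \<subseteq> cbox (- a) a" using a by auto
    show "continuous_on (cbox (- a) a) g" using g by simp
    show "g ` cbox (- a) a \<subseteq> S3c" using g(2) by simp
    show "g (flatten y) = f y" if "y \<in> S" for y
      using g(3)[of "flatten y"] that uf by auto
  qed simp
qed

lemma extend_to_S3c:
  fixes C :: "complex set"
  assumes "compact S" "S \<subseteq> Circ \<times> UNIV" "compact C" "continuous_on S f" "f ` S \<subseteq> S3c"
  obtains g where "continuous_on (Circ \<times> C) g" "g ` (Circ \<times> C) \<subseteq> S3c" "\<And>y. y \<in> S \<Longrightarrow> g y = f y"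
proof -
  obtain B h where h: "convex B" "flatten ` (Circ \<times> C) \<subseteq> B" "continuous_on B h" "h ` B \<subseteq> S3c"
    "\<And>y. y \<in> S \<Longrightarrow> h (flatten y) = f y"
    using extend_to_box[OF assms] by metis
  show ?thesis
  proof
    show "continuous_on (Circ \<times> C) (\<lambda>y. h (flatten y))"
      by (rule continuous_on_compose2[OF h(3) continuous_on_flatten h(2)])
    show "(\<lambda>y. h (flatten y)) ` (Circ \<times> C) \<subseteq> S3c" using h by blast
  qed (use h in auto)
qed

text \<open>Extended over the box, the map factors through a convex set. This is why
  \<open>extend_to_box\<close> returns the box and not only the restriction to the torus.\<close>

lemma nullhomotopic_to_S3c:
  fixes C :: "complex set"
  assumes "compact C" "continuous_on (Circ \<times> C) q" "q ` (Circ \<times> C) \<subseteq> S3c"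
  shows "homotopic_with_canon (\<lambda>_. True) (Circ \<times> C) S3c q (\<lambda>_. (1, 0))"
proof -
  have "compact (Circ \<times> C)" using assms(1) by (intro compact_Times) auto
  then obtain B h where h: "convex B" "flatten ` (Circ \<times> C) \<subseteq> B" "continuous_on B h" "h ` B \<subseteq> S3c"
    "\<And>y. y \<in> Circ \<times> C \<Longrightarrow> h (flatten y) = q y"
    using extend_to_box[of "Circ \<times> C" C q] assms by blast
  obtain c where c: "homotopic_with_canon (\<lambda>_. True) (Circ \<times> C) S3c (h \<circ> flatten) (\<lambda>_. c)"
    using nullhomotopic_through_contractible[of "Circ \<times> C" flatten B h S3c]
      continuous_on_flatten h convex_imp_contractible
    unfolding image_subset_iff_funcset by metis
  have "homotopic_with_canon (\<lambda>_. True) (Circ \<times> C) S3c (\<lambda>_. c) (\<lambda>_. (1, 0))"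
  \<comment> \<open>Over an empty domain nothing forces \<open>c\<close> to lie on the
    sphere.\<close>
  proof (cases "Circ \<times> C = {}")
    case False
    then have "c \<in> S3c" using homotopic_with_imp_subset2[OF c] by blast
    moreover have "path_connected S3c"
      by (rule path_connected_sphere) simp
    ultimately show ?thesis
      using one_in_S3c by (auto simp: homotopic_constant_maps path_connected_component)
  qed (auto simp: homotopic_constant_maps)
  then have "homotopic_with_canon (\<lambda>_. True) (Circ \<times> C) S3c (h \<circ> flatten) (\<lambda>_. (1, 0))"
    using c homotopic_with_trans by blast
  then show ?thesis
    by (rule homotopic_with_eq) (use h in auto)
qed

section \<open>Loops of maps into the three-sphere and the prolongation of null-homotopies\<close>

abbreviation I01 :: "real set" where "I01 \<equiv> {0..1}"

abbreviation based_ends :: "'a set \<Rightarrow> (real \<times> 'a \<Rightarrow> complex \<times> complex) \<Rightarrow> bool" where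
  "based_ends K h \<equiv> \<forall>y\<in>K. h (0, y) = (1, 0) \<and> h (1, y) = (1, 0)"

lemma homotopic_based_endsI:
  assumes "continuous_on (I01 \<times> (I01 \<times> K)) h"
    "h ` (I01 \<times> (I01 \<times> K)) \<subseteq> S3c"
    "\<And>x. x \<in> I01 \<times> K \<Longrightarrow> h (0, x) = p x" "\<And>x. x \<in> I01 \<times> K \<Longrightarrow> h (1, x) = q x"
    "\<And>s y. s \<in> I01 \<Longrightarrow> y \<in> K \<Longrightarrow> h (s, (0, y)) = (1, 0) \<and> h (s, (1, y)) = (1, 0)"
  shows "homotopic_with_canon (based_ends K) (I01 \<times> K) S3c p q"
proof (subst homotopic_with)
  show "\<exists>h. continuous_map (prod_topology (top_of_set I01) (top_of_set (I01 \<times> K)))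
         (top_of_set S3c) h \<and>
        (\<forall>x\<in>topspace (top_of_set (I01 \<times> K)). h (0, x) = p x) \<and>
        (\<forall>x\<in>topspace (top_of_set (I01 \<times> K)). h (1, x) = q x) \<and>
        (\<forall>t\<in>I01. based_ends K (\<lambda>x. h (t, x)))"
    using assms by (intro exI[of _ h]) (auto simp: image_subset_iff_funcset)
qed auto

text \<open>Contracting \<open>C\<close> to a point \<open>c\<close> leaves a loop parametrised by
  the circle. A null-homotopy of it is a map on the circle times a square with prescribed values
  over the boundary of the square. With the square placed in the complex plane this is an instance
  of \<open>extend_to_S3c\<close>.\<close>

lemma based_loop_nullhomotopic:
  fixes C :: "complex set"
  assumes C: "convex C" "compact C"
    and M: "continuous_on (I01 \<times> (Circ \<times> C)) M" "M ` (I01 \<times> (Circ \<times> C)) \<subseteq> S3c"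
      "based_ends (Circ \<times> C) M"
  shows "homotopic_with_canon (based_ends (Circ \<times> C)) (I01 \<times> (Circ \<times> C)) S3c M (\<lambda>_. (1, 0))"
proof (cases "C = {}")
  case False
  then obtain c where c: "c \<in> C" by blast
  let ?K = "Circ \<times> C"
  let ?M = "\<lambda>x. M (fst x, (fst (snd x), c))"
  have conv: "(1 - s) *\<^sub>R z + s *\<^sub>R c \<in> C" if "s \<in> I01" "z \<in> C" for s z
    using C(1) c that unfolding convex_alt by auto
  have 1: "homotopic_with_canon (based_ends ?K) (I01 \<times> ?K) S3c M ?M"
  proof (rule homotopic_based_endsI)
    let ?h = "\<lambda>x. M (fst (snd x), (fst (snd (snd x)), (1 - fst x) *\<^sub>R snd (snd (snd x)) + fst x *\<^sub>R c))"
    show "continuous_on (I01 \<times> (I01 \<times> ?K)) ?h"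
      by (rule continuous_on_compose2[OF M(1)]) (use conv in \<open>auto intro!: continuous_intros\<close>)
    show "?h ` (I01 \<times> (I01 \<times> ?K)) \<subseteq> S3c"
    proof (rule image_subsetI)
      fix x assume "x \<in> I01 \<times> (I01 \<times> ?K)"
      then have "(fst (snd x), (fst (snd (snd x)), (1 - fst x) *\<^sub>R snd (snd (snd x)) + fst x *\<^sub>R c)) \<in> I01 \<times> ?K"
        using conv by auto
      then show "?h x \<in> S3c" using M(2) by blast
    qed
    show "?h (s, (0, y)) = (1, 0) \<and> ?h (s, (1, y)) = (1, 0)" if "s \<in> I01" "y \<in> ?K" for s y
    proof -
      have "(fst y, (1 - s) *\<^sub>R snd y + s *\<^sub>R c) \<in> ?K" using conv that by auto
      then show ?thesis using M(3) by simp
    qed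
  qed auto
  define Sq where "Sq = {w. Re w \<in> I01 \<and> Im w \<in> I01 \<and> (Re w \<in> {0, 1} \<or> Im w \<in> {0, 1})}"
  \<comment> \<open>The real part is the loop parameter, the imaginary part the time of the
    homotopy: the contracted loop stands on the bottom edge, the base point on the other three. At
    the bottom corners both agree because the loop is based.\<close>
  define F where "F = (\<lambda>y. if Im (snd y) = 0 then M (Re (snd y), (fst y, c)) else (1, 0))"
  have cSq: "compact Sq"
  proof -
    have "Sq = {w. Re w \<in> I01 \<and> Im w \<in> I01 \<and> Re w * (1 - Re w) * (Im w * (1 - Im w)) = 0}"
      unfolding Sq_def by auto
    also have "\<dots> = cbox 0 (Complex 1 1) \<inter> {w. Re w * (1 - Re w) * (Im w * (1 - Im w)) = 0}"
      by (auto simp: in_cbox_complex_iff)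
    also have "compact \<dots>"
      by (intro compact_Int_closed compact_cbox closed_Collect_eq continuous_intros)
    finally show ?thesis .
  qed
  have Fe: "F y = (1, 0)" if "y \<in> Circ \<times> Sq" "Im (snd y) \<noteq> 0 \<or> Re (snd y) \<in> {0, 1}" for y
    using that M(3) c by (auto simp: F_def)
  have "continuous_on (Circ \<times> Sq) F"
  proof -
    let ?A = "(Circ \<times> Sq) \<inter> {y. Im (snd y) = 0}"
    let ?B = "(Circ \<times> Sq) \<inter> ({y. Im (snd y) = 1} \<union> ({y. Re (snd y) = 0} \<union> {y. Re (snd y) = 1}))"
    have closed: "closed (Circ \<times> Sq)"
      using cSq by (intro compact_imp_closed compact_Times) auto
    have "continuous_on (?A \<union> ?B) F"
    proof (rule continuous_on_closed_Un)
      show "closed ?A" "closed ?B"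
        by (intro closed_Int closed closed_Un closed_Collect_eq continuous_intros)+
      have "continuous_on ?A (\<lambda>y. M (Re (snd y), (fst y, c)))"
        by (rule continuous_on_compose2[OF M(1)]) (use c in \<open>auto intro!: continuous_intros simp: Sq_def\<close>)
      then show "continuous_on ?A F" by (rule continuous_on_eq) (simp add: F_def)
      show "continuous_on ?B F"
        by (rule continuous_on_eq[OF continuous_on_const[of _ "(1, 0)"]]) (subst Fe, auto)
    qed
    moreover have "?A \<union> ?B = Circ \<times> Sq"
      unfolding Sq_def by auto
    ultimately show ?thesis by simp
  qed
  moreover have "F ` (Circ \<times> Sq) \<subseteq> S3c"
    using M(2) c by (auto simp: F_def Sq_def one_in_S3c)
  ultimately obtain g where g: "continuous_on (Circ \<times> cbox 0 (Complex 1 1)) g"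
      "g ` (Circ \<times> cbox 0 (Complex 1 1)) \<subseteq> S3c" "\<And>y. y \<in> Circ \<times> Sq \<Longrightarrow> g y = F y"
    using extend_to_S3c[of "Circ \<times> Sq" "cbox 0 (Complex 1 1)" F] cSq
    by (metis compact_Times compact_cbox compact_sphere Sigma_mono subset_UNIV order_refl)
  have 2: "homotopic_with_canon (based_ends ?K) (I01 \<times> ?K) S3c ?M (\<lambda>_. (1, 0))"
  proof (rule homotopic_based_endsI)
    let ?h = "\<lambda>x. g (fst (snd (snd x)), Complex (fst (snd x)) (fst x))"
    show "continuous_on (I01 \<times> (I01 \<times> ?K)) ?h"
      unfolding Complex_eq
      by (rule continuous_on_compose2[OF g(1)]) (auto intro!: continuous_intros simp: in_cbox_complex_iff)
    show "?h ` (I01 \<times> (I01 \<times> ?K)) \<subseteq> S3c"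
      using g(2) by (auto simp: in_cbox_complex_iff)
    show "?h (0, x) = ?M x" if "x \<in> I01 \<times> ?K" for x
      using g(3)[of "(fst (snd x), Complex (fst x) 0)"] that by (auto simp: Sq_def F_def)
    show "?h (1, x) = (1, 0)" if "x \<in> I01 \<times> ?K" for x
      using g(3)[of "(fst (snd x), Complex (fst x) 1)"] that by (auto simp: Sq_def F_def)
    show "?h (s, (0, y)) = (1, 0) \<and> ?h (s, (1, y)) = (1, 0)" if "s \<in> I01" "y \<in> ?K" for s y
      using g(3)[of "(fst y, Complex 0 s)"] g(3)[of "(fst y, Complex 1 s)"]
        Fe[of "(fst y, Complex 0 s)"] Fe[of "(fst y, Complex 1 s)"] that by (auto simp: Sq_def)
  qed
  show ?thesis using homotopic_with_trans[OF 1 2] .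
qed (auto simp: homotopic_on_emptyI)

text \<open>A null-homotopy given on the inner solid torus is prolonged to the outer one: it differs from an
  arbitrary null-homotopy on the outer torus by a based loop of maps, which is null-homotopic and
  therefore extends.\<close>

lemma homotopy_step:
  fixes C :: "complex set" and e :: "complex \<times> complex \<Rightarrow> complex \<times> complex"
  assumes C: "convex C" "compact C" "C \<noteq> {}"
    and e: "continuous_on (Circ \<times> C) e" "inj_on e (Circ \<times> C)" "e ` (Circ \<times> C) \<subseteq> Circ \<times> C"
    and q: "continuous_on (Circ \<times> C) q" "q ` (Circ \<times> C) \<subseteq> S3c"
    and Q: "continuous_on (I01 \<times> (Circ \<times> C)) Q" "Q ` (I01 \<times> (Circ \<times> C)) \<subseteq> S3c"
      "\<And>y. y \<in> Circ \<times> C \<Longrightarrow> Q (0, y) = q (e y) \<and> Q (1, y) = (1, 0)"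
  obtains Q' where "continuous_on (I01 \<times> (Circ \<times> C)) Q'"
    "Q' ` (I01 \<times> (Circ \<times> C)) \<subseteq> S3c"
    "\<And>y. y \<in> Circ \<times> C \<Longrightarrow> Q' (0, y) = q y \<and> Q' (1, y) = (1, 0)"
    "\<And>t y. t \<in> I01 \<Longrightarrow> y \<in> Circ \<times> C \<Longrightarrow> Q' (t, e y) = Q (t, y)"
proof -
  define K where "K = Circ \<times> C"
  note * = e[folded K_def] q[folded K_def] Q[folded K_def]
  have cK: "compact K" unfolding K_def using C by (intro compact_Times) auto
  have "homotopic_with_canon (\<lambda>_. True) K S3c q (\<lambda>_. (1, 0))"
    unfolding K_def using C q by (intro nullhomotopic_to_S3c)
  then obtain R where R: "continuous_on (I01 \<times> K) R" "R ` (I01 \<times> K) \<subseteq> S3c"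
      "\<And>y. R (0, y) = q y" "\<And>y. R (1, y) = (1, 0)"
    unfolding homotopic_with_def by (auto simp: image_subset_iff_funcset)
  \<comment> \<open>The quotient of two paths of maps on the inner torus: the given \<open>Q\<close>
    and the restriction of \<open>R\<close>. Both lead from \<open>q\<close> composed with
    \<open>e\<close> to the base point, so \<open>M\<close> is a based loop.\<close>
  define M where "M = (\<lambda>x. qmul (qinv (R (fst x, e (snd x)))) (Q x))"
  have Re: "R (t, e y) \<in> S3c" if "t \<in> I01" "y \<in> K" for t y
    using that R(2) *(3) by blast
  have M: "continuous_on (I01 \<times> K) M" "M ` (I01 \<times> K) \<subseteq> S3c"
    unfolding M_def
  proof -
    show "continuous_on (I01 \<times> K) (\<lambda>x. qmul (qinv (R (fst x, e (snd x)))) (Q x))"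
      by (intro continuous_intros * continuous_on_compose2[OF R(1)] continuous_on_compose2[OF *(1)])
        (use *(3) in auto)
    show "(\<lambda>x. qmul (qinv (R (fst x, e (snd x)))) (Q x)) ` (I01 \<times> K) \<subseteq> S3c"
    proof (rule image_subsetI)
      fix x assume x: "x \<in> I01 \<times> K"
      then have "R (fst x, e (snd x)) \<in> S3c" using Re by (simp add: mem_Times_iff)
      moreover have "Q x \<in> S3c" using x *(7) by blast
      ultimately
      show "qmul (qinv (R (fst x, e (snd x)))) (Q x) \<in> S3c"
        by (intro qmul_in_S3c qinv_in_S3c)
    qed
  qed
  have "based_ends K M"
  proof (intro ballI conjI)
    fix y assume y: "y \<in> K"
    then have qe: "q (e y) \<in> S3c" using * by blast
    show "M (0, y) = (1, 0)"
      using qmul_qinv_left[OF qe, of "(1, 0)"] R(3) *(8)[OF y] by (simp add: M_def)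
    show "M (1, y) = (1, 0)"
      using R(4) *(8)[OF y] by (simp add: M_def qinv_def)
  qed
  then have "homotopic_with_canon (based_ends K) (I01 \<times> K) S3c M (\<lambda>_. (1, 0))"
    unfolding K_def using C M by (intro based_loop_nullhomotopic) (simp_all add: K_def)
  then obtain H where H: "continuous_on (I01 \<times> (I01 \<times> K)) H"
      "H ` (I01 \<times> (I01 \<times> K)) \<subseteq> S3c" "\<And>x. H (0, x) = M x" "\<And>x. H (1, x) = (1, 0)"
      "\<And>s. s \<in> I01 \<Longrightarrow> based_ends K (\<lambda>x. H (s, x))"
    unfolding homotopic_with_def by (auto simp: image_subset_iff_funcset)
  define A where "A = e ` K"
  define e' where "e' = inv_into K e"
  have e'e: "e' (e y) = y" if "y \<in> K" for y using that *(2) by (simp add: e'_def)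
  have e': "continuous_on A e'" "\<And>x. x \<in> A \<Longrightarrow> e' x \<in> K"
    unfolding A_def using e'e * cK by (auto intro!: continuous_on_inv)
  have cA: "compact A" unfolding A_def using * cK by (intro compact_continuous_image)
  have "A \<subseteq> K" using *(3) by (simp add: A_def)
  \<comment> \<open>The part of the cylinder where the correction of \<open>R\<close> is prescribed:
    all times over the inner torus, and both end times over the outer one, where it must be
    trivial.\<close>
  define Y where "Y = I01 \<times> A \<union> {0, 1} \<times> K"
  define L where "L = (\<lambda>x. if snd x \<in> A then M (fst x, e' (snd x)) else (1, 0))"
  \<comment> \<open>The contraction of the loop stays based at every time, so it continues by the
    constant \<open>(1, 0)\<close> to the two ends over the outer torus.\<close>
  define H' where "H' = (\<lambda>x::real \<times> real \<times> complex \<times> complex.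
    if snd (snd x) \<in> A then H (fst x, (fst (snd x), e' (snd (snd x)))) else (1, 0))"
  have cY: "compact Y"
    unfolding Y_def using cK cA by (intro compact_Un compact_Times) auto
  have "A \<noteq> {}" using C by (auto simp: A_def K_def intro: exI[of _ 1])
  have H'1: "H' x = (1, 0)" if "x \<in> I01 \<times> ({0, 1} \<times> K)" for x
    using that H(5)[of "fst x"] e'(2)[of "snd (snd x)"] by (auto simp: H'_def)
  have cH': "continuous_on (I01 \<times> (I01 \<times> A) \<union> I01 \<times> ({0, 1} \<times> K)) H'"
  proof (rule continuous_on_closed_Un)
    show "closed (I01 \<times> (I01 \<times> A))" "closed (I01 \<times> ({0::real, 1} \<times> K))"
      using cA cK by (intro compact_imp_closed compact_Times; auto)+
    have "continuous_on (I01 \<times> (I01 \<times> A)) (\<lambda>x. H (fst x, (fst (snd x), e' (snd (snd x)))))"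
      by (rule continuous_on_compose2[OF H(1)])
        (use e' in \<open>auto intro!: continuous_intros continuous_on_compose2[OF e'(1)]\<close>)
    then show "continuous_on (I01 \<times> (I01 \<times> A)) H'"
      by (rule continuous_on_eq) (auto simp: H'_def)
    show "continuous_on (I01 \<times> ({0, 1} \<times> K)) H'"
      by (rule continuous_on_eq[OF continuous_on_const[of _ "(1, 0)"]]) (simp add: H'1)
  qed
  have "homotopic_with_canon (\<lambda>_. True) Y S3c L (\<lambda>_. (1, 0))"
  proof (subst homotopic_with)
    have "H' ` (I01 \<times> Y) \<subseteq> S3c"
    proof (rule image_subsetI)
      fix x assume x: "x \<in> I01 \<times> Y"
      show "H' x \<in> S3c"
      proof (cases "snd (snd x) \<in> A")
        case True
        then have "(fst x, (fst (snd x), e' (snd (snd x)))) \<in> I01 \<times> (I01 \<times> K)"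
          using x e'(2) by (auto simp: Y_def)
        then have "H (fst x, (fst (snd x), e' (snd (snd x)))) \<in> S3c" using H(2) by blast
        then show ?thesis using True by (simp add: H'_def)
      qed (use one_in_S3c in \<open>simp add: H'_def\<close>)
    qed
    moreover have "I01 \<times> Y = I01 \<times> (I01 \<times> A) \<union> I01 \<times> ({0, 1} \<times> K)"
      by (auto simp: Y_def)
    then have "continuous_on (I01 \<times> Y) H'" using cH' by simp
    moreover have "H' (0, x) = L x" "H' (1, x) = (1, 0)" for x
      using H(3,4) by (simp_all add: H'_def L_def)
    ultimately show "\<exists>h. continuous_map (prod_topology (top_of_set I01) (top_of_set Y)) (top_of_set S3c) h \<and>
        (\<forall>x\<in>topspace (top_of_set Y). h (0, x) = L x) \<and>
        (\<forall>x\<in>topspace (top_of_set Y). h (1, x) = (1, 0)) \<and> (\<forall>t\<in>I01. True)"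
      by (intro exI[of _ H']) (simp add: image_subset_iff_funcset)
  qed auto
  moreover from this have "continuous_on Y L" "L ` Y \<subseteq> S3c"
    using homotopic_with_imp_continuous homotopic_with_imp_subset1 by blast+
  moreover have "Y \<noteq> {}" using \<open>A \<noteq> {}\<close> by (auto simp: Y_def)
  \<comment> \<open>A null-homotopic map into a sphere extends from a closed set to the whole space;
    \<open>g\<close> prolongs the correction from \<open>Y\<close> to the full cylinder.\<close>
  ultimately obtain g where g: "continuous_on UNIV g" "range g \<subseteq> S3c" "\<And>x. x \<in> Y \<Longrightarrow> g x = L x"
    using nullhomotopic_into_sphere_extension[of Y L 0 1] compact_imp_closed[OF cY] by blast
  define Q' where "Q' = (\<lambda>x. qmul (R x) (g x))"
  show ?thesis
  proof (rule that[folded K_def])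
    show "continuous_on (I01 \<times> K) Q'"
      unfolding Q'_def by (intro continuous_intros R continuous_on_subset[OF g(1)]) auto
    show "Q' ` (I01 \<times> K) \<subseteq> S3c"
    proof (rule image_subsetI)
      fix x assume "x \<in> I01 \<times> K"
      then have "R x \<in> S3c" "g x \<in> S3c" using R(2) g(2) by blast+
      then show "Q' x \<in> S3c" unfolding Q'_def by (rule qmul_in_S3c)
    qed
    show "Q' (0, y) = q y \<and> Q' (1, y) = (1, 0)" if "y \<in> K" for y
    proof -
      have "L (0, y) = (1, 0)" "L (1, y) = (1, 0)"
        using \<open>based_ends K M\<close> e'(2)[of y] by (auto simp: L_def)
      moreover have "(0, y) \<in> Y" "(1, y) \<in> Y" using that by (auto simp: Y_def)
      ultimately show ?thesis using g(3) R by (simp add: Q'_def)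
    qed
    show "Q' (t, e y) = Q (t, y)" if "t \<in> I01" "y \<in> K" for t y
    proof -
      have "e y \<in> A" using that by (simp add: A_def)
      then have "g (t, e y) = M (t, y)"
        using that g(3)[of "(t, e y)"] e'e[of y] by (auto simp: Y_def L_def)
      then show ?thesis
        using qmul_qinv_right[OF Re[OF that]] by (simp add: Q'_def M_def)
    qed
  qed
qed

section \<open>The mapping space of an exhausted space is Polish\<close>

text \<open>The relatively open sets \<open>V n\<close> inside the compact stages make the
  exhaustion locally finite in effect: each compact subset lies in one stage, and continuity can be
  tested stage by stage.\<close>

locale exhaustion =
  fixes X :: "'a::euclidean_space set" and Xs V :: "nat \<Rightarrow> 'a set"
  assumes compact_Xs: "compact (Xs n)" and Xs_Suc: "Xs n \<subseteq> Xs (Suc n)"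
    and X_eq: "X = (\<Union>n. Xs n)" and V_open: "openin (top_of_set X) (V n)"
    and V_sub: "V n \<subseteq> Xs n" and X_sub_V: "X \<subseteq> (\<Union>n. V n)" and X_nonempty: "X \<noteq> {}"
begin

lemma Xs_mono: "m \<le> n \<Longrightarrow> Xs m \<subseteq> Xs n"
  using lift_Suc_mono_le[of Xs m n] Xs_Suc by blast

lemma Xs_sub: "Xs n \<subseteq> X"
  using X_eq by blast

lemma compact_sub_Xs:
  assumes "compact K" "K \<subseteq> X" obtains n where "K \<subseteq> Xs n"
proof -
  obtain W where W: "\<And>n. open (W n)" "\<And>n. V n = X \<inter> W n"
    using V_open unfolding openin_open by metis
  have "K \<subseteq> (\<Union>n\<in>UNIV. W n)" using assms X_sub_V W(2) by blast
  then obtain N where N: "finite N" "K \<subseteq> (\<Union>n\<in>N. W n)"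
    using compactE_image[OF assms(1), of UNIV W] W(1) by metis
  have "K \<subseteq> Xs (Max N)"
  proof
    fix x assume "x \<in> K"
    then obtain n where "n \<in> N" "x \<in> W n" using N by blast
    then have "x \<in> Xs n" using \<open>x \<in> K\<close> assms W(2) V_sub by blast
    then show "x \<in> Xs (Max N)" using Xs_mono[of n "Max N"] N \<open>n \<in> N\<close> by auto
  qed
  then show ?thesis using that by blast
qed

text \<open>\<open>T\<close> is the time interval of a homotopy. Near a given point only some
  \<open>V n\<close> matters, and this lies in a single stage.\<close>

lemma continuous_on_Times_X:
  fixes T :: "real set"
  assumes "\<And>n. continuous_on (T \<times> Xs n) f" shows "continuous_on (T \<times> X) f"
  unfolding continuous_on_eq_continuous_within
proof
  fix x assume x: "x \<in> T \<times> X"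
  then obtain n where n: "snd x \<in> V n" using X_sub_V by auto
  obtain W where W: "open W" "V n = X \<inter> W" using V_open unfolding openin_open by metis
  have "continuous_on (T \<times> (X \<inter> W)) f"
    using continuous_on_subset[OF assms] V_sub W(2) by (metis Sigma_mono order_refl)
  then have "continuous (at x within T \<times> (X \<inter> W)) f"
    using n W(2) x by (auto simp: continuous_on_eq_continuous_within)
  moreover have "at x within T \<times> X = at x within T \<times> (X \<inter> W)"
  proof (rule at_within_nhd)
    show "x \<in> UNIV \<times> W" using n W(2) by (simp add: mem_Times_iff)
    show "open (UNIV \<times> W)" by (rule open_Times[OF open_UNIV W(1)])
  qed blast
  ultimately show "continuous (at x within T \<times> X) f" by simp
qed

lemma continuous_on_X:
  assumes "\<And>n. continuous_on (Xs n) f" shows "continuous_on X f"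
proof -
  have "continuous_on ({0::real} \<times> X) (\<lambda>x. f (snd x))"
  proof (rule continuous_on_Times_X)
    show "continuous_on ({0} \<times> Xs n) (\<lambda>x. f (snd x))" for n
      by (rule continuous_on_compose2[OF assms]) (auto intro: continuous_intros)
  qed
  then have "continuous_on X (\<lambda>x. f (snd (0::real, x)))"
    by (rule continuous_on_compose2) (auto intro: continuous_intros)
  then show ?thesis by simp
qed

section \<open>The compact-open topology as uniform convergence on the stages\<close>

definition nearby :: "('a \<Rightarrow> real^3) \<Rightarrow> nat \<Rightarrow> real \<Rightarrow> ('a \<Rightarrow> real^3) set" where
  "nearby f n \<epsilon> = {g \<in> cmaps X S2. \<forall>x\<in>Xs n. dist (f x) (g x) < \<epsilon>}"

lemma nearby_mono: "m \<le> n \<Longrightarrow> \<delta> \<le> \<epsilon> \<Longrightarrow> nearby f n \<delta> \<subseteq> nearby f m \<epsilon>"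
  unfolding nearby_def using Xs_mono[of m n] by force

lemma topspace_map_space [simp]: "topspace (map_space X S2) = cmaps X S2"
proof -
  have "{f \<in> cmaps X S2. f ` {} \<subseteq> UNIV} \<in> {{f \<in> cmaps X S2. f ` K \<subseteq> U} | K U. compact K \<and> K \<subseteq> X \<and> open U}"
    by blast
  then have "cmaps X S2 \<subseteq> \<Union> {{f \<in> cmaps X S2. f ` K \<subseteq> U} | K U. compact K \<and> K \<subseteq> X \<and> open U}"
    by auto
  then show ?thesis
    unfolding map_space_def topology_generated_by_topspace by blast
qed

lemma openin_subbasic:
  "compact K \<Longrightarrow> K \<subseteq> X \<Longrightarrow> open U \<Longrightarrow> openin (map_space X S2) {f \<in> cmaps X S2. f ` K \<subseteq> U}"
  unfolding map_space_def by (rule topology_generated_by_Basis) blast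

text \<open>A countable selection from the subbasic sets: the compact set is the closure of a basic
  open set cut with a stage, the open set is basic.\<close>

definition subbase :: "('a \<Rightarrow> real^3) set set" where
  "subbase = (\<lambda>(n, a, b). {g \<in> cmaps X S2. g ` (closure a \<inter> Xs n) \<subseteq> b}) `
     (UNIV \<times> (SOME B. countable B \<and> topological_basis B) \<times> (SOME B. countable B \<and> topological_basis B))"

lemma countable_subbase: "countable subbase"
  unfolding subbase_def
  using someI_ex[OF ex_countable_basis[where 'a='a]] someI_ex[OF ex_countable_basis[where 'a="real^3"]]
  by (intro countable_image countable_SIGMA) auto

lemma openin_subbase: "S \<in> subbase \<Longrightarrow> openin (map_space X S2) S"
  unfolding subbase_def
  using someI_ex[OF ex_countable_basis[where 'a="real^3"]] Xs_sub topological_basis_open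
  by (auto intro!: openin_subbasic closed_Int_compact compact_Xs)

text \<open>Finitely many basic sets cover the stage such that on the closure of each of them
  \<open>f\<close> stays in a basic set inside a ball of radius \<open>\<epsilon>/2\<close>. A map
  obeying the same finitely many constraints is within \<open>\<epsilon>\<close> of
  \<open>f\<close>.\<close>

lemma nearby_contains_basic:
  assumes f: "f \<in> cmaps X S2" and "\<epsilon> > 0"
  obtains F where "finite F" "F \<subseteq> subbase" "f \<in> \<Inter>F" "cmaps X S2 \<inter> \<Inter>F \<subseteq> nearby f n \<epsilon>"
proof -
  define A where "A = (SOME B::'a set set. countable B \<and> topological_basis B)"
  define B where "B = (SOME B::(real^3) set set. countable B \<and> topological_basis B)"
  have A: "topological_basis A" unfolding A_def by (rule someI2_ex[OF ex_countable_basis]) simp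
  have B: "topological_basis B" unfolding B_def by (rule someI2_ex[OF ex_countable_basis]) simp
  have cont: "continuous_on (Xs n) f"
    using f Xs_sub by (auto simp: cmaps_def intro: continuous_on_subset)
  have "\<forall>x\<in>Xs n. \<exists>a\<in>A. \<exists>b\<in>B. x \<in> a \<and> f ` (closure a \<inter> Xs n) \<subseteq> b \<and> b \<subseteq> ball (f x) (\<epsilon>/2)"
  proof
    fix x assume x: "x \<in> Xs n"
    obtain b where b: "b \<in> B" "f x \<in> b" "b \<subseteq> ball (f x) (\<epsilon>/2)"
      using topological_basisE[OF B, of "ball (f x) (\<epsilon>/2)" "f x"] \<open>\<epsilon> > 0\<close> by auto
    then obtain \<eta> where \<eta>: "\<eta> > 0" "ball (f x) \<eta> \<subseteq> b"
      using topological_basis_open[OF B] open_contains_ball by metis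
    then obtain \<delta> where \<delta>: "\<delta> > 0" "\<And>y. y \<in> Xs n \<Longrightarrow> dist y x < \<delta> \<Longrightarrow> dist (f y) (f x) < \<eta>"
      using cont x unfolding continuous_on_iff by metis
    obtain a where a: "a \<in> A" "x \<in> a" "a \<subseteq> ball x (\<delta>/2)"
      using topological_basisE[OF A, of "ball x (\<delta>/2)" x] \<delta>(1) by auto
    have "closure a \<subseteq> cball x (\<delta>/2)"
      using a(3) by (intro closure_minimal) (auto simp: subset_iff less_imp_le)
    then have "f ` (closure a \<inter> Xs n) \<subseteq> b"
      using \<delta> \<eta>(2) by (force simp: dist_commute subset_iff)
    then show "\<exists>a\<in>A. \<exists>b\<in>B. x \<in> a \<and> f ` (closure a \<inter> Xs n) \<subseteq> b \<and> b \<subseteq> ball (f x) (\<epsilon>/2)"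
      using a b by blast
  qed
  then obtain a b where ab: "\<And>x. x \<in> Xs n \<Longrightarrow> a x \<in> A \<and> b x \<in> B \<and> x \<in> a x \<and>
      f ` (closure (a x) \<inter> Xs n) \<subseteq> b x \<and> b x \<subseteq> ball (f x) (\<epsilon>/2)"
    by metis
  obtain D where D: "D \<subseteq> Xs n" "finite D" "Xs n \<subseteq> (\<Union>x\<in>D. a x)"
  proof (rule compactE_image[OF compact_Xs[of n], of "Xs n" a])
    show "open (a x)" if "x \<in> Xs n" for x using ab[OF that] topological_basis_open[OF A] by blast
    show "Xs n \<subseteq> (\<Union>x\<in>Xs n. a x)" using ab by blast
  qed (use that in blast)
  define F where "F = (\<lambda>x. {g \<in> cmaps X S2. g ` (closure (a x) \<inter> Xs n) \<subseteq> b x}) ` D"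
  show ?thesis
  proof
    show "finite F" using D by (simp add: F_def)
    have "{g \<in> cmaps X S2. g ` (closure (a x) \<inter> Xs n) \<subseteq> b x} \<in> subbase" if "x \<in> D" for x
    proof -
      have "(n, a x, b x) \<in> UNIV \<times> A \<times> B" using ab that D(1) by auto
      from imageI[OF this, of "\<lambda>(n, a, b). {g \<in> cmaps X S2. g ` (closure a \<inter> Xs n) \<subseteq> b}"]
      show ?thesis unfolding subbase_def A_def[symmetric] B_def[symmetric] by simp
    qed
    then show "F \<subseteq> subbase" unfolding F_def by (rule image_subsetI)
    show "f \<in> \<Inter>F" using ab D(1) f by (auto simp: F_def)
    show "cmaps X S2 \<inter> \<Inter>F \<subseteq> nearby f n \<epsilon>"
    proof
      fix g assume g: "g \<in> cmaps X S2 \<inter> \<Inter>F"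
      have "dist (f y) (g y) < \<epsilon>" if y: "y \<in> Xs n" for y
      proof -
        obtain x where x: "x \<in> D" "y \<in> a x" using D y by blast
        then have "y \<in> closure (a x) \<inter> Xs n" using that closure_subset by blast
        moreover have "g ` (closure (a x) \<inter> Xs n) \<subseteq> b x" using g x(1) by (auto simp: F_def)
        moreover have "f ` (closure (a x) \<inter> Xs n) \<subseteq> b x" using ab x(1) D(1) by blast
        ultimately have "f y \<in> b x" "g y \<in> b x" by blast+
        then have "dist (f x) (f y) < \<epsilon>/2" "dist (f x) (g y) < \<epsilon>/2" using ab[of x] x D(1) by (auto simp: subset_iff)
        then show ?thesis by (metis dist_commute dist_triangle_half_l)
      qed
      then show "g \<in> nearby f n \<epsilon>" using g by (simp add: nearby_def)
    qed
  qed
qed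

lemma openin_map_space_iff:
  "openin (map_space X S2) U \<longleftrightarrow> U \<subseteq> cmaps X S2 \<and> (\<forall>f\<in>U. \<exists>n. \<exists>\<epsilon>>0. nearby f n \<epsilon> \<subseteq> U)"
proof
  assume "openin (map_space X S2) U"
  then have "generate_topology_on {{f \<in> cmaps X S2. f ` K \<subseteq> U} | K U. compact K \<and> K \<subseteq> X \<and> open U} U"
    unfolding map_space_def openin_topology_generated_by_iff .
  then show "U \<subseteq> cmaps X S2 \<and> (\<forall>f\<in>U. \<exists>n. \<exists>\<epsilon>>0. nearby f n \<epsilon> \<subseteq> U)"
  proof induction
    case (Int a b)
    have "\<exists>n. \<exists>\<epsilon>>0. nearby f n \<epsilon> \<subseteq> a \<inter> b" if f: "f \<in> a \<inter> b" for f
    proof -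
      obtain n \<epsilon> where 1: "\<epsilon> > 0" "nearby f n \<epsilon> \<subseteq> a" using Int f by blast
      obtain m \<delta> where 2: "\<delta> > 0" "nearby f m \<delta> \<subseteq> b" using Int f by blast
      have "nearby f (max n m) (min \<epsilon> \<delta>) \<subseteq> a \<inter> b"
        using 1(2) 2(2) nearby_mono[of n "max n m" "min \<epsilon> \<delta>" \<epsilon> f] nearby_mono[of m "max n m" "min \<epsilon> \<delta>" \<delta> f]
        by auto
      then show ?thesis using 1(1) 2(1) by (intro exI[of _ "max n m"] exI[of _ "min \<epsilon> \<delta>"]) auto
    qed
    then show ?case using Int by blast
  next
    case (UN K)
    then show ?case by (meson Sup_least Sup_upper UnionE order_trans)
  next
    case (Basis s)
    then obtain K U where s: "s = {f \<in> cmaps X S2. f ` K \<subseteq> U}" and K: "compact K" "K \<subseteq> X" and "open U"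
      by blast
    have "\<exists>n. \<exists>\<epsilon>>0. nearby f n \<epsilon> \<subseteq> s" if f: "f \<in> s" for f
    proof -
      obtain n where n: "K \<subseteq> Xs n" using compact_sub_Xs[OF K] .
      have "compact (f ` K)"
        using f s K by (auto simp: cmaps_def intro!: compact_continuous_image intro: continuous_on_subset)
      then obtain \<epsilon> where \<epsilon>: "\<epsilon> > 0" "(\<Union>y\<in>f ` K. ball y \<epsilon>) \<subseteq> U"
        using compact_subset_open_imp_ball_epsilon_subset[OF _ \<open>open U\<close>, of "f ` K"] f s by blast
      have "nearby f n \<epsilon> \<subseteq> s"
        unfolding s nearby_def using \<epsilon>(2) n by (auto simp: subset_iff)
      then show ?thesis using \<epsilon>(1) by blast
    qed
    then show ?case using s by blast
  qed simp
next
  assume *: "U \<subseteq> cmaps X S2 \<and> (\<forall>f\<in>U. \<exists>n. \<exists>\<epsilon>>0. nearby f n \<epsilon> \<subseteq> U)"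
  show "openin (map_space X S2) U"
  proof (subst openin_subopen, intro ballI)
    fix f assume f: "f \<in> U"
    then obtain n \<epsilon> where n: "\<epsilon> > 0" "nearby f n \<epsilon> \<subseteq> U" using * by blast
    obtain F where F: "finite F" "F \<subseteq> subbase" "f \<in> \<Inter>F" "cmaps X S2 \<inter> \<Inter>F \<subseteq> nearby f n \<epsilon>"
      using nearby_contains_basic[of f \<epsilon> n] n(1) f * by blast
    have "openin (map_space X S2) (\<Inter>(insert (cmaps X S2) F))"
      using F openin_subbase openin_topspace[of "map_space X S2"] by (intro openin_Inter) auto
    then show "\<exists>T. openin (map_space X S2) T \<and> f \<in> T \<and> T \<subseteq> U"
      using F f * n(2) by (intro exI[of _ "\<Inter>(insert (cmaps X S2) F)"]) auto
  qed
qed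

lemma second_countable_map_space: "second_countable (map_space X S2)"
  unfolding second_countable_def
proof (intro exI conjI ballI allI impI)
  let ?B = "(\<lambda>F. cmaps X S2 \<inter> \<Inter>F) ` {F. finite F \<and> F \<subseteq> subbase}"
  show "countable ?B"
    using countable_subbase by (intro countable_image countable_Collect_finite_subset)
  show "openin (map_space X S2) W" if W: "W \<in> ?B" for W
  proof -
    obtain F where F: "W = \<Inter>(insert (cmaps X S2) F)" "finite F" "F \<subseteq> subbase" using W by auto
    show ?thesis
      unfolding F(1) using F openin_subbase openin_topspace[of "map_space X S2"] by (intro openin_Inter) auto
  qed
  show "\<exists>W\<in>?B. f \<in> W \<and> W \<subseteq> U" if U: "openin (map_space X S2) U \<and> f \<in> U" for U f
  proof -
    obtain n \<epsilon> where n: "f \<in> cmaps X S2" "\<epsilon> > 0" "nearby f n \<epsilon> \<subseteq> U"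
      using U unfolding openin_map_space_iff by blast
    obtain F where F: "finite F" "F \<subseteq> subbase" "f \<in> \<Inter>F" "cmaps X S2 \<inter> \<Inter>F \<subseteq> nearby f n \<epsilon>"
      using nearby_contains_basic[OF n(1,2)] by metis
    then show ?thesis
      using n by (intro bexI[of _ "cmaps X S2 \<inter> \<Inter>F"]) auto
  qed
qed

section \<open>A complete metric for the mapping space\<close>

definition level :: "'a \<Rightarrow> nat" where "level x = (LEAST n. x \<in> Xs n)"

lemma level_le: "x \<in> Xs n \<Longrightarrow> level x \<le> n"
  unfolding level_def by (rule Least_le)

lemma in_Xs_level: "x \<in> X \<Longrightarrow> level x \<le> n \<Longrightarrow> x \<in> Xs n"
proof -
  assume "x \<in> X" "level x \<le> n"
  then have "x \<in> Xs (level x)" unfolding level_def X_eq by (auto intro: LeastI)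
  then show ?thesis using Xs_mono \<open>level x \<le> n\<close> by blast
qed

text \<open>The truncation keeps the supremum finite, and the weight makes late stages negligible;
  one supremum thus controls uniform convergence on all stages at once.\<close>

definition wdist :: "('a \<Rightarrow> real^3) \<Rightarrow> ('a \<Rightarrow> real^3) \<Rightarrow> 'a \<Rightarrow> real" where
  "wdist f g x = min 1 (dist (f x) (g x)) / (1 + level x)"

definition map_dist :: "('a \<Rightarrow> real^3) \<Rightarrow> ('a \<Rightarrow> real^3) \<Rightarrow> real" where
  "map_dist f g = (SUP x\<in>X. wdist f g x)"

lemma wdist_bounds: "0 \<le> wdist f g x" "wdist f g x \<le> 1"
  unfolding wdist_def by (auto simp: divide_simps min_def)

lemma wdist_le: "x \<in> X \<Longrightarrow> wdist f g x \<le> map_dist f g"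
  unfolding map_dist_def using wdist_bounds by (intro cSUP_upper) (auto intro!: bdd_aboveI2)

lemma wdist_le': "x \<in> Xs n \<Longrightarrow> wdist f g x \<le> map_dist f g"
  using wdist_le Xs_sub by blast

lemma map_dist_le: "(\<And>x. x \<in> X \<Longrightarrow> wdist f g x \<le> c) \<Longrightarrow> map_dist f g \<le> c"
  unfolding map_dist_def using X_nonempty by (intro cSUP_least) auto

lemma wdist_lt_imp_dist:
  assumes "x \<in> Xs n" "wdist f g x < \<epsilon> / (1 + n)" "\<epsilon> \<le> 1"
  shows "dist (f x) (g x) < \<epsilon>"
proof -
  have "min 1 (dist (f x) (g x)) / (1 + n) \<le> wdist f g x"
    unfolding wdist_def using level_le[OF assms(1)] by (intro divide_left_mono) (auto simp: min_def)
  with assms(2) have "min 1 (dist (f x) (g x)) / (1 + n) < \<epsilon> / (1 + n)" by simp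
  then have "min 1 (dist (f x) (g x)) < \<epsilon>" by (simp add: divide_less_cancel)
  then show ?thesis using assms(3) by (auto simp: min_def split: if_splits)
qed

text \<open>Points outside \<open>Xs n\<close> have level at least \<open>n + 1\<close>, so their
  truncated and weighted distance is at most \<open>1 / (2 + real n)\<close> whatever the maps do
  there.\<close>

lemma map_dist_le_of_nearby:
  assumes "\<And>x. x \<in> Xs n \<Longrightarrow> dist (f x) (g x) \<le> \<epsilon>" "1 / (2 + real n) \<le> \<epsilon>"
  shows "map_dist f g \<le> \<epsilon>"
proof (rule map_dist_le)
  fix x assume x: "x \<in> X"
  show "wdist f g x \<le> \<epsilon>"
  proof (cases "level x \<le> n")
    case True
    have "wdist f g x \<le> min 1 (dist (f x) (g x)) / 1"
      unfolding wdist_def by (intro divide_left_mono) (auto simp: min_def)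
    then show ?thesis using assms(1)[OF in_Xs_level[OF x True]] by simp
  next
    case False
    have "wdist f g x \<le> 1 / (2 + real n)"
      unfolding wdist_def using False by (intro frac_le) auto
    then show ?thesis using assms(2) by simp
  qed
qed

lemma Metric_space_map_dist: "Metric_space (cmaps X S2) map_dist"
proof
  obtain x0 where x0: "x0 \<in> X" using X_nonempty by blast
  fix f g :: "'a \<Rightarrow> real^3"
  show "0 \<le> map_dist f g" using wdist_bounds(1) wdist_le[OF x0] order_trans by blast
  show "map_dist f g = map_dist g f" by (simp add: map_dist_def wdist_def dist_commute)
  show "map_dist f k \<le> map_dist f g + map_dist g k" for k
  proof (rule map_dist_le)
    fix x assume x: "x \<in> X"
    have "min 1 (dist (f x) (k x)) \<le> min 1 (dist (f x) (g x)) + min 1 (dist (g x) (k x))"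
      using dist_triangle[of "f x" "k x" "g x"] zero_le_dist[of "f x" "g x"] zero_le_dist[of "g x" "k x"]
      unfolding min_def by (auto split: if_splits simp del: zero_le_dist)
    then have "wdist f k x \<le> wdist f g x + wdist g k x"
      unfolding wdist_def add_divide_distrib[symmetric] by (intro divide_right_mono) auto
    then show "wdist f k x \<le> map_dist f g + map_dist g k"
      using wdist_le[OF x, of f g] wdist_le[OF x, of g k] by linarith
  qed
  assume fg: "f \<in> cmaps X S2" "g \<in> cmaps X S2"
  show "map_dist f g = 0 \<longleftrightarrow> f = g"
  proof
    assume "map_dist f g = 0"
    then have "wdist f g x \<le> 0" if "x \<in> X" for x using wdist_le[OF that, of f g] by simp
    then have "min 1 (dist (f x) (g x)) \<le> 0" if "x \<in> X" for x
      using that unfolding wdist_def by (auto simp: divide_le_0_iff)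
    then have "f x = g x" if "x \<in> X" for x
      using that by (force simp: min_le_iff_disj)
    then show "f = g" using fg unfolding cmaps_def by (intro PiE_ext[of f X "\<lambda>_. S2" g]) auto
  next
    assume "f = g"
    then have "map_dist f g \<le> 0" by (intro map_dist_le) (simp add: wdist_def)
    then show "map_dist f g = 0" using wdist_bounds(1) wdist_le[OF x0, of f g] by (meson order_antisym order_trans)
  qed
qed

interpretation MS: Metric_space "cmaps X S2" map_dist
  by (rule Metric_space_map_dist)

lemma mtopology_map_dist: "MS.mtopology = map_space X S2"
  unfolding topology_eq
proof
  fix U
  show "openin MS.mtopology U \<longleftrightarrow> openin (map_space X S2) U"
    unfolding MS.openin_mtopology openin_map_space_iff
  proof (intro conj_cong refl iffI allI impI ballI)
    fix f assume U: "U \<subseteq> cmaps X S2"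
    { assume *: "\<forall>f. f \<in> U \<longrightarrow> (\<exists>r>0. MS.mball f r \<subseteq> U)" and f: "f \<in> U"
      obtain r where r: "r > 0" "MS.mball f r \<subseteq> U" using * f by blast
      obtain n :: nat where n: "inverse (real (Suc n)) < r / 2"
        using reals_Archimedean[of "r/2"] r(1) by auto
      have "nearby f n (r/2) \<subseteq> MS.mball f r"
      proof
        fix g assume g: "g \<in> nearby f n (r/2)"
        have "1 / (2 + real n) \<le> inverse (real (Suc n))" by (simp add: divide_simps)
        then have "map_dist f g \<le> r/2"
          using g n by (intro map_dist_le_of_nearby[of n]) (auto simp: nearby_def less_imp_le)
        then show "g \<in> MS.mball f r" using g r(1) f U by (auto simp: nearby_def)
      qed
      then show "\<exists>n. \<exists>\<epsilon>>0. nearby f n \<epsilon> \<subseteq> U" using r by (intro exI[of _ n] exI[of _ "r/2"]) auto }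
    { assume *: "\<forall>f\<in>U. \<exists>n. \<exists>\<epsilon>>0. nearby f n \<epsilon> \<subseteq> U" and f: "f \<in> U"
      obtain n \<epsilon> where n: "\<epsilon> > 0" "nearby f n \<epsilon> \<subseteq> U" using * f by blast
      let ?e = "min \<epsilon> 1"
      have "MS.mball f (?e / (1 + n)) \<subseteq> nearby f n \<epsilon>"
      proof
        fix g assume g: "g \<in> MS.mball f (?e / (1 + n))"
        have "dist (f x) (g x) < ?e" if "x \<in> Xs n" for x
          using le_less_trans[OF wdist_le'[OF that]] g by (intro wdist_lt_imp_dist[OF that]) auto
        then show "g \<in> nearby f n \<epsilon>" using g by (auto simp: nearby_def)
      qed
      then show "\<exists>r>0. MS.mball f r \<subseteq> U" using n by (intro exI[of _ "?e / (1 + n)"]) auto }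
  qed
qed

lemma mcomplete_map_dist: "MS.mcomplete"
  unfolding MS.mcomplete_def
proof (intro allI impI)
  fix \<sigma> assume \<sigma>: "MS.MCauchy \<sigma>"
  have \<sigma>c: "\<sigma> i \<in> cmaps X S2" for i using \<sigma> by (auto simp: MS.MCauchy_def)
  have Cauchy: "\<exists>N. \<forall>i\<ge>N. \<forall>j\<ge>N. \<forall>x\<in>Xs n. dist (\<sigma> i x) (\<sigma> j x) < \<epsilon>" if "\<epsilon> > 0" for n \<epsilon>
  proof -
    let ?e = "min \<epsilon> 1"
    have "?e / (1 + n) > 0" using that by simp
    then obtain N where N: "\<And>i j. N \<le> i \<Longrightarrow> N \<le> j \<Longrightarrow> map_dist (\<sigma> i) (\<sigma> j) < ?e / (1 + n)"
      using \<sigma> unfolding MS.MCauchy_def by metis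
    have "dist (\<sigma> i x) (\<sigma> j x) < ?e" if "i \<ge> N" "j \<ge> N" "x \<in> Xs n" for i j x
      using le_less_trans[OF wdist_le'[OF that(3)]] N[of i j] that by (intro wdist_lt_imp_dist[OF that(3)]) auto
    then show ?thesis by (meson min_less_iff_conj)
  qed
  have "convergent (\<lambda>i. \<sigma> i x)" if x: "x \<in> X" for x
  proof -
    have "Cauchy (\<lambda>i. \<sigma> i x)"
      unfolding Cauchy_def using Cauchy[of _ "level x"] in_Xs_level[OF x order_refl] by meson
    then show ?thesis by (rule Cauchy_convergent)
  qed
  then obtain l0 where l0: "\<And>x. x \<in> X \<Longrightarrow> (\<lambda>i. \<sigma> i x) \<longlonglongrightarrow> l0 x"
    unfolding convergent_def by metis
  define l where "l = restrict l0 X"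
  have l: "(\<lambda>i. \<sigma> i x) \<longlonglongrightarrow> l x" if "x \<in> X" for x using l0 that by (simp add: l_def)
  have unif: "\<exists>N. \<forall>i\<ge>N. \<forall>x\<in>Xs n. dist (\<sigma> i x) (l x) \<le> \<epsilon>" if "\<epsilon> > 0" for n \<epsilon>
  proof -
    obtain N where N: "\<And>i j x. i \<ge> N \<Longrightarrow> j \<ge> N \<Longrightarrow> x \<in> Xs n \<Longrightarrow> dist (\<sigma> i x) (\<sigma> j x) < \<epsilon>"
      using Cauchy[OF \<open>\<epsilon> > 0\<close>] by metis
    have "dist (\<sigma> i x) (l x) \<le> \<epsilon>" if "i \<ge> N" "x \<in> Xs n" for i x
    proof (rule tendsto_upperbound)
      show "(\<lambda>j. dist (\<sigma> i x) (\<sigma> j x)) \<longlonglongrightarrow> dist (\<sigma> i x) (l x)"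
        using l Xs_sub that by (intro tendsto_intros) auto
      show "\<forall>\<^sub>F j in sequentially. dist (\<sigma> i x) (\<sigma> j x) \<le> \<epsilon>"
        using N[OF that(1) _ that(2)] by (auto simp: eventually_sequentially intro!: exI[of _ N] less_imp_le)
    qed simp
    then show ?thesis by blast
  qed
  have "l x \<in> S2" if "x \<in> X" for x
  proof (rule Lim_in_closed_set[OF closed_sphere _ _ l[OF that]])
    show "\<forall>\<^sub>F i in sequentially. \<sigma> i x \<in> S2"
      using \<sigma>c that unfolding cmaps_def by (intro always_eventually allI) blast
  qed simp
  moreover have "continuous_on X l"
  proof (rule continuous_on_X)
    fix n
    show "continuous_on (Xs n) l"
    proof (rule uniform_limit_theorem)
      show "uniform_limit (Xs n) \<sigma> l sequentially"
      proof (rule uniform_limitI)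
        fix \<epsilon> :: real assume "\<epsilon> > 0"
        then obtain N where "\<forall>i\<ge>N. \<forall>x\<in>Xs n. dist (\<sigma> i x) (l x) \<le> \<epsilon>/2" using unif[of "\<epsilon>/2" n] by auto
        then have "\<forall>i\<ge>N. \<forall>x\<in>Xs n. dist (\<sigma> i x) (l x) < \<epsilon>" using \<open>\<epsilon> > 0\<close> by fastforce
        then show "\<forall>\<^sub>F i in sequentially. \<forall>x\<in>Xs n. dist (\<sigma> i x) (l x) < \<epsilon>"
          unfolding eventually_sequentially by blast
      qed
      show "\<forall>\<^sub>F i in sequentially. continuous_on (Xs n) (\<sigma> i)"
        using \<sigma>c Xs_sub unfolding cmaps_def
        by (intro always_eventually allI) (blast intro: continuous_on_subset)
    qed simp
  qed
  ultimately have lc: "l \<in> cmaps X S2" unfolding cmaps_def l_def by auto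
  have "limitin MS.mtopology \<sigma> l sequentially"
    unfolding MS.limitin_metric
  proof (intro conjI lc allI impI)
    fix \<epsilon> :: real assume "\<epsilon> > 0"
    obtain n :: nat where n: "inverse (real (Suc n)) < \<epsilon> / 2"
      using reals_Archimedean[of "\<epsilon>/2"] \<open>\<epsilon> > 0\<close> by auto
    obtain N where N: "\<forall>i\<ge>N. \<forall>x\<in>Xs n. dist (\<sigma> i x) (l x) \<le> \<epsilon>/2" using unif[of "\<epsilon>/2" n] \<open>\<epsilon> > 0\<close> by auto
    have "1 / (2 + real n) \<le> inverse (real (Suc n))" by (simp add: divide_simps)
    then have "map_dist (\<sigma> i) l \<le> \<epsilon>/2" if "i \<ge> N" for i
      using N that n by (intro map_dist_le_of_nearby[of n]) auto
    then show "\<forall>\<^sub>F i in sequentially. \<sigma> i \<in> cmaps X S2 \<and> map_dist (\<sigma> i) l < \<epsilon>"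
      unfolding eventually_sequentially using \<sigma>c \<open>\<epsilon> > 0\<close> by (intro exI[of _ N]) force
  qed
  then show "\<exists>l. limitin MS.mtopology \<sigma> l sequentially" by blast
qed

lemma polish_map_space: "polish (map_space X S2)"
  unfolding polish_def
  using second_countable_map_space MS.completely_metrizable_space_mtopology mcomplete_map_dist mtopology_map_dist
  by simp

end

section \<open>Measurability\<close>

lemma space_borel_of [simp]: "space (borel_of Y) = topspace Y"
  unfolding borel_of_def by (intro space_measure_of) (auto dest: openin_subset)

lemma openin_in_borel_of: "openin Y U \<Longrightarrow> U \<in> sets (borel_of Y)"
  unfolding borel_of_def by (subst sets_measure_of) (auto dest: openin_subset)

lemma measurable_borel_ofI:
  assumes "\<And>x. x \<in> space M \<Longrightarrow> f x \<in> topspace Y"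
    "\<And>U. openin Y U \<Longrightarrow> {x \<in> space M. f x \<in> U} \<in> sets M"
  shows "f \<in> measurable M (borel_of Y)"
  unfolding borel_of_def
proof (rule measurable_measure_of)
  show "f -` U \<inter> space M \<in> sets M" if "U \<in> {U. openin Y U}" for U
  proof -
    have "f -` U \<inter> space M = {x \<in> space M. f x \<in> U}" by blast
    then show ?thesis using assms(2) that by simp
  qed
qed (use assms(1) openin_subset in \<open>force+\<close>)

lemma continuous_map_measurable_borel_of:
  assumes "continuous_map Y Z f" shows "f \<in> measurable (borel_of Y) (borel_of Z)"
proof (rule measurable_borel_ofI)
  show "f x \<in> topspace Z" if "x \<in> space (borel_of Y)" for x
    using assms that by (auto simp: continuous_map_def)
  show "{x \<in> space (borel_of Y). f x \<in> U} \<in> sets (borel_of Y)" if "openin Z U" for U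
    using openin_continuous_map_preimage[OF assms that] by (auto intro: openin_in_borel_of)
qed

text \<open>The target carries the sets generated by all open sets of the product. Second
  countability writes each of these as a countable union of open rectangles.\<close>

lemma measurable_Pair_borel_of:
  assumes f: "f \<in> measurable M (borel_of Y)" and g: "g \<in> measurable M (borel_of Z)"
    and "second_countable Y" "second_countable Z"
  shows "(\<lambda>x. (f x, g x)) \<in> measurable M (borel_of (prod_topology Y Z))"
proof (rule measurable_borel_ofI)
  show "(f x, g x) \<in> topspace (prod_topology Y Z)" if "x \<in> space M" for x
    using measurable_space[OF f that] measurable_space[OF g that] by simp
  fix U assume U: "openin (prod_topology Y Z) U"
  obtain A where A: "countable A" "\<forall>V\<in>A. openin Y V" "\<And>W y. openin Y W \<Longrightarrow> y \<in> W \<Longrightarrow> \<exists>V\<in>A. y \<in> V \<and> V \<subseteq> W"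
    using assms(3) unfolding second_countable_def by metis
  obtain B where B: "countable B" "\<forall>V\<in>B. openin Z V" "\<And>W y. openin Z W \<Longrightarrow> y \<in> W \<Longrightarrow> \<exists>V\<in>B. y \<in> V \<and> V \<subseteq> W"
    using assms(4) unfolding second_countable_def by metis
  let ?R = "{R \<in> A \<times> B. fst R \<times> snd R \<subseteq> U}"
  have "{x \<in> space M. (f x, g x) \<in> U} = (\<Union>R\<in>?R. (f -` fst R \<inter> space M) \<inter> (g -` snd R \<inter> space M))"
  proof (intro subset_antisym subsetI)
    fix x assume x: "x \<in> {x \<in> space M. (f x, g x) \<in> U}"
    then have "(f x, g x) \<in> U" by simp
    from iffD1[OF openin_prod_topology_alt U, rule_format, OF this]
    obtain V W where VW: "openin Y V" "openin Z W" "f x \<in> V" "g x \<in> W" "V \<times> W \<subseteq> U"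
      by blast
    obtain V' where V': "V' \<in> A" "f x \<in> V'" "V' \<subseteq> V" using A(3)[OF VW(1,3)] by blast
    obtain W' where W': "W' \<in> B" "g x \<in> W'" "W' \<subseteq> W" using B(3)[OF VW(2,4)] by blast
    have "(V', W') \<in> ?R" using V' W' VW(5) by auto
    then show "x \<in> (\<Union>R\<in>?R. (f -` fst R \<inter> space M) \<inter> (g -` snd R \<inter> space M))"
      using V' W' x by (intro UN_I[of "(V', W')"]) auto
  qed auto
  also have "\<dots> \<in> sets M"
  proof (rule sets.countable_UN'')
    show "countable ?R"
      using A(1) B(1) by (intro countable_Collect countable_SIGMA) auto
    show "(f -` fst R \<inter> space M) \<inter> (g -` snd R \<inter> space M) \<in> sets M" if "R \<in> ?R" for R
      using that A(2) B(2)
      by (intro sets.Int measurable_sets[OF f] measurable_sets[OF g] openin_in_borel_of) auto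
  qed
  finally show "{x \<in> space M. (f x, g x) \<in> U} \<in> sets M" .
qed

text \<open>The assumption on \<open>Q\<close> says that it is open in the product topology on
  integer sequences. There are only countably many finite lists, so the preimage is a countable
  union over the lists that already force \<open>Q\<close>.\<close>

lemma sets_initial_segment:
  fixes D :: "'a \<Rightarrow> nat \<Rightarrow> int"
  assumes D: "\<And>n m. {x \<in> space M. D x n = m} \<in> sets M"
    and Q: "\<And>d. Q d \<Longrightarrow> \<exists>n. \<forall>d'. (\<forall>i<n. d' i = d i) \<longrightarrow> Q d'"
  shows "{x \<in> space M. Q (D x)} \<in> sets M"
proof -
  let ?L = "{l :: int list. \<forall>d. (\<forall>i<length l. d i = l ! i) \<longrightarrow> Q d}"
  have "{x \<in> space M. Q (D x)} = (\<Union>l\<in>?L. {x \<in> space M. \<forall>i\<in>{..<length l}. D x i = l ! i})"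
  proof (intro subset_antisym subsetI)
    fix x assume x: "x \<in> {x \<in> space M. Q (D x)}"
    then obtain n where n: "\<forall>d'. (\<forall>i<n. d' i = D x i) \<longrightarrow> Q d'" using Q by blast
    then have "map (D x) [0..<n] \<in> ?L" by auto
    then show "x \<in> (\<Union>l\<in>?L. {x \<in> space M. \<forall>i\<in>{..<length l}. D x i = l ! i})"
      using x by (intro UN_I[of "map (D x) [0..<n]"]) auto
  qed auto
  also have "\<dots> \<in> sets M"
    using D by (intro sets.countable_UN'' sets.sets_Collect_finite_All) auto
  finally show ?thesis .
qed

lemma measurable_initial_segment:
  fixes D :: "'a \<Rightarrow> nat \<Rightarrow> int"
  assumes D: "\<And>n m. {x \<in> space M. D x n = m} \<in> sets M"
    and F: "\<And>d. F d \<in> topspace Y"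
      "\<And>U d. openin Y U \<Longrightarrow> F d \<in> U \<Longrightarrow> \<exists>n. \<forall>d'. (\<forall>i<n. d' i = d i) \<longrightarrow> F d' \<in> U"
  shows "(\<lambda>x. F (D x)) \<in> measurable M (borel_of Y)"
  using F by (intro measurable_borel_ofI sets_initial_segment[OF D]) auto

text \<open>The classes form the first derived limit of the tower of integers with all bonding maps
  equal to multiplication by \<open>p\<close>.\<close>

definition seq_equiv :: "nat \<Rightarrow> (nat \<Rightarrow> int) \<Rightarrow> (nat \<Rightarrow> int) \<Rightarrow> bool" where
  "seq_equiv p d d' \<longleftrightarrow> (\<exists>a::nat \<Rightarrow> int. \<forall>n. d n - d' n = int p * a (Suc n) - a n)"

lemma seq_equivI: "(\<And>n. d n - d' n = int p * a (Suc n) - a n) \<Longrightarrow> seq_equiv p d d'"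
  unfolding seq_equiv_def by blast

lemma seq_equiv_refl: "seq_equiv p d d"
  by (rule seq_equivI[of _ _ _ "\<lambda>_. 0"]) simp

lemma seq_equiv_sym: "seq_equiv p d d' \<Longrightarrow> seq_equiv p d' d"
proof -
  assume "seq_equiv p d d'"
  then obtain a where a: "\<And>n. d n - d' n = int p * a (Suc n) - a n" unfolding seq_equiv_def by blast
  show ?thesis
  proof (rule seq_equivI[of _ _ _ "\<lambda>n. - a n"])
    show "d' n - d n = int p * - a (Suc n) - - a n" for n using a[of n] by simp
  qed
qed

lemma seq_equiv_trans: "seq_equiv p d d' \<Longrightarrow> seq_equiv p d' d'' \<Longrightarrow> seq_equiv p d d''"
proof -
  assume "seq_equiv p d d'" "seq_equiv p d' d''"
  then obtain a b where a: "\<And>n. d n - d' n = int p * a (Suc n) - a n"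
    and b: "\<And>n. d' n - d'' n = int p * b (Suc n) - b n" unfolding seq_equiv_def by blast
  show ?thesis
  proof (rule seq_equivI[of _ _ _ "\<lambda>n. a n + b n"])
    show "d n - d'' n = int p * (a (Suc n) + b (Suc n)) - (a n + b n)" for n
      using a[of n] b[of n] by (simp add: algebra_simps)
  qed
qed

text \<open>Multiplying the \<open>n\<close>-th equation by \<open>int p ^ n\<close> and summing
  telescopes to \<open>int p ^ n * a n\<close>, so \<open>a\<close> is determined by
  \<open>a 0\<close>. The quantifier over sequences becomes one over a single integer, which is what
  makes the relation Borel.\<close>

lemma seq_equiv_iff_dvd:
  assumes "p > 0"
  shows "seq_equiv p d d' \<longleftrightarrow> (\<exists>a. \<forall>n. int p ^ n dvd a + (\<Sum>i<n. int p ^ i * (d i - d' i)))"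
proof
  assume "seq_equiv p d d'"
  then obtain a where a: "\<And>n. d n - d' n = int p * a (Suc n) - a n" unfolding seq_equiv_def by blast
  have "a 0 + (\<Sum>i<n. int p ^ i * (d i - d' i)) = int p ^ n * a n" for n
    by (induction n) (simp_all add: a algebra_simps)
  then show "\<exists>a. \<forall>n. int p ^ n dvd a + (\<Sum>i<n. int p ^ i * (d i - d' i))"
    by (intro exI[of _ "a 0"]) simp
next
  assume "\<exists>a. \<forall>n. int p ^ n dvd a + (\<Sum>i<n. int p ^ i * (d i - d' i))"
  then obtain a0 where "\<And>n. int p ^ n dvd a0 + (\<Sum>i<n. int p ^ i * (d i - d' i))" by blast
  then obtain a where a: "\<And>n. a0 + (\<Sum>i<n. int p ^ i * (d i - d' i)) = int p ^ n * a n"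
    unfolding dvd_def by metis
  show "seq_equiv p d d'"
  proof (rule seq_equivI[of _ _ _ a])
    fix n
    have "int p ^ n * a n + int p ^ n * (d n - d' n) = int p ^ n * (int p * a (Suc n))"
      using a[of n] a[of "Suc n"] by (simp add: algebra_simps)
    then have "int p ^ n * (a n + (d n - d' n)) = int p ^ n * (int p * a (Suc n))"
      by (simp add: distrib_left)
    then have "a n + (d n - d' n) = int p * a (Suc n)"
      using assms by (subst (asm) mult_left_cancel) auto
    then show "d n - d' n = int p * a (Suc n) - a n" by simp
  qed
qed

section \<open>Normal forms: sequences of digits in a class\<close>

fun digit_carry :: "nat \<Rightarrow> int \<Rightarrow> (nat \<Rightarrow> int) \<Rightarrow> nat \<Rightarrow> int" where
  "digit_carry p i d 0 = i"
| "digit_carry p i d (Suc n) = - ((d n - digit_carry p i d n) div int p)"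

text \<open>Division with remainder at each place: the remainder is the digit, and the quotient,
  with its sign changed, is the carry passed to the next place. The initial carry \<open>i\<close>
  is the only free choice.\<close>

definition digits :: "nat \<Rightarrow> int \<Rightarrow> (nat \<Rightarrow> int) \<Rightarrow> nat \<Rightarrow> int" where
  "digits p i d n = (d n - digit_carry p i d n) mod int p"

lemma digits_equiv: "seq_equiv p (digits p i d) d"
proof (rule seq_equivI[of _ _ _ "digit_carry p i d"])
  show "digits p i d n - d n = int p * digit_carry p i d (Suc n) - digit_carry p i d n" for n
    unfolding digits_def minus_mult_div_eq_mod [symmetric] by simp
qed

text \<open>A term in the digit range must be the remainder of \<open>d n - a n\<close>. Uniqueness
  of division with remainder then forces \<open>a\<close> to follow the carry recursion.\<close>

lemma digits_unique:
  assumes "p > 0" "seq_equiv p \<delta> d" "\<And>n. \<delta> n \<in> {0..<int p}"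
  obtains i where "\<delta> = digits p i d"
proof -
  obtain a where a: "\<And>n. \<delta> n - d n = int p * a (Suc n) - a n"
    using assms(2) unfolding seq_equiv_def by blast
  have *: "\<delta> n = (d n - a n) mod int p \<and> a (Suc n) = - ((d n - a n) div int p)" for n
  proof -
    have 1: "d n - a n = \<delta> n + int p * (- a (Suc n))" using a[of n] by simp
    have "(\<delta> n + int p * b) mod int p = \<delta> n \<and> (\<delta> n + int p * b) div int p = b" for b
      using assms(1) assms(3)[of n] by simp
    from this[of "- a (Suc n)"] show ?thesis unfolding 1 by (metis minus_minus)
  qed
  have carry: "a n = digit_carry p (a 0) d n" for n
    by (induction n) (use * in auto)
  have "\<delta> = digits p (a 0) d"
    unfolding digits_def carry [symmetric] using * by blast
  then show ?thesis by (rule that)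
qed

lemma digits_range: "p > 0 \<Longrightarrow> digits p i d n \<in> {0..<int p}"
  by (simp add: digits_def)

text \<open>Both sides are the set of all digit sequences in the class, a description that does not
  mention the representative.\<close>

lemma digits_class:
  assumes "p > 0" "seq_equiv p d d'"
  shows "range (\<lambda>i. digits p i d) = range (\<lambda>i. digits p i d')"
proof -
  have "range (\<lambda>i. digits p i d) \<subseteq> range (\<lambda>i. digits p i d')" if "seq_equiv p d d'" for d d'
  proof (rule image_subsetI)
    fix i
    have "seq_equiv p (digits p i d) d'" using digits_equiv that by (rule seq_equiv_trans)
    then show "digits p i d \<in> range (\<lambda>i. digits p i d')"
      using digits_unique[of p "digits p i d" d'] digits_range[of p i d] assms(1) by blast
  qed
  then show ?thesis using assms(2) seq_equiv_sym by blast
qed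

lemma digits_initial: "\<forall>i<n. d' i = d i \<Longrightarrow> j < n \<Longrightarrow> digits p i d' j = digits p i d j"
proof -
  assume *: "\<forall>i<n. d' i = d i"
  have "j < n \<Longrightarrow> digit_carry p i d' j = digit_carry p i d j" for j
    by (induction j) (use * in auto)
  then show "j < n \<Longrightarrow> digits p i d' j = digits p i d j" using * by (simp add: digits_def)
qed

section \<open>Extensions of \<open>Z[1/p]\<close> by the integers\<close>

lemma Z_inv_iff:
  assumes "p > 0" shows "x \<in> Z_inv p \<longleftrightarrow> (\<exists>n. x * of_nat p ^ n \<in> \<int>)"
proof
  assume "x \<in> Z_inv p"
  then obtain k n where "x = of_int k / of_nat p ^ n" unfolding Z_inv_def by blast
  then have "x * of_nat p ^ n = of_int k" using assms by simp
  then show "\<exists>n. x * of_nat p ^ n \<in> \<int>" by (metis Ints_of_int)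
next
  assume "\<exists>n. x * of_nat p ^ n \<in> \<int>"
  then obtain n k where "x * of_nat p ^ n = of_int k" by (auto elim: Ints_cases)
  then have "x = of_int k / of_nat p ^ n" using assms by (simp add: field_simps)
  then show "x \<in> Z_inv p" unfolding Z_inv_def by blast
qed

locale Z_inv_ext =
  fixes p :: nat assumes p: "p \<ge> 2"
begin

abbreviation C :: "rat set" where "C \<equiv> Z_inv p"

definition den :: "rat \<Rightarrow> nat" where "den x = (LEAST n. x * of_nat p ^ n \<in> \<int>)"

lemma Ints_mult_power: "x \<in> C \<Longrightarrow> den x \<le> n \<Longrightarrow> x * of_nat p ^ n \<in> \<int>"
proof -
  assume x: "x \<in> C" "den x \<le> n"
  have "x * of_nat p ^ den x \<in> \<int>"
    unfolding den_def using x(1) p Z_inv_iff[of p x] by (auto intro: LeastI)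
  then have "x * of_nat p ^ den x * of_nat p ^ (n - den x) \<in> \<int>" by simp
  then show ?thesis using x(2) by (simp add: mult.assoc flip: power_add)
qed

lemma C_I: "x * of_nat p ^ n \<in> \<int> \<Longrightarrow> x \<in> C"
  using p Z_inv_iff[of p x] by auto

lemma C_zero: "0 \<in> C" by (rule C_I[of _ 0]) simp

lemma C_add: "x \<in> C \<Longrightarrow> y \<in> C \<Longrightarrow> x + y \<in> C"
  using Ints_mult_power[of x "max (den x) (den y)"] Ints_mult_power[of y "max (den x) (den y)"]
  by (intro C_I[of _ "max (den x) (den y)"]) (simp add: distrib_right)

definition unit_frac :: "nat \<Rightarrow> rat" where "unit_frac n = 1 / of_nat p ^ n"

lemma unit_frac_mult: "of_int i * unit_frac n \<in> C"
  using p by (intro C_I[of _ n]) (simp add: unit_frac_def)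

lemma den_unit_frac: "den (unit_frac n) = n"
  unfolding den_def
proof (rule Least_equality)
  show "unit_frac n * of_nat p ^ n \<in> \<int>" using p by (simp add: unit_frac_def)
  fix m assume m: "unit_frac n * of_nat p ^ m \<in> \<int>"
  show "n \<le> m"
  proof (rule ccontr)
    assume "\<not> n \<le> m"
    then obtain k where k: "n = m + Suc k" using less_imp_Suc_add[of m n] by auto
    obtain z where "unit_frac n * of_nat p ^ m = of_int z" using m by (auto elim: Ints_cases)
    then have "(of_int z :: rat) * of_nat p ^ Suc k = 1"
      using p unfolding k unit_frac_def by (simp add: field_simps power_add)
    then have "(of_int (z * int p ^ Suc k) :: rat) = of_int 1" by simp
    then have "z * int p ^ Suc k = 1" unfolding of_int_eq_iff .
    then have "int p dvd 1" by (metis dvd_mult dvd_triv_left power_Suc)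
    then show False using p by simp
  qed
qed

text \<open>The value prescribed at \<open>p ^ -n\<close> for a rational function on
  \<open>C\<close> whose coboundary is the cocycle to be built, normalised to 0 at the argument
  1.\<close>

fun slope :: "(nat \<Rightarrow> int) \<Rightarrow> nat \<Rightarrow> rat" where
  "slope d 0 = 0"
| "slope d (Suc n) = (slope d n + of_int (d n)) / of_nat p"

lemma slope_Suc: "of_nat p * slope d (Suc n) = slope d n + of_int (d n)"
  using p by simp

text \<open>The factor \<open>x * of_nat p ^ den x\<close> is the numerator of \<open>x\<close> over
  its least denominator. The values at the unit fractions are thus continued linearly, at the price
  that additivity holds only modulo integers.\<close>

definition sect :: "(nat \<Rightarrow> int) \<Rightarrow> rat \<Rightarrow> rat" where
  "sect d x = x * of_nat p ^ den x * slope d (den x)"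

text \<open>Passing from denominator exponent \<open>n\<close> to \<open>n + 1\<close> changes the
  value by the integral numerator times \<open>d n\<close>.\<close>

lemma sect_mod_Ints:
  assumes "x \<in> C" "den x \<le> n" shows "x * of_nat p ^ n * slope d n - sect d x \<in> \<int>"
  using assms(2)
proof (induction n rule: dec_induct)
  case (step n)
  have "x * of_nat p ^ Suc n * slope d (Suc n) = x * of_nat p ^ n * (slope d n + of_int (d n))"
    unfolding slope_Suc[symmetric] by simp
  then have "x * of_nat p ^ Suc n * slope d (Suc n) - sect d x =
      (x * of_nat p ^ n * slope d n - sect d x) + x * of_nat p ^ n * of_int (d n)"
    by (simp add: algebra_simps)
  also have "\<dots> \<in> \<int>"
    by (rule Ints_add[OF step.IH Ints_mult[OF Ints_mult_power[OF assms(1) step.hyps(1)] Ints_of_int]])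
  finally show ?case .
qed (simp add: sect_def)

text \<open>Over a common denominator the expression is linear in the argument, and by
  \<open>sect_mod_Ints\<close> it differs from \<open>sect\<close> by integers.\<close>

lemma sect_cobounds:
  assumes "x \<in> C" "y \<in> C" shows "sect d x + sect d y - sect d (x + y) \<in> \<int>"
proof -
  let ?n = "max (den x) (max (den y) (den (x + y)))"
  define g where "g = (\<lambda>z. z * of_nat p ^ ?n * slope d ?n)"
  have "g x - sect d x \<in> \<int>" "g y - sect d y \<in> \<int>" "g (x + y) - sect d (x + y) \<in> \<int>"
    unfolding g_def using assms C_add by (intro sect_mod_Ints; simp)+
  then have "(g (x + y) - sect d (x + y)) - (g x - sect d x) - (g y - sect d y) \<in> \<int>"
    using Ints_diff by blast
  moreover have "g (x + y) = g x + g y" by (simp add: g_def algebra_simps)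
  ultimately show ?thesis by (simp add: algebra_simps)
qed

lemma sect_zero [simp]: "sect d 0 = 0" by (simp add: sect_def)

text \<open>The floor merely turns a rational number known to be integral into an integer.\<close>

definition ext_of :: "(nat \<Rightarrow> int) \<Rightarrow> rat \<times> rat \<Rightarrow> int" where
  "ext_of d = (\<lambda>(x, y) \<in> C \<times> C. \<lfloor>sect d x + sect d y - sect d (x + y)\<rfloor>)"

lemma of_int_ext_of:
  "x \<in> C \<Longrightarrow> y \<in> C \<Longrightarrow> of_int (ext_of d (x, y)) = sect d x + sect d y - sect d (x + y)"
  using sect_cobounds[of x y d] by (simp add: ext_of_def)

lemma ext_of_cocycle: "ext_of d \<in> ext_cocycles C UNIV"
proof -
  have "ext_of d (x, y) + ext_of d (x + y, z) = ext_of d (x, y + z) + ext_of d (y, z)"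
    if "x \<in> C" "y \<in> C" "z \<in> C" for x y z
  proof -
    have "(of_int (ext_of d (x, y) + ext_of d (x + y, z)) :: rat) = of_int (ext_of d (x, y + z) + ext_of d (y, z))"
      using that C_add by (simp add: of_int_ext_of add.assoc)
    then show ?thesis unfolding of_int_eq_iff .
  qed
  moreover have "ext_of d (x, y) = ext_of d (y, x)" if "x \<in> C" "y \<in> C" for x y
    using that by (simp add: ext_of_def add.commute)
  ultimately show ?thesis
    unfolding ext_cocycles_def by (auto simp: ext_of_def C_zero)
qed

text \<open>If the difference is the coboundary of \<open>k\<close>, then the difference of the two
  sections minus \<open>k\<close> is additive, and comparing its values at consecutive unit
  fractions yields the relation with \<open>a n = k (unit_frac n)\<close>. Conversely a suitable
  homomorphism to the rationals has to be subtracted from the difference of the sections to make it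
  integral.\<close>

lemma ext_rel_ext_of_iff:
  "(ext_of d, ext_of d') \<in> ext_rel C UNIV \<longleftrightarrow> seq_equiv p d d'"
proof
  define \<sigma> where "\<sigma> = (\<lambda>x. sect d x - sect d' x)"
  have \<sigma>: "\<sigma> x + \<sigma> y - \<sigma> (x + y) = of_int (ext_of d (x, y) - ext_of d' (x, y))" if "x \<in> C" "y \<in> C" for x y
    using that by (simp add: of_int_ext_of \<sigma>_def)
  have \<sigma>u: "\<sigma> (unit_frac n) = slope d n - slope d' n" for n
    using p by (simp add: \<sigma>_def sect_def den_unit_frac) (simp add: unit_frac_def)
  {
    assume "(ext_of d, ext_of d') \<in> ext_rel C UNIV"
    then obtain k :: "rat \<Rightarrow> int" where k: "k 0 = 0"
      "(\<lambda>u\<in>C \<times> C. ext_of d u - ext_of d' u) = (\<lambda>(x, y)\<in>C \<times> C. k x + k y - k (x + y))"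
      unfolding ext_rel_def ext_coboundaries_def by blast
    define \<phi> where "\<phi> = (\<lambda>x. \<sigma> x - of_int (k x))"
    have add: "\<phi> (x + y) = \<phi> x + \<phi> y" if "x \<in> C" "y \<in> C" for x y
    proof -
      have "ext_of d (x, y) - ext_of d' (x, y) = k x + k y - k (x + y)"
        using fun_cong[OF k(2), of "(x, y)"] that by simp
      then show ?thesis using \<sigma>[OF that] by (simp add: \<phi>_def)
    qed
    have "\<phi> 0 = 0" using k(1) by (simp add: \<phi>_def \<sigma>_def)
    then have mult: "\<phi> (of_nat m * unit_frac n) = of_nat m * \<phi> (unit_frac n)" for m n
    proof (induction m)
      case (Suc m)
      have "\<phi> (of_nat m * unit_frac n + unit_frac n) = \<phi> (of_nat m * unit_frac n) + \<phi> (unit_frac n)"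
        using unit_frac_mult[of "int m" n] unit_frac_mult[of 1 n] by (intro add) auto
      then show ?case using Suc by (simp add: algebra_simps)
    qed simp
    have step: "\<phi> (unit_frac n) = of_nat p * \<phi> (unit_frac (Suc n))" for n
      using mult[of p "Suc n"] p by (simp add: unit_frac_def)
    have step: "slope d n - slope d' n - of_int (k (unit_frac n)) =
       of_nat p * (slope d (Suc n) - slope d' (Suc n) - of_int (k (unit_frac (Suc n))))" for n
      using step[of n] unfolding \<phi>_def \<sigma>u .
    have "of_int (d n - d' n) = (of_int (int p * k (unit_frac (Suc n)) - k (unit_frac n)) :: rat)" for n
      using step[of n] unfolding right_diff_distrib slope_Suc by simp
    then have "d n - d' n = int p * k (unit_frac (Suc n)) - k (unit_frac n)" for n
      unfolding of_int_eq_iff .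
    then show "seq_equiv p d d'" by (rule seq_equivI)
  next
    assume "seq_equiv p d d'"
    then obtain a where a: "\<And>n. d n - d' n = int p * a (Suc n) - a n" unfolding seq_equiv_def by blast
    \<comment> \<open>These numbers satisfy \<open>of_nat p * \<phi> (Suc n) = \<phi> n\<close>:
      they are the values at the unit fractions of the homomorphism sending \<open>x\<close> to
      \<open>x * \<phi> 0\<close>, and this is the one to subtract.\<close>
    define \<phi> where "\<phi> = (\<lambda>n. slope d n - slope d' n - of_int (a n))"
    have \<phi>Suc: "of_nat p * \<phi> (Suc n) = \<phi> n" for n
    proof -
      have "of_nat p * \<phi> (Suc n) = slope d n - slope d' n + (of_int (d n - d' n) - of_int (int p * a (Suc n)))"
        unfolding \<phi>_def right_diff_distrib slope_Suc by simp
      then show ?thesis unfolding a by (simp add: \<phi>_def)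
    qed
    have \<phi>0: "of_nat p ^ n * \<phi> n = \<phi> 0" for n
      by (induction n) (simp, metis \<phi>Suc mult.assoc power_Suc2)
    have int: "\<sigma> x - x * \<phi> 0 \<in> \<int>" if "x \<in> C" for x
    proof -
      let ?n = "den x"
      have "x * \<phi> 0 = x * of_nat p ^ ?n * \<phi> ?n" by (simp add: \<phi>0[of ?n, symmetric] mult.assoc)
      then have "\<sigma> x - x * \<phi> 0 = x * of_nat p ^ ?n * of_int (a ?n)"
        by (simp add: \<sigma>_def sect_def \<phi>_def algebra_simps)
      then show ?thesis using Ints_mult_power[OF that order_refl] by simp
    qed
    define k where "k = (\<lambda>x. \<lfloor>\<sigma> x - x * \<phi> 0\<rfloor>)"
    have k: "of_int (k x) = \<sigma> x - x * \<phi> 0" if "x \<in> C" for x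
      using int[OF that] by (simp add: k_def)
    have "ext_of d (x, y) - ext_of d' (x, y) = k x + k y - k (x + y)" if "x \<in> C" "y \<in> C" for x y
    proof -
      have "(of_int (ext_of d (x, y) - ext_of d' (x, y)) :: rat) = of_int (k x + k y - k (x + y))"
        unfolding \<sigma>[OF that, symmetric] using that C_add by (simp add: k algebra_simps)
      then show ?thesis unfolding of_int_eq_iff .
    qed
    then have "(\<lambda>u\<in>C \<times> C. ext_of d u - ext_of d' u) = (\<lambda>(x, y)\<in>C \<times> C. k x + k y - k (x + y))"
      by (intro restrict_ext) auto
    moreover have "k 0 = 0" by (simp add: k_def \<sigma>_def)
    ultimately show "(ext_of d, ext_of d') \<in> ext_rel C UNIV"
      unfolding ext_rel_def ext_coboundaries_def using ext_of_cocycle by blast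
  }
qed

end

section \<open>Every extension comes from a sequence, continuously in the sequence\<close>

context Z_inv_ext begin

lemma ext_of_zero: "ext_of (\<lambda>_. 0) = (\<lambda>u\<in>C \<times> C. 0)"
proof -
  have "slope (\<lambda>_. 0) n = 0" for n by (induction n) auto
  then show ?thesis by (auto simp: ext_of_def sect_def fun_eq_iff)
qed

text \<open>Solving k(i u) + k(u) - k((i + 1) u) = g(i u, u) under k(0) = k(u) = 0 leaves no choice;
  the second branch runs the recursion backwards.\<close>

definition walk :: "(rat \<times> rat \<Rightarrow> int) \<Rightarrow> rat \<Rightarrow> int \<Rightarrow> int" where
  "walk g u i = (if 0 \<le> i then - (\<Sum>t\<in>{0..<i}. g (of_int t * u, u)) else (\<Sum>t\<in>{i..<0}. g (of_int t * u, u)))"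

lemma walk_step: "walk g u (i + 1) = walk g u i - g (of_int i * u, u)"
proof (cases "0 \<le> i")
  case True
  then have "{0..<i + 1} = insert i {0..<i}" by auto
  then show ?thesis using True by (simp add: walk_def)
next
  case False
  then have "{i..<0} = insert i {i + 1..<0}" by auto
  then show ?thesis using False by (auto simp: walk_def)
qed

lemma walk_zero [simp]: "walk g u 0 = 0" by (simp add: walk_def)

lemma cocycleD:
  assumes "g \<in> ext_cocycles C UNIV"
  shows "x \<in> C \<Longrightarrow> g (x, 0) = 0" "x \<in> C \<Longrightarrow> g (0, x) = 0"
    "x \<in> C \<Longrightarrow> y \<in> C \<Longrightarrow> z \<in> C \<Longrightarrow> g (x, y) + g (x + y, z) = g (x, y + z) + g (y, z)"
  using assms unfolding ext_cocycles_def by auto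

text \<open>The construction provides the case of a single step; the cocycle identity at the
  multiples by \<open>i\<close>, \<open>j\<close> and 1 carries it to all \<open>j\<close>, in both
  directions.\<close>

lemma walk_cobounds:
  assumes g: "g \<in> ext_cocycles C UNIV" and u: "\<And>i. of_int i * u \<in> C"
  shows "walk g u i + walk g u j - walk g u (i + j) = g (of_int i * u, of_int j * u)"
proof (induction j rule: int_induct[where k = 0])
  case base
  then show ?case using cocycleD(1)[OF g u[of i]] by simp
next
  case (step1 j)
  have "g (of_int i * u, of_int j * u) + g (of_int i * u + of_int j * u, u) =
      g (of_int i * u, of_int j * u + u) + g (of_int j * u, u)"
    using u[of 1] by (intro cocycleD(3)[OF g u u]) simp
  then show ?case
    using step1 walk_step[of g u j] walk_step[of g u "i + j"]
    by (simp add: algebra_simps)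
next
  case (step2 j)
  have "g (of_int i * u, of_int (j - 1) * u) + g (of_int i * u + of_int (j - 1) * u, u) =
      g (of_int i * u, of_int (j - 1) * u + u) + g (of_int (j - 1) * u, u)"
    using u[of 1] by (intro cocycleD(3)[OF g u u]) simp
  then show ?case
    using step2 walk_step[of g u "j - 1"] walk_step[of g u "i + (j - 1)"]
    by (simp add: algebra_simps)
qed

text \<open>On the cyclic subgroup generated by \<open>p ^ -n\<close> every cocycle is the coboundary of a walk; the
  walks for \<open>n\<close> and \<open>n + 1\<close> differ by a homomorphism, whose value on the generator is the \<open>n\<close>-th
  term of the sequence.\<close>

lemma ext_of_surj:
  assumes g: "g \<in> ext_cocycles C UNIV"
  obtains d where "(g, ext_of d) \<in> ext_rel C UNIV"
proof -
  define f where "f = (\<lambda>n. walk g (unit_frac n))"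
  have f: "f n i + f n j - f n (i + j) = g (of_int i * unit_frac n, of_int j * unit_frac n)" for n i j
    unfolding f_def using g unit_frac_mult by (intro walk_cobounds)
  have f0: "f n 0 = 0" for n by (simp add: f_def)
  have f1: "f n 1 = 0" for n
    using walk_step[of g "unit_frac n" 0] cocycleD(2)[OF g, of "unit_frac n"] unit_frac_mult[of 1 n] by (simp add: f_def)
  \<comment> \<open>The sign is chosen so that the linear term given by \<open>slope\<close> cancels
    the growth of the walks in the invariance \<open>S\<close> below.\<close>
  define d where "d = (\<lambda>n. - f (Suc n) (int p))"
  have pu: "of_int (int p) * unit_frac (Suc n) = unit_frac n" for n
    using p by (simp add: unit_frac_def)
  have step: "f (Suc n) (int p * i) - f n i = i * f (Suc n) (int p)" for n i
  proof -
    have S: "f (Suc n) (int p * (i + 1)) - f n (i + 1) = f (Suc n) (int p * i) - f n i + f (Suc n) (int p)" for i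
    proof -
      have "g (of_int (int p * i) * unit_frac (Suc n), of_int (int p) * unit_frac (Suc n)) =
          g (of_int i * unit_frac n, of_int 1 * unit_frac n)"
        unfolding of_int_mult mult.commute[of "of_int (int p)" "of_int i"] mult.assoc pu by simp
      then show ?thesis
        using f[of "Suc n" "int p * i" "int p"] f[of n i 1] f1 by (simp add: algebra_simps)
    qed
    show ?thesis
    proof (induction i rule: int_induct[where k = 0])
      case (step1 i) then show ?case using S[of i] by (simp add: algebra_simps)
    next
      case (step2 i) then show ?case using S[of "i - 1"] by (simp add: algebra_simps)
    qed (simp add: f0)
  qed
  define num where "num = (\<lambda>(x::rat) n. \<lfloor>x * of_nat p ^ n\<rfloor>)"
  have num: "of_int (num x n) = x * of_nat p ^ n" if "x \<in> C" "den x \<le> n" for x n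
    using Ints_mult_power[OF that] by (simp add: num_def)
  define k where "k = (\<lambda>x. f (den x) (num x (den x)))"
  \<comment> \<open>From \<open>n\<close> to \<open>n + 1\<close> the walk gains
    \<open>num x n * f (Suc n) (int p)\<close> and the linear term loses the same. So the sum may be
    evaluated over a denominator common to \<open>x\<close>, \<open>y\<close> and
    \<open>x + y\<close>, where the linear terms cancel.\<close>
  have S: "of_int (f n (num x n)) + x * of_nat p ^ n * slope d n = of_int (k x) + sect d x"
    if x: "x \<in> C" and n: "den x \<le> n" for x n
    using n
  proof (induction n rule: dec_induct)
    case (step n)
    have "(of_int (num x (Suc n)) :: rat) = of_int (int p * num x n)"
      using num[OF x, of n] num[OF x, of "Suc n"] step.hyps by simp
    then have "num x (Suc n) = int p * num x n" unfolding of_int_eq_iff .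
    then have "f (Suc n) (num x (Suc n)) = f n (num x n) + num x n * f (Suc n) (int p)"
      using \<open>\<And>n i. f (Suc n) (int p * i) - f n i = i * f (Suc n) (int p)\<close>[of n "num x n"] by simp
    moreover have "x * of_nat p ^ Suc n * slope d (Suc n) = x * of_nat p ^ n * (slope d n - of_int (f (Suc n) (int p)))"
    proof -
      have "x * of_nat p ^ Suc n * slope d (Suc n) = x * of_nat p ^ n * (of_nat p * slope d (Suc n))"
        by (simp only: power_Suc ac_simps)
      then show ?thesis unfolding slope_Suc by (simp only: d_def of_int_minus add_uminus_conv_diff)
    qed
    ultimately have "of_int (f (Suc n) (num x (Suc n))) + x * of_nat p ^ Suc n * slope d (Suc n) =
        of_int (f n (num x n)) + x * of_nat p ^ n * slope d n"
      using num[OF x, of n] step.hyps by (simp only:) (simp add: algebra_simps)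
    then show ?case using step.IH by simp
  qed (simp add: k_def sect_def)
  have main: "g (x, y) - ext_of d (x, y) = k x + k y - k (x + y)" if xy: "x \<in> C" "y \<in> C" for x y
  proof -
    let ?n = "max (den x) (max (den y) (den (x + y)))"
    have le: "den x \<le> ?n" "den y \<le> ?n" "den (x + y) \<le> ?n" by auto
    have xyC: "x + y \<in> C" using xy C_add by blast
    have "(of_int (num (x + y) ?n) :: rat) = of_int (num x ?n + num y ?n)"
      using num[OF xy(1) le(1)] num[OF xy(2) le(2)] num[OF xyC le(3)] by (simp add: algebra_simps)
    then have n: "num (x + y) ?n = num x ?n + num y ?n" unfolding of_int_eq_iff .
    have u: "of_int (num x ?n) * unit_frac ?n = x" "of_int (num y ?n) * unit_frac ?n = y"
      using num[OF xy(1) le(1)] num[OF xy(2) le(2)] p by (simp_all add: unit_frac_def)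
    have G: "g (x, y) = f ?n (num x ?n) + f ?n (num y ?n) - f ?n (num (x + y) ?n)"
      unfolding n using f[of ?n "num x ?n" "num y ?n", unfolded u] by (rule sym)
    have "(of_int (g (x, y)) :: rat) = of_int (f ?n (num x ?n)) + of_int (f ?n (num y ?n)) - of_int (f ?n (num (x + y) ?n))"
      unfolding G by simp
    moreover have "(x + y) * of_nat p ^ ?n * slope d ?n = x * of_nat p ^ ?n * slope d ?n + y * of_nat p ^ ?n * slope d ?n"
      by (simp only: distrib_right)
    ultimately have "(of_int (g (x, y)) :: rat) = (of_int (k x) + sect d x) + (of_int (k y) + sect d y) - (of_int (k (x + y)) + sect d (x + y))"
      using S[OF xy(1) le(1)] S[OF xy(2) le(2)] S[OF xyC le(3)] by linarith
    then have "(of_int (g (x, y) - ext_of d (x, y)) :: rat) = of_int (k x + k y - k (x + y))"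
      using of_int_ext_of[OF xy, of d] by simp
    then show ?thesis unfolding of_int_eq_iff .
  qed
  then have "(\<lambda>u\<in>C \<times> C. g u - ext_of d u) = (\<lambda>(x, y)\<in>C \<times> C. k x + k y - k (x + y))"
    by (intro restrict_ext) auto
  moreover have "k 0 = 0" by (simp add: k_def num_def f0)
  ultimately have "(g, ext_of d) \<in> ext_rel C UNIV"
    unfolding ext_rel_def ext_coboundaries_def using ext_of_cocycle g by blast
  then show ?thesis by (rule that)
qed

lemma equiv_ext_rel: "equiv (ext_cocycles C (UNIV :: int set)) (ext_rel C UNIV)"
proof (rule equivI)
  let ?B = "ext_coboundaries C (UNIV :: int set)"
  have cob: "(\<lambda>u\<in>C \<times> C. h u) \<in> ?B" if "k 0 = 0" "\<And>x y. x \<in> C \<Longrightarrow> y \<in> C \<Longrightarrow> h (x, y) = k x + k y - k (x + y)" for h k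
    unfolding ext_coboundaries_def using that by (intro CollectI exI[of _ k]) (auto intro!: restrict_ext)
  have ex: "\<exists>k. k 0 = 0 \<and> (\<forall>x\<in>C. \<forall>y\<in>C. h (x, y) = k x + k y - k (x + y))" if h: "(\<lambda>u\<in>C \<times> C. h u) \<in> ?B" for h
  proof -
    obtain k where k: "k 0 = 0" "(\<lambda>u\<in>C \<times> C. h u) = (\<lambda>(x, y)\<in>C \<times> C. k x + k y - k (x + y))"
      using h unfolding ext_coboundaries_def by blast
    have "h (x, y) = k x + k y - k (x + y)" if "x \<in> C" "y \<in> C" for x y
      using fun_cong[OF k(2), of "(x, y)"] that by simp
    then show ?thesis using k(1) by blast
  qed
  show "ext_rel C (UNIV :: int set) \<subseteq> ext_cocycles C UNIV \<times> ext_cocycles C UNIV" by (auto simp: ext_rel_def)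
  show "refl_on (ext_cocycles C (UNIV :: int set)) (ext_rel C UNIV)"
  proof (rule refl_onI)
    fix g :: "rat \<times> rat \<Rightarrow> int" assume "g \<in> ext_cocycles C UNIV"
    moreover have "(\<lambda>u\<in>C \<times> C. g u - g u) \<in> ?B" by (rule cob[of "\<lambda>_. 0"]) auto
    ultimately show "(g, g) \<in> ext_rel C UNIV" by (simp add: ext_rel_def)
  qed
  show "sym (ext_rel C (UNIV :: int set))"
  proof (rule symI)
    fix g g' :: "rat \<times> rat \<Rightarrow> int" assume gg: "(g, g') \<in> ext_rel C UNIV"
    then obtain k where "k 0 = 0" "\<forall>x\<in>C. \<forall>y\<in>C. g (x, y) - g' (x, y) = k x + k y - k (x + y)"
      using ex[of "\<lambda>u. g u - g' u"] by (auto simp: ext_rel_def)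
    then have "(\<lambda>u\<in>C \<times> C. g' u - g u) \<in> ?B" by (intro cob[of "\<lambda>x. - k x"]) (auto simp: algebra_simps)
    then show "(g', g) \<in> ext_rel C UNIV" using gg by (simp add: ext_rel_def)
  qed
  show "trans (ext_rel C (UNIV :: int set))"
  proof (rule transI)
    fix g g' g'' :: "rat \<times> rat \<Rightarrow> int"
    assume gg: "(g, g') \<in> ext_rel C UNIV" "(g', g'') \<in> ext_rel C UNIV"
    obtain k where k: "k 0 = 0" "\<forall>x\<in>C. \<forall>y\<in>C. g (x, y) - g' (x, y) = k x + k y - k (x + y)"
      using ex[of "\<lambda>u. g u - g' u"] gg(1) by (auto simp: ext_rel_def)
    obtain l where l: "l 0 = 0" "\<forall>x\<in>C. \<forall>y\<in>C. g' (x, y) - g'' (x, y) = l x + l y - l (x + y)"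
      using ex[of "\<lambda>u. g' u - g'' u"] gg(2) by (auto simp: ext_rel_def)
    have "(\<lambda>u\<in>C \<times> C. g u - g'' u) \<in> ?B"
    proof (rule cob[of "\<lambda>x. k x + l x"])
      fix x y assume "x \<in> C" "y \<in> C"
      then have "g (x, y) - g' (x, y) = k x + k y - k (x + y)" "g' (x, y) - g'' (x, y) = l x + l y - l (x + y)"
        using k l by blast+
      then show "g (x, y) - g'' (x, y) = k x + l x + (k y + l y) - (k (x + y) + l (x + y))" by linarith
    qed (use k l in simp)
    then show "(g, g'') \<in> ext_rel C UNIV" using gg by (simp add: ext_rel_def)
  qed
qed

lemma topspace_ext_space: "topspace (ext_space C (UNIV :: int set)) = ext_cocycles C UNIV"
  unfolding ext_space_def by (auto simp: ext_cocycles_def)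

text \<open>The value at a pair \<open>(x, y)\<close> involves the section at three points only,
  hence finitely many slopes.\<close>

lemma ext_of_initial:
  obtains n where "\<And>d'. \<forall>i<n. d' i = d i \<Longrightarrow> ext_of d' u = ext_of d u"
proof -
  have slope: "slope d' m = slope d m" if "\<forall>i<n. d' i = d i" "m \<le> n" for d' n m
    using that(2) by (induction m) (use that(1) in auto)
  obtain x y where u: "u = (x, y)" by (cases u)
  let ?n = "max (den x) (max (den y) (den (x + y)))"
  show ?thesis
  proof (rule that[of ?n])
    fix d' assume d': "\<forall>i<?n. d' i = d i"
    have "sect d' z = sect d z" if "z \<in> {x, y, x + y}" for z
    proof -
      have "den z \<le> ?n" using that by (auto simp: le_max_iff_disj)
      then show ?thesis using slope[OF d'] by (simp add: sect_def)
    qed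
    then show "ext_of d' u = ext_of d u" by (simp add: ext_of_def u restrict_def)
  qed
qed

lemma ext_of_continuous:
  assumes U: "openin (ext_space C (UNIV :: int set)) U" "ext_of d \<in> U"
  shows "\<exists>n. \<forall>d'. (\<forall>i<n. d' i = d i) \<longrightarrow> ext_of d' \<in> U"
proof -
  obtain W where W: "openin (product_topology (\<lambda>_. discrete_topology (UNIV :: int set)) (C \<times> C)) W"
      "U = W \<inter> ext_cocycles C UNIV"
    using U(1) unfolding ext_space_def openin_subtopology by blast
  then obtain B where B: "finite {u \<in> C \<times> C. B u \<noteq> (UNIV :: int set)}" "ext_of d \<in> Pi\<^sub>E (C \<times> C) B" "Pi\<^sub>E (C \<times> C) B \<subseteq> W"
    using U(2) unfolding openin_product_topology_alt topspace_discrete_topology by blast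
  let ?I = "{u \<in> C \<times> C. B u \<noteq> (UNIV :: int set)}"
  have "\<forall>u. \<exists>n. \<forall>d'. (\<forall>i<n. d' i = d i) \<longrightarrow> ext_of d' u = ext_of d u"
    by (metis ext_of_initial)
  then obtain N where N: "\<And>u d'. \<forall>i<N u. d' i = d i \<Longrightarrow> ext_of d' u = ext_of d u" by metis
  show ?thesis
  proof (intro exI allI impI)
    fix d' assume d': "\<forall>i<Max (insert 0 (N ` ?I)). d' i = d i"
    have "ext_of d' u \<in> B u" if u: "u \<in> C \<times> C" for u
    proof (cases "u \<in> ?I")
      case True
      then have "N u \<le> Max (insert 0 (N ` ?I))" using B(1) by (intro Max_ge) auto
      then have "ext_of d' u = ext_of d u" using d' by (intro N) auto
      then show ?thesis using B(2) u by auto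
    qed (use u in auto)
    then have "ext_of d' \<in> Pi\<^sub>E (C \<times> C) B"
      by (intro PiE_I) (auto simp: ext_of_def)
    then show "ext_of d' \<in> U" using B(3) W(2) ext_of_cocycle by blast
  qed
qed

end

section \<open>Degree sequences of maps on a telescope of solid tori\<close>

lemma has_degree_in_Circ:
  assumes "has_degree C u d" "y \<in> Circ \<times> C" shows "u y \<in> Circ"
  using assms unfolding has_degree_def by (auto simp: norm_mult norm_power_int)

lemma csc_cancel:
  assumes "csc u g = csc v g" "g \<in> S3c" shows "u = v"
  using assms by (cases g) (auto simp: csc_def)

lemma hopf_liftD:
  assumes "hopf_lift S f g"
  shows "continuous_on S g" "g ` S \<subseteq> S3c" "x \<in> S \<Longrightarrow> g x \<in> S3c" "x \<in> S \<Longrightarrow> hopf (g x) = f x"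
  using assms unfolding hopf_lift_def by blast+

lemma lift_pair_degree:
  fixes C :: "'c::euclidean_space set"
  assumes C: "convex C" "compact C"
    and a: "continuous_on (Circ \<times> C) a" "a ` (Circ \<times> C) \<subseteq> S3c"
    and b: "continuous_on (Circ \<times> C) b" "b ` (Circ \<times> C) \<subseteq> S3c"
    and eq: "\<And>y. y \<in> Circ \<times> C \<Longrightarrow> hopf (a y) = hopf (b y)"
  obtains u d where "has_degree C u d" "\<And>y. y \<in> Circ \<times> C \<Longrightarrow> a y = csc (u y) (b y)"
proof -
  define u where "u = (\<lambda>y. herm (a y) (b y))"
  have *: "a y = csc (u y) (b y)" "u y \<in> Circ" if y: "y \<in> Circ \<times> C" for y
  proof -
    have "a y \<in> S3c" "b y \<in> S3c" using a(2) b(2) y by blast+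
    then show "a y = csc (u y) (b y)" "u y \<in> Circ"
      using hopf_fibre[of "b y" "a y"] eq[OF y] by (simp_all add: u_def)
  qed
  have "continuous_on (Circ \<times> C) u" unfolding u_def by (intro continuous_intros a b)
  then obtain d where "has_degree C u d"
    using has_degree_exists[OF C, of u] *(2) by blast
  then show ?thesis using that * by blast
qed

text \<open>All stages are parametrised by the same solid torus, and the inclusion of each stage
  into the next is always the same map \<open>e\<close>.\<close>

locale telescope = exhaustion X Xs V for X :: "'a::euclidean_space set" and Xs V +
  fixes p :: nat and r :: real and e :: "complex \<times> complex \<Rightarrow> complex \<times> complex"
    and j :: "nat \<Rightarrow> complex \<times> complex \<Rightarrow> 'a"
  assumes p: "p \<ge> 2" and r: "r > 0"
    and e: "continuous_on (Circ \<times> cball 0 r) e" "inj_on e (Circ \<times> cball 0 r)"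
      "e ` (Circ \<times> cball 0 r) \<subseteq> Circ \<times> cball 0 r"
    and fst_e: "\<And>y. y \<in> Circ \<times> cball 0 r \<Longrightarrow> fst (e y) = fst y ^ p"
    and j: "\<And>n. continuous_on (Circ \<times> cball 0 r) (j n)" "\<And>n. inj_on (j n) (Circ \<times> cball 0 r)"
      "\<And>n. j n ` (Circ \<times> cball 0 r) = Xs n"
    and j_e: "\<And>n y. y \<in> Circ \<times> cball 0 r \<Longrightarrow> j n y = j (Suc n) (e y)"
begin

abbreviation D :: "complex set" where "D \<equiv> cball 0 r"
abbreviation ST :: "(complex \<times> complex) set" where "ST \<equiv> Circ \<times> D"

lemma compact_ST: "compact ST" by (intro compact_Times) auto

lemma e_ST: "y \<in> ST \<Longrightarrow> e y \<in> ST" using e(3) by blast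

lemma j_Xs: "y \<in> ST \<Longrightarrow> j n y \<in> Xs n" using j(3) by blast

lemma j_X: "y \<in> ST \<Longrightarrow> j n y \<in> X" using j_Xs Xs_sub by blast

definition e_inv :: "complex \<times> complex \<Rightarrow> complex \<times> complex" where "e_inv = inv_into ST e"

lemma e_inv_e: "y \<in> ST \<Longrightarrow> e_inv (e y) = y" using e(2) by (simp add: e_inv_def)

lemma continuous_on_e_inv: "continuous_on (e ` ST) e_inv"
  using e_inv_e e(1) compact_ST by (intro continuous_on_inv) auto

lemma compact_e_ST: "compact (e ` ST)"
  using e(1) compact_ST by (rule compact_continuous_image)

lemma e_inv_ST: "x \<in> e ` ST \<Longrightarrow> e_inv x \<in> ST" using e_inv_e by auto

definition j_inv :: "nat \<Rightarrow> 'a \<Rightarrow> complex \<times> complex" where "j_inv n = inv_into ST (j n)"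

lemma j_inv_j: "y \<in> ST \<Longrightarrow> j_inv n (j n y) = y" using j(2) by (simp add: j_inv_def)

lemma continuous_on_j_inv: "continuous_on (Xs n) (j_inv n)"
  unfolding j(3)[of n, symmetric] using j_inv_j j(1) compact_ST by (intro continuous_on_inv) auto

lemma j_inv_ST: "x \<in> Xs n \<Longrightarrow> j_inv n x \<in> ST" "x \<in> Xs n \<Longrightarrow> j n (j_inv n x) = x"
  unfolding j(3)[of n, symmetric] using j_inv_j by auto

text \<open>A family compatible with \<open>e\<close> is a function on the union. Reading it off at
  the first stage containing the point is one choice among equals, as \<open>glue_j\<close>
  shows.\<close>

definition glue :: "(nat \<Rightarrow> complex \<times> complex \<Rightarrow> 'b) \<Rightarrow> 'a \<Rightarrow> 'b" where
  "glue \<phi> x = \<phi> (level x) (j_inv (level x) x)"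

lemma glue_j:
  assumes \<phi>: "\<And>n y. y \<in> ST \<Longrightarrow> \<phi> (Suc n) (e y) = \<phi> n y" and y: "y \<in> ST"
  shows "glue \<phi> (j n y) = \<phi> n y"
proof -
  have *: "\<exists>w\<in>ST. j n w = j m z \<and> \<phi> n w = \<phi> m z" if "m \<le> n" "z \<in> ST" for m n z
    using that(1)
  proof (induction n rule: dec_induct)
    case base then show ?case using that by blast
  next
    case (step n)
    then obtain w where "w \<in> ST" "j n w = j m z" "\<phi> n w = \<phi> m z" by blast
    then show ?case using j_e \<phi> e_ST by (intro bexI[of _ "e w"]) auto
  qed
  let ?x = "j n y" let ?m = "level ?x"
  have x: "?x \<in> Xs ?m" using in_Xs_level[OF j_X[OF y]] by blast
  obtain w where w: "w \<in> ST" "j n w = j ?m (j_inv ?m ?x)" "\<phi> n w = \<phi> ?m (j_inv ?m ?x)"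
    using *[OF level_le[OF j_Xs[OF y]] j_inv_ST(1)[OF x]] by blast
  then have "j n w = j n y" using j_inv_ST(2)[OF x] by simp
  then have "w = y" using j(2)[of n] w(1) y by (auto dest: inj_onD)
  then show ?thesis using w(3) by (simp add: glue_def)
qed

lemma glue_Xs:
  assumes "\<And>n y. y \<in> ST \<Longrightarrow> \<phi> (Suc n) (e y) = \<phi> n y" "x \<in> Xs n"
  shows "glue \<phi> x = \<phi> n (j_inv n x)"
  using glue_j[of \<phi>, OF assms(1) j_inv_ST(1)[OF assms(2)], of n] j_inv_ST(2)[OF assms(2)] by simp

lemma continuous_on_glue:
  assumes "\<And>n y. y \<in> ST \<Longrightarrow> \<phi> (Suc n) (e y) = \<phi> n y" "\<And>n. continuous_on ST (\<phi> n)"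
  shows "continuous_on X (glue \<phi>)"
proof (rule continuous_on_X)
  fix n
  have "continuous_on (Xs n) (\<lambda>x. \<phi> n (j_inv n x))"
    by (rule continuous_on_compose2[OF assms(2) continuous_on_j_inv]) (use j_inv_ST(1) in blast)
  then show "continuous_on (Xs n) (glue \<phi>)"
    by (rule continuous_on_eq) (simp add: glue_Xs[of \<phi>, OF assms(1)])
qed

definition step_degree ::
  "(complex \<times> complex \<Rightarrow> complex \<times> complex) \<Rightarrow> (complex \<times> complex \<Rightarrow> complex \<times> complex) \<Rightarrow> int \<Rightarrow> bool" where
  "step_degree g g' d \<longleftrightarrow> (\<exists>u. has_degree D u d \<and> (\<forall>y\<in>ST. g' (e y) = csc (u y) (g y)))"

text \<open>A relation and not a function of \<open>f\<close>: another choice of lifts changes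
  \<open>d\<close>, but only within its class.\<close>

definition coherent :: "('a \<Rightarrow> real^3) \<Rightarrow> (nat \<Rightarrow> int) \<Rightarrow> bool" where
  "coherent f d \<longleftrightarrow> f \<in> cmaps X S2 \<and>
     (\<exists>g. \<forall>n. hopf_lift ST (\<lambda>y. f (j n y)) (g n) \<and> step_degree (g n) (g (Suc n)) (d n))"

lemma D_nonempty: "D \<noteq> {}" using r by auto

lemma step_degree_unique:
  assumes "step_degree g g' d" "step_degree g g' k" "g ` ST \<subseteq> S3c"
  shows "d = k"
proof -
  obtain u v where u: "has_degree D u d" "\<And>y. y \<in> ST \<Longrightarrow> g' (e y) = csc (u y) (g y)"
    and v: "has_degree D v k" "\<And>y. y \<in> ST \<Longrightarrow> g' (e y) = csc (v y) (g y)"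
    using assms(1,2) unfolding step_degree_def by blast
  have "u y = v y" if "y \<in> ST" for y
  proof (rule csc_cancel)
    show "csc (u y) (g y) = csc (v y) (g y)" using u(2)[OF that] v(2)[OF that] by simp
    show "g y \<in> S3c" using assms(3) that by blast
  qed
  then have "has_degree D u k" using v(1) has_degree_cong[of D u v k] by blast
  then show ?thesis using has_degree_unique[OF u(1) _ D_nonempty] by blast
qed

lemma step_degree_exists:
  assumes f: "f \<in> cmaps X S2"
    and g: "hopf_lift ST (\<lambda>y. f (j n y)) g" and g': "hopf_lift ST (\<lambda>y. f (j (Suc n) y)) g'"
  obtains d where "step_degree g g' d"
proof -
  have "continuous_on ST (\<lambda>y. g' (e y))"
    using e(3) by (rule continuous_on_compose2[OF hopf_liftD(1)[OF g'] e(1)])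
  moreover have "(\<lambda>y. g' (e y)) ` ST \<subseteq> S3c"
    using hopf_liftD(3)[OF g'] e_ST by blast
  moreover have "hopf (g' (e y)) = hopf (g y)" if "y \<in> ST" for y
    unfolding hopf_liftD(4)[OF g that] hopf_liftD(4)[OF g' e_ST[OF that]] j_e[OF that] ..
  ultimately obtain u d where "has_degree D u d" "\<And>y. y \<in> ST \<Longrightarrow> g' (e y) = csc (u y) (g y)"
    using lift_pair_degree[OF convex_cball compact_cball _ _ hopf_liftD(1,2)[OF g], of "\<lambda>y. g' (e y)"] by metis
  then show ?thesis using that unfolding step_degree_def by blast
qed

text \<open>Multiplying the \<open>n\<close>-th lift by the power \<open>- a n\<close> of the circle
  coordinate changes the \<open>n\<close>-th degree by \<open>a n - int p * a (Suc n)\<close>; the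
  factor \<open>p\<close> arises because \<open>e\<close> wraps the circle \<open>p\<close>
  times.\<close>

lemma coherent_shift:
  assumes "coherent f d" "seq_equiv p d d'"
  shows "coherent f d'"
proof -
  obtain g where f: "f \<in> cmaps X S2" and g: "\<And>n. hopf_lift ST (\<lambda>y. f (j n y)) (g n)"
      "\<And>n. step_degree (g n) (g (Suc n)) (d n)"
    using assms(1) unfolding coherent_def by blast
  obtain a where a: "\<And>n. d n - d' n = int p * a (Suc n) - a n" using assms(2) unfolding seq_equiv_def by blast
  define g' where "g' = (\<lambda>n y. csc (fst y powi (- a n)) (g n y))"
  have pw: "fst y powi k \<in> Circ" if "y \<in> ST" for y k
    using that by (auto simp: norm_power_int)
  have "hopf_lift ST (\<lambda>y. f (j n y)) (g' n)" for n
    unfolding hopf_lift_def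
  proof (intro conjI ballI)
    show "continuous_on ST (g' n)"
      unfolding g'_def using g(1)[of n] by (intro continuous_intros) (auto simp: hopf_lift_def)
    show "g' n ` ST \<subseteq> S3c"
    proof (rule image_subsetI)
      fix y assume y: "y \<in> ST"
      then have "g n y \<in> S3c" using g(1)[of n] unfolding hopf_lift_def by blast
      then show "g' n y \<in> S3c" unfolding g'_def using pw[OF y] by (intro csc_in_S3c)
    qed
    show "hopf (g' n y) = f (j n y)" if "y \<in> ST" for y
      unfolding g'_def hopf_csc[OF pw[OF that]] by (rule hopf_liftD(4)[OF g(1) that])
  qed
  moreover have "step_degree (g' n) (g' (Suc n)) (d' n)" for n
  proof -
    obtain u where u: "has_degree D u (d n)" "\<And>y. y \<in> ST \<Longrightarrow> g (Suc n) (e y) = csc (u y) (g n y)"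
      using g(2)[of n] unfolding step_degree_def by blast
    let ?v = "\<lambda>y. (fst (e y) powi (- a (Suc n)) * u y) * fst y powi a n"
    have "has_degree D ?v (int p * (- a (Suc n)) + d n + a n)"
      using e fst_e
      by (intro has_degree_mult has_degree_powi u has_degree_compose[OF has_degree_powi[of D "- a (Suc n)"] e(1,3)])
        (auto simp: power_int_of_nat)
    moreover have "int p * (- a (Suc n)) + d n + a n = d' n" using a[of n] by simp
    moreover have "g' (Suc n) (e y) = csc (?v y) (g' n y)" if y: "y \<in> ST" for y
    proof -
      have "fst y \<noteq> 0" using y by auto
      then have "fst y powi a n * fst y powi (- a n) = 1" by (simp flip: power_int_add)
      then have "?v y * fst y powi (- a n) = fst (e y) powi (- a (Suc n)) * u y"
        by (simp only: mult.assoc mult_1_right)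
      then show ?thesis unfolding g'_def u(2)[OF y] csc_csc by (simp only: csc_csc)
    qed
    ultimately show ?thesis unfolding step_degree_def by auto
  qed
  ultimately show ?thesis using f unfolding coherent_def by blast
qed

text \<open>Two lifts of the same map on the \<open>n\<close>-th torus differ by a phase of some
  degree \<open>a n\<close>, and these integers, negated, witness the equivalence.\<close>

lemma coherent_unique:
  assumes "coherent f d" "coherent f d'"
  shows "seq_equiv p d d'"
proof -
  obtain g where f: "f \<in> cmaps X S2" and g: "\<And>n. hopf_lift ST (\<lambda>y. f (j n y)) (g n)"
      "\<And>n. step_degree (g n) (g (Suc n)) (d n)"
    using assms(1) unfolding coherent_def by blast
  obtain g' where g': "\<And>n. hopf_lift ST (\<lambda>y. f (j n y)) (g' n)"
      "\<And>n. step_degree (g' n) (g' (Suc n)) (d' n)"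
    using assms(2) unfolding coherent_def by blast
  have "\<exists>v a. has_degree D v a \<and> (\<forall>y\<in>ST. g' n y = csc (v y) (g n y))" for n
  proof (rule lift_pair_degree[of D "g' n" "g n"])
    show "hopf (g' n y) = hopf (g n y)" if "y \<in> ST" for y
      unfolding hopf_liftD(4)[OF g(1) that] hopf_liftD(4)[OF g'(1) that] ..
    show "continuous_on ST (g n)" "g n ` ST \<subseteq> S3c" "continuous_on ST (g' n)" "g' n ` ST \<subseteq> S3c"
      by (fact hopf_liftD(1,2)[OF g(1)] hopf_liftD(1,2)[OF g'(1)])+
  qed auto
  then obtain v a where v: "\<And>n. has_degree D (v n) (a n)" "\<And>n y. y \<in> ST \<Longrightarrow> g' n y = csc (v n y) (g n y)"
    by metis
  have "d' n = int p * a (Suc n) + d n - a n" for n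
  proof -
    obtain u where u: "has_degree D u (d n)" "\<And>y. y \<in> ST \<Longrightarrow> g (Suc n) (e y) = csc (u y) (g n y)"
      using g(2)[of n] unfolding step_degree_def by blast
    let ?w = "\<lambda>y. (v (Suc n) (e y) * u y) * inverse (v n y)"
    have "has_degree D ?w (int p * a (Suc n) + d n + - a n)"
      using e fst_e
      by (intro has_degree_mult has_degree_inverse u v has_degree_compose[OF v(1)[of "Suc n"] e(1,3)])
        (auto simp: power_int_of_nat)
    moreover have "g' (Suc n) (e y) = csc (?w y) (g' n y)" if y: "y \<in> ST" for y
    proof -
      have "v n y \<noteq> 0" using has_degree_in_Circ[OF v(1) y, of n] by auto
      then show ?thesis by (simp add: v(2)[OF y] v(2)[OF e_ST[OF y]] u(2)[OF y] mult.assoc)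
    qed
    ultimately have "step_degree (g' n) (g' (Suc n)) (int p * a (Suc n) + d n + - a n)"
      unfolding step_degree_def by blast
    then have "d' n = int p * a (Suc n) + d n + - a n"
      using step_degree_unique[OF g'(2) _ hopf_liftD(2)[OF g'(1)]] by blast
    then show ?thesis by simp
  qed
  then show ?thesis by (intro seq_equivI[of _ _ _ "\<lambda>n. - a n"]) simp
qed

text \<open>A pair of lifts over a parameter interval: since the degree is discrete, it is the same at all
  parameters.\<close>

lemma step_degree_homotopy:
  assumes G: "continuous_on (Circ \<times> (D \<times> I01)) G" "G ` (Circ \<times> (D \<times> I01)) \<subseteq> S3c"
    and G': "continuous_on (Circ \<times> (D \<times> I01)) G'" "G' ` (Circ \<times> (D \<times> I01)) \<subseteq> S3c"
    and eq: "\<And>y t. y \<in> ST \<Longrightarrow> t \<in> I01 \<Longrightarrow>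
      hopf (G' (fst (e y), (snd (e y), t))) = hopf (G (fst y, (snd y, t)))"
  obtains d where "\<And>t. t \<in> I01 \<Longrightarrow>
    step_degree (\<lambda>y. G (fst y, (snd y, t))) (\<lambda>y. G' (fst y, (snd y, t))) d"
proof -
  let ?C = "D \<times> I01"
  let ?e = "\<lambda>y::complex \<times> complex \<times> real. (fst (e (fst y, fst (snd y))), (snd (e (fst y, fst (snd y))), snd (snd y)))"
  have ce: "continuous_on (Circ \<times> ?C) ?e"
    by (intro continuous_intros continuous_on_compose2[OF e(1)]) auto
  have e': "?e y \<in> Circ \<times> ?C" if "y \<in> Circ \<times> ?C" for y
  proof -
    have "e (fst y, fst (snd y)) \<in> ST" using that by (intro e_ST) auto
    then show ?thesis using that by (auto simp: mem_Times_iff)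
  qed
  obtain u d where u: "has_degree ?C u d" "\<And>y. y \<in> Circ \<times> ?C \<Longrightarrow> G' (?e y) = csc (u y) (G y)"
  proof (rule lift_pair_degree[of ?C "\<lambda>y. G' (?e y)" G])
    show "convex ?C" "compact ?C" by (intro convex_Times compact_Times; simp)+
    show "continuous_on (Circ \<times> ?C) (\<lambda>y. G' (?e y))"
      by (rule continuous_on_compose2[OF G'(1) ce]) (use e' in blast)
    show "(\<lambda>y. G' (?e y)) ` (Circ \<times> ?C) \<subseteq> S3c" using G'(2) e' by blast
    show "hopf (G' (?e y)) = hopf (G y)" if "y \<in> Circ \<times> ?C" for y
    proof -
      have "(fst y, fst (snd y)) \<in> ST" "snd (snd y) \<in> I01" using that by auto
      from eq[OF this] show ?thesis by simp
    qed
  qed (use G that in auto)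
  show ?thesis
  proof (rule that)
    fix t :: real assume t: "t \<in> I01"
    have "has_degree D (\<lambda>y. u (fst y, (snd y, t))) (1 * d)"
    proof (rule has_degree_compose[OF u(1), where e = "\<lambda>y. (fst y, (snd y, t))"])
      show "continuous_on ST (\<lambda>y. (fst y, (snd y, t)))" by (intro continuous_intros)
    qed (use t in auto)
    moreover have "G' (fst (e y), (snd (e y), t)) = csc (u (fst y, (snd y, t))) (G (fst y, (snd y, t)))" if "y \<in> ST" for y
    proof -
      have "(fst y, (snd y, t)) \<in> Circ \<times> ?C" using that t by auto
      from u(2)[OF this] show ?thesis by simp
    qed
    ultimately show "step_degree (\<lambda>y. G (fst y, (snd y, t))) (\<lambda>y. G' (fst y, (snd y, t))) d"
      unfolding step_degree_def by auto
  qed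
qed

text \<open>On each stage the whole homotopy is lifted as one map, with time counted in the convex
  factor, so one degree is valid at both ends.\<close>

lemma coherent_homotopic:
  assumes "(f, f') \<in> homotopy_rel X S2"
  obtains d where "coherent f d" "coherent f' d"
proof -
  have ff: "f \<in> cmaps X S2" "f' \<in> cmaps X S2" "homotopic_with_canon (\<lambda>_. True) X S2 f f'"
    using assms by (auto simp: homotopy_rel_def)
  then obtain H where H: "continuous_on (I01 \<times> X) H" "H ` (I01 \<times> X) \<subseteq> S2"
      "\<And>x. H (0, x) = f x" "\<And>x. H (1, x) = f' x"
    unfolding homotopic_with_def by (auto simp: image_subset_iff_funcset)
  let ?C = "D \<times> I01"
  let ?F = "\<lambda>n y. H (snd (snd y), j n (fst y, fst (snd y)))"
  have "\<exists>g. hopf_lift (Circ \<times> ?C) (?F n) g" for n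
  proof (rule hopf_lift_exists[of ?C "?F n"])
    show "convex ?C" "compact ?C" by (intro convex_Times compact_Times; simp)+
    have in_X: "(snd (snd y), j n (fst y, fst (snd y))) \<in> I01 \<times> X" if "y \<in> Circ \<times> ?C" for y
      using that j_X[of "(fst y, fst (snd y))" n] by auto
    show "continuous_on (Circ \<times> ?C) (?F n)"
    proof (rule continuous_on_compose2[OF H(1)])
      show "continuous_on (Circ \<times> ?C) (\<lambda>y. (snd (snd y), j n (fst y, fst (snd y))))"
        by (intro continuous_intros continuous_on_compose2[OF j(1)]) auto
    qed (use in_X in blast)
    show "?F n ` (Circ \<times> ?C) \<subseteq> S2"
      using H(2) in_X by blast
  qed blast
  then have "\<forall>n. \<exists>g. hopf_lift (Circ \<times> ?C) (?F n) g" by blast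
  from choice[OF this] obtain G where "\<forall>n. hopf_lift (Circ \<times> ?C) (?F n) (G n)" by blast
  then have G: "hopf_lift (Circ \<times> ?C) (?F n) (G n)" for n by blast
  have "\<exists>d. \<forall>t\<in>I01. step_degree (\<lambda>y. G n (fst y, (snd y, t))) (\<lambda>y. G (Suc n) (fst y, (snd y, t))) d" for n
  proof (rule step_degree_homotopy[of "G n" "G (Suc n)"])
    show "hopf (G (Suc n) (fst (e y), (snd (e y), t))) = hopf (G n (fst y, (snd y, t)))"
      if y: "y \<in> ST" and t: "t \<in> I01" for y t
    proof -
      have "(fst (e y), (snd (e y), t)) \<in> Circ \<times> ?C" "(fst y, (snd y, t)) \<in> Circ \<times> ?C"
        using e_ST[OF y] y t by (auto simp: mem_Times_iff)
      then have "hopf (G (Suc n) (fst (e y), (snd (e y), t))) = H (t, j (Suc n) (e y))"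
        "hopf (G n (fst y, (snd y, t))) = H (t, j n y)"
        using hopf_liftD(4)[OF G, of _ n] hopf_liftD(4)[OF G, of _ "Suc n"] by simp_all
      then show ?thesis using j_e[OF y] by simp
    qed
  qed (use hopf_liftD(1,2)[OF G] in blast)+
  then have "\<forall>n. \<exists>d. \<forall>t\<in>I01. step_degree (\<lambda>y. G n (fst y, (snd y, t))) (\<lambda>y. G (Suc n) (fst y, (snd y, t))) d"
    by blast
  from choice[OF this] obtain d where d: "\<forall>n. \<forall>t\<in>I01.
      step_degree (\<lambda>y. G n (fst y, (snd y, t))) (\<lambda>y. G (Suc n) (fst y, (snd y, t))) (d n)"
    by blast
  have lift: "hopf_lift ST (\<lambda>y. H (t, j n y)) (\<lambda>y. G n (fst y, (snd y, t)))" if t: "t \<in> I01" for t n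
    unfolding hopf_lift_def
  proof (intro conjI ballI)
    show "continuous_on ST (\<lambda>y. G n (fst y, (snd y, t)))"
      by (rule continuous_on_compose2[of "Circ \<times> ?C" "G n"])
        (use hopf_liftD(1)[OF G] t in \<open>auto intro!: continuous_intros\<close>)
    have in_C: "(fst y, (snd y, t)) \<in> Circ \<times> ?C" if "y \<in> ST" for y using t that by auto
    show "(\<lambda>y. G n (fst y, (snd y, t))) ` ST \<subseteq> S3c"
      using hopf_liftD(3)[OF G in_C] by blast
    show "hopf (G n (fst y, (snd y, t))) = H (t, j n y)" if "y \<in> ST" for y
      using hopf_liftD(4)[OF G in_C[OF that]] by simp
  qed
  have "coherent f d"
    unfolding coherent_def using ff(1) lift[of 0, unfolded H(3)] d
    by (intro conjI exI[of _ "\<lambda>n y. G n (fst y, (snd y, 0))"] allI) auto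
  moreover have "coherent f' d"
    unfolding coherent_def using ff(2) lift[of 1, unfolded H(4)] d
    by (intro conjI exI[of _ "\<lambda>n y. G n (fst y, (snd y, 1))"] allI) auto
  ultimately show ?thesis by (rule that)
qed

end

section \<open>Realising all sequences, and homotopies between maps of equal degrees\<close>

context telescope begin

text \<open>The choice depends on \<open>g\<close> and \<open>k\<close> alone. Consequently
  \<open>tower d n\<close> depends only on the first \<open>n\<close> terms of \<open>d\<close>,
  which is what makes \<open>realize\<close> continuous.\<close>

definition ext_step :: "(complex \<times> complex \<Rightarrow> complex \<times> complex) \<Rightarrow> int \<Rightarrow> complex \<times> complex \<Rightarrow> complex \<times> complex" where
  "ext_step g k = (SOME g'. continuous_on ST g' \<and> g' ` ST \<subseteq> S3c \<and>
     (\<forall>y\<in>ST. g' (e y) = csc (fst y powi k) (g y)))"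

lemma ext_step:
  assumes g: "continuous_on ST g" "g ` ST \<subseteq> S3c"
  shows "continuous_on ST (ext_step g k)" "ext_step g k ` ST \<subseteq> S3c"
    "\<And>y. y \<in> ST \<Longrightarrow> ext_step g k (e y) = csc (fst y powi k) (g y)"
proof -
  let ?f = "\<lambda>x. csc (fst (e_inv x) powi k) (g (e_inv x))"
  have sub: "e_inv ` (e ` ST) \<subseteq> ST" using e_inv_ST by blast
  have "fst (e_inv x) \<noteq> 0" if "x \<in> e ` ST" for x using e_inv_ST[OF that] by auto
  then have cf: "continuous_on (e ` ST) ?f"
    by (intro continuous_intros continuous_on_e_inv continuous_on_compose2[OF g(1) continuous_on_e_inv sub]) auto
  have im: "?f ` (e ` ST) \<subseteq> S3c"
  proof (rule image_subsetI)
    fix x assume "x \<in> e ` ST"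
    then have x: "e_inv x \<in> ST" by (rule e_inv_ST)
    then have "fst (e_inv x) powi k \<in> Circ" by (simp add: norm_power_int mem_Times_iff)
    moreover have "g (e_inv x) \<in> S3c" by (rule subsetD[OF g(2) imageI[OF x]])
    ultimately show "?f x \<in> S3c" by (rule csc_in_S3c)
  qed
  have sub': "e ` ST \<subseteq> Circ \<times> UNIV" using e(3) by (rule order_trans) auto
  obtain h where h: "continuous_on ST h" "h ` ST \<subseteq> S3c" "\<And>x. x \<in> e ` ST \<Longrightarrow> h x = ?f x"
    by (rule extend_to_S3c[OF compact_e_ST sub' compact_cball cf im]) (rule that)
  have "\<exists>g'. continuous_on ST g' \<and> g' ` ST \<subseteq> S3c \<and> (\<forall>y\<in>ST. g' (e y) = csc (fst y powi k) (g y))"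
    by (rule exI[of _ h]) (simp add: h e_inv_e del: split_paired_Ball_Sigma)
  from someI_ex[OF this]
  show "continuous_on ST (ext_step g k)" "ext_step g k ` ST \<subseteq> S3c"
    "\<And>y. y \<in> ST \<Longrightarrow> ext_step g k (e y) = csc (fst y powi k) (g y)"
    unfolding ext_step_def by blast+
qed

primrec tower :: "(nat \<Rightarrow> int) \<Rightarrow> nat \<Rightarrow> complex \<times> complex \<Rightarrow> complex \<times> complex" where
  "tower d 0 = (\<lambda>_. (1, 0))"
| "tower d (Suc n) = ext_step (tower d n) (d n)"

lemma tower: "continuous_on ST (tower d n) \<and> tower d n ` ST \<subseteq> S3c"
proof (induction n)
  case 0
  then show ?case using one_in_S3c by auto
next
  case (Suc n)
  then show ?case using ext_step(1,2)[of "tower d n" "d n"] by simp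
qed

lemma tower_e: "y \<in> ST \<Longrightarrow> tower d (Suc n) (e y) = csc (fst y powi (d n)) (tower d n y)"
  using ext_step(3)[of "tower d n" y "d n"] tower by simp

definition realize :: "(nat \<Rightarrow> int) \<Rightarrow> 'a \<Rightarrow> real^3" where
  "realize d = restrict (glue (\<lambda>n y. hopf (tower d n y))) X"

lemma tower_compat: "y \<in> ST \<Longrightarrow> hopf (tower d (Suc n) (e y)) = hopf (tower d n y)"
  using tower_e[of y d n] by (simp add: hopf_csc norm_power_int mem_Times_iff)

lemma realize_j: "y \<in> ST \<Longrightarrow> realize d (j n y) = hopf (tower d n y)"
  using glue_j[of "\<lambda>n y. hopf (tower d n y)" y n] tower_compat[of _ d] j_X by (simp add: realize_def)

lemma realize_Xs: "x \<in> Xs n \<Longrightarrow> realize d x = hopf (tower d n (j_inv n x))"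
  using realize_j[OF j_inv_ST(1)] j_inv_ST(2) by metis

lemma realize_cmaps: "realize d \<in> cmaps X S2"
proof -
  have "continuous_on X (glue (\<lambda>n y. hopf (tower d n y)))"
    by (rule continuous_on_glue) (use tower tower_compat in \<open>blast intro: continuous_intros\<close>)+
  then have "continuous_on X (realize d)"
    by (rule continuous_on_eq) (simp add: realize_def)
  moreover have "realize d x \<in> S2" if "x \<in> X" for x
  proof -
    obtain n where n: "x \<in> Xs n" using X_eq \<open>x \<in> X\<close> by blast
    have "tower d n (j_inv n x) \<in> S3c"
      by (rule subsetD[OF conjunct2[OF tower] imageI[OF j_inv_ST(1)[OF n]]])
    then show ?thesis unfolding realize_Xs[OF n] by (rule hopf_in_S2)
  qed
  ultimately show ?thesis unfolding cmaps_def realize_def by auto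
qed

lemma coherent_realize: "coherent (realize d) d"
  unfolding coherent_def
proof (intro conjI realize_cmaps exI allI)
  fix n
  show "hopf_lift ST (\<lambda>y. realize d (j n y)) (tower d n)"
    unfolding hopf_lift_def using tower[of d n] realize_j[of _ d n] by simp
  show "step_degree (tower d n) (tower d (Suc n)) (d n)"
    unfolding step_degree_def using has_degree_powi[of D "d n"] tower_e by blast
qed

lemma realize_initial:
  assumes "\<forall>i<n. d' i = d i" "x \<in> Xs n" shows "realize d' x = realize d x"
proof -
  have "m \<le> n \<Longrightarrow> tower d' m = tower d m" for m
    by (induction m) (use assms(1) in auto)
  then show ?thesis using assms(2) by (simp add: realize_Xs)
qed

lemma realize_continuous:
  assumes "openin (map_space X S2) U" "realize d \<in> U"
  shows "\<exists>n. \<forall>d'. (\<forall>i<n. d' i = d i) \<longrightarrow> realize d' \<in> U"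
proof -
  obtain n \<epsilon> where n: "\<epsilon> > 0" "nearby (realize d) n \<epsilon> \<subseteq> U"
    using assms unfolding openin_map_space_iff by blast
  have "realize d' \<in> nearby (realize d) n \<epsilon>" if "\<forall>i<n. d' i = d i" for d'
    using realize_initial[OF that] n(1) realize_cmaps by (simp add: nearby_def)
  then show ?thesis using n(2) by blast
qed

text \<open>On the image of \<open>e\<close> the values are forced; beyond it a real function
  extends by a theorem of Tietze type. Circle-valued functions would not do, hence the passage to
  phases.\<close>

lemma extend_real:
  assumes "continuous_on ST (\<beta> :: complex \<times> complex \<Rightarrow> real)"
  obtains \<alpha> where "continuous_on ST \<alpha>" "\<And>y. y \<in> ST \<Longrightarrow> \<alpha> (e y) = \<beta> y"
proof -
  have "continuous_on (e ` ST) (\<lambda>x. \<beta> (e_inv x))"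
    by (rule continuous_on_compose2[OF assms continuous_on_e_inv]) (use e_inv_ST in blast)
  moreover have "closedin (top_of_set ST) (e ` ST)"
    using compact_e_ST e(3) by (intro closed_subset compact_imp_closed)
  ultimately obtain \<alpha> where "continuous_on ST \<alpha>" "\<And>x. x \<in> e ` ST \<Longrightarrow> \<alpha> x = \<beta> (e_inv x)"
    using Dugundji[of "UNIV :: real set" ST "e ` ST" "\<lambda>x. \<beta> (e_inv x)"] by (metis UNIV_I convex_UNIV empty_not_UNIV subset_UNIV)
  then show ?thesis using that e_inv_e by auto
qed

lemma homotopic_coherent:
  assumes "coherent f d" "coherent f' d"
  shows "(f', f) \<in> homotopy_rel X S2"
proof -
  obtain g where f: "f \<in> cmaps X S2" and g: "\<And>n. hopf_lift ST (\<lambda>y. f (j n y)) (g n)"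
      "\<And>n. step_degree (g n) (g (Suc n)) (d n)"
    using assms(1) unfolding coherent_def by blast
  obtain g' where f': "f' \<in> cmaps X S2" and g': "\<And>n. hopf_lift ST (\<lambda>y. f' (j n y)) (g' n)"
      "\<And>n. step_degree (g' n) (g' (Suc n)) (d n)"
    using assms(2) unfolding coherent_def by blast
  have "\<forall>n. \<exists>u. has_degree D u (d n) \<and> (\<forall>y\<in>ST. g (Suc n) (e y) = csc (u y) (g n y))"
    using g(2) unfolding step_degree_def by blast
  from choice[OF this] obtain u where u: "\<And>n. has_degree D (u n) (d n)"
      "\<And>n y. y \<in> ST \<Longrightarrow> g (Suc n) (e y) = csc (u n y) (g n y)" by blast
  have "\<forall>n. \<exists>u. has_degree D u (d n) \<and> (\<forall>y\<in>ST. g' (Suc n) (e y) = csc (u y) (g' n y))"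
    using g'(2) unfolding step_degree_def by blast
  from choice[OF this] obtain u' where u': "\<And>n. has_degree D (u' n) (d n)"
      "\<And>n y. y \<in> ST \<Longrightarrow> g' (Suc n) (e y) = csc (u' n y) (g' n y)" by blast
  have "\<forall>n. \<exists>\<theta>::complex \<times> complex \<Rightarrow> real. continuous_on ST \<theta> \<and> (\<forall>y\<in>ST. u' n y = u n y * cis (\<theta> y))"
  proof
    fix n
    obtain \<theta> where \<theta>: "continuous_on ST \<theta>" "\<And>y. y \<in> ST \<Longrightarrow> u n y = fst y powi (d n) * cis (\<theta> y)"
      using u(1)[of n] unfolding has_degree_def by blast
    obtain \<theta>' where \<theta>': "continuous_on ST \<theta>'" "\<And>y. y \<in> ST \<Longrightarrow> u' n y = fst y powi (d n) * cis (\<theta>' y)"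
      using u'(1)[of n] unfolding has_degree_def by blast
    have "u' n y = u n y * cis (\<theta>' y - \<theta> y)" if "y \<in> ST" for y
      unfolding \<theta>(2)[OF that] \<theta>'(2)[OF that] mult.assoc cis_mult by simp
    then show "\<exists>\<theta>. continuous_on ST \<theta> \<and> (\<forall>y\<in>ST. u' n y = u n y * cis (\<theta> y))"
      using continuous_on_diff[OF \<theta>'(1) \<theta>(1)] by blast
  qed
  from choice[OF this] obtain \<theta> :: "nat \<Rightarrow> complex \<times> complex \<Rightarrow> real" where \<theta>: "\<And>n. continuous_on ST (\<theta> n)"
      "\<And>n y. y \<in> ST \<Longrightarrow> u' n y = u n y * cis (\<theta> n y)" by blast
  \<comment> \<open>The phases by which the lifts of \<open>f'\<close> are corrected. The
    discrepancy \<open>\<theta> n\<close> is passed on to the next torus, so that the corrected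
    lifts change from torus to torus by the same factor \<open>u n\<close> as those of
    \<open>f\<close>.\<close>
  obtain \<alpha> :: "nat \<Rightarrow> complex \<times> complex \<Rightarrow> real" where \<alpha>: "\<And>n. continuous_on ST (\<alpha> n)"
      "\<And>n y. y \<in> ST \<Longrightarrow> \<alpha> (Suc n) (e y) = \<alpha> n y - \<theta> n y"
  proof -
    have 0: "\<exists>x::complex \<times> complex \<Rightarrow> real. continuous_on ST x" by (rule exI[of _ "\<lambda>_. 0"]) simp
    have "\<exists>y. continuous_on ST y \<and> (\<forall>z\<in>ST. y (e z) = x z - \<theta> n z)" if "continuous_on ST x" for x :: "complex \<times> complex \<Rightarrow> real" and n
      using extend_real[OF continuous_on_diff[OF that \<theta>(1)], of n] by metis
    from dependent_nat_choice[of "\<lambda>_ x. continuous_on ST x" "\<lambda>n x y. \<forall>z\<in>ST. y (e z) = x z - \<theta> n z", OF 0 this]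
    obtain \<alpha> where "\<forall>n. continuous_on ST (\<alpha> n) \<and> (\<forall>z\<in>ST. \<alpha> (Suc n) (e z) = \<alpha> n z - \<theta> n z)" by blast
    then show thesis using that by blast
  qed
  define k where "k = (\<lambda>n y. csc (cis (\<alpha> n y)) (g' n y))"
  have k: "hopf_lift ST (\<lambda>y. f' (j n y)) (k n)" for n
    unfolding hopf_lift_def k_def
  proof (intro conjI ballI)
    show "continuous_on ST (\<lambda>y. csc (cis (\<alpha> n y)) (g' n y))"
      by (intro continuous_intros \<alpha> hopf_liftD(1)[OF g'(1)])
    show "(\<lambda>y. csc (cis (\<alpha> n y)) (g' n y)) ` ST \<subseteq> S3c"
      using hopf_liftD(3)[OF g'(1)] by (intro image_subsetI csc_in_S3c) auto
    show "hopf (csc (cis (\<alpha> n y)) (g' n y)) = f' (j n y)" if "y \<in> ST" for y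
      using hopf_liftD(4)[OF g'(1) that] by (simp add: hopf_csc)
  qed
  have k_e: "k (Suc n) (e y) = csc (u n y) (k n y)" if y: "y \<in> ST" for n y
  proof -
    have "cis (\<alpha> n y - \<theta> n y) * (u n y * cis (\<theta> n y)) = u n y * (cis (\<alpha> n y - \<theta> n y) * cis (\<theta> n y))"
      by (simp only: ac_simps)
    also have "\<dots> = u n y * cis (\<alpha> n y)" unfolding cis_mult by simp
    finally show ?thesis
      unfolding k_def \<alpha>(2)[OF y] u'(2)[OF y] \<theta>(2)[OF y] csc_csc by (rule arg_cong)
  qed
  define q where "q = (\<lambda>n y. qmul (qinv (g n y)) (k n y))"
  have q: "continuous_on ST (q n)" "q n ` ST \<subseteq> S3c" for n
  proof -
    show "continuous_on ST (q n)"
      unfolding q_def by (intro continuous_intros hopf_liftD(1)[OF g(1)] hopf_liftD(1)[OF k])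
    show "q n ` ST \<subseteq> S3c"
      unfolding q_def using hopf_liftD(3)[OF g(1)] hopf_liftD(3)[OF k]
      by (intro image_subsetI qmul_in_S3c qinv_in_S3c)
  qed
  have q_e: "q (Suc n) (e y) = q n y" if y: "y \<in> ST" for n y
    unfolding q_def u(2)[OF y] k_e[OF y]
    by (rule qmul_qinv_csc[OF has_degree_in_Circ[OF u(1) y] hopf_liftD(3)[OF g(1) y]])
  define P where "P = (\<lambda>n Q. continuous_on (I01 \<times> ST) Q \<and> Q ` (I01 \<times> ST) \<subseteq> S3c \<and>
      (\<forall>y\<in>ST. Q (0, y) = q n y \<and> Q (1, y) = (1, 0)))"
  have "\<exists>Q. P 0 Q"
  proof -
    have "homotopic_with_canon (\<lambda>_. True) ST S3c (q 0) (\<lambda>_. (1, 0))"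
      by (rule nullhomotopic_to_S3c[OF compact_cball q])
    then obtain Q where "continuous_on (I01 \<times> ST) Q" "Q ` (I01 \<times> ST) \<subseteq> S3c"
        "\<And>y. Q (0, y) = q 0 y" "\<And>y. Q (1, y) = (1, 0)"
      unfolding homotopic_with_def by (auto simp: image_subset_iff_funcset)
    then show ?thesis unfolding P_def by (intro exI[of _ Q]) blast
  qed
  \<comment> \<open>Null-homotopies chosen independently on the tori would not fit together; each
    has to prolong its predecessor.\<close>
  moreover have "\<exists>Q'. P (Suc n) Q' \<and> (\<forall>t\<in>I01. \<forall>y\<in>ST. Q' (t, e y) = Q (t, y))" if Q: "P n Q" for n Q
  proof -
    have "Q (0, y) = q (Suc n) (e y) \<and> Q (1, y) = (1, 0)" if "y \<in> ST" for y
      using Q that q_e unfolding P_def by metis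
    with Q show ?thesis
      using homotopy_step[OF convex_cball compact_cball D_nonempty e q[of "Suc n"], of Q]
      unfolding P_def by metis
  qed
  ultimately obtain Q where Q: "\<And>n. P n (Q n)"
      "\<And>n t y. t \<in> I01 \<Longrightarrow> y \<in> ST \<Longrightarrow> Q (Suc n) (t, e y) = Q n (t, y)"
    using dependent_nat_choice[of P "\<lambda>n Q Q'. \<forall>t\<in>I01. \<forall>y\<in>ST. Q' (t, e y) = Q (t, y)"] by metis
  \<comment> \<open>At time 0 the product is the corrected lift of \<open>f'\<close>, at time 1 it
    is the lift of \<open>f\<close>. At each time the products on consecutive tori differ by the
    phase \<open>u n\<close>, which \<open>hopf\<close> removes.\<close>
  define \<phi> where "\<phi> = (\<lambda>t n y. hopf (qmul (g n y) (Q n (t, y))))"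
  have \<phi>_e: "\<phi> t (Suc n) (e y) = \<phi> t n y" if "t \<in> I01" "y \<in> ST" for t n y
    unfolding \<phi>_def u(2)[OF that(2)] Q(2)[OF that] qmul_csc
    by (rule hopf_csc[OF has_degree_in_Circ[OF u(1) that(2)]])
  define H where "H = (\<lambda>x. glue (\<phi> (fst x)) (snd x))"
  have H_Xs: "H (t, x) = \<phi> t n (j_inv n x)" if "t \<in> I01" "x \<in> Xs n" for t x n
    unfolding H_def using glue_Xs[of "\<phi> t", OF \<phi>_e that(2)] that(1) by simp
  note QP = Q(1)[unfolded P_def]
  note Qc = conjunct1[OF QP] and Q01 = bspec[OF conjunct2[OF conjunct2[OF QP]]]
  have QS: "Q n x \<in> S3c" if "x \<in> I01 \<times> ST" for n x
    by (rule subsetD[OF conjunct1[OF conjunct2[OF QP]] imageI[OF that]])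
  have H_S2: "H x \<in> S2" if x: "x \<in> I01 \<times> X" for x
  proof -
    obtain n where n: "snd x \<in> Xs n" using x X_eq by (metis UN_E mem_Times_iff)
    have "(fst x, j_inv n (snd x)) \<in> I01 \<times> ST" using x j_inv_ST(1)[OF n] by (simp add: mem_Times_iff)
    then have "\<phi> (fst x) n (j_inv n (snd x)) \<in> S2"
      unfolding \<phi>_def using hopf_liftD(3)[OF g(1) j_inv_ST(1)[OF n]] QS
      by (intro hopf_in_S2 qmul_in_S3c)
    then show ?thesis using H_Xs[OF _ n, of "fst x"] x by (simp add: mem_Times_iff)
  qed
  have cH: "continuous_on (I01 \<times> X) H"
  proof (rule continuous_on_Times_X)
    fix n
    have "continuous_on (I01 \<times> Xs n) (\<lambda>x. hopf (qmul (g n (j_inv n (snd x))) (Q n (fst x, j_inv n (snd x)))))"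
    proof (intro continuous_intros)
      have cj: "continuous_on (I01 \<times> Xs n) (\<lambda>x. j_inv n (snd x))"
        by (rule continuous_on_compose2[OF continuous_on_j_inv]) (auto intro: continuous_intros)
      have ST: "j_inv n (snd x) \<in> ST" if "x \<in> I01 \<times> Xs n" for x
        using j_inv_ST(1) that by (simp add: mem_Times_iff)
      show "continuous_on (I01 \<times> Xs n) (\<lambda>x. g n (j_inv n (snd x)))"
        by (rule continuous_on_compose2[OF hopf_liftD(1)[OF g(1)] cj]) (use ST in blast)
      have "(fst x, j_inv n (snd x)) \<in> I01 \<times> ST" if "x \<in> I01 \<times> Xs n" for x
        using ST[OF that] that by (simp add: mem_Times_iff)
      then show "continuous_on (I01 \<times> Xs n) (\<lambda>x. Q n (fst x, j_inv n (snd x)))"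
        by (intro continuous_on_compose2[OF Qc] continuous_intros cj) blast
    qed
    then show "continuous_on (I01 \<times> Xs n) H"
      by (rule continuous_on_eq) (use H_Xs in \<open>auto simp: \<phi>_def\<close>)
  qed
  have "H (0, x) = f' x \<and> H (1, x) = f x" if "x \<in> X" for x
  proof -
    obtain n where n: "x \<in> Xs n" using X_eq \<open>x \<in> X\<close> by blast
    define y where "y = j_inv n x"
    have y: "y \<in> ST" "j n y = x" using j_inv_ST[OF n] by (simp_all add: y_def)
    have "Q n (0, y) = q n y" "Q n (1, y) = (1, 0)" using Q01[OF y(1), of n] by simp_all
    then have "H (0, x) = hopf (k n y)" "H (1, x) = hopf (g n y)"
      using H_Xs[OF _ n] qmul_qinv_right[OF hopf_liftD(3)[OF g(1) y(1)]]
      by (simp_all add: \<phi>_def y_def[symmetric] q_def)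
    then show ?thesis
      using hopf_liftD(4)[OF k y(1)] hopf_liftD(4)[OF g(1) y(1)] y(2) by simp
  qed
  then have "homotopic_with_canon (\<lambda>_. True) X S2 f' f"
    using cH H_S2 by (subst homotopic_with) (auto simp: image_subset_iff_funcset Pi_iff intro!: exI[of _ H])
  then show ?thesis using f f' by (simp add: homotopy_rel_def)
qed

end

section \<open>A measurable choice of degree sequences\<close>

context telescope begin

text \<open>Nearness is expressed by a positive inner product, since this condition survives linear
  interpolation and excludes antipodes. For unit vectors a distance below 1 means an inner product
  above 1/2.\<close>

lemma dense_sequence:
  obtains q :: "nat \<Rightarrow> 'a \<Rightarrow> real^3" where "\<And>i. q i \<in> cmaps X S2"
    "\<And>f n. f \<in> cmaps X S2 \<Longrightarrow> \<exists>i. \<forall>x\<in>Xs n. 0 < q i x \<bullet> f x"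
proof -
  obtain B where B: "countable B" "\<And>W. W \<in> B \<Longrightarrow> openin (map_space X S2) W"
      "\<And>U f. openin (map_space X S2) U \<Longrightarrow> f \<in> U \<Longrightarrow> \<exists>W\<in>B. f \<in> W \<and> W \<subseteq> U"
    using second_countable_map_space unfolding second_countable_def by metis
  define A where "A = insert (realize (\<lambda>_. 0)) ((\<lambda>W. SOME f. f \<in> W) ` {W \<in> B. W \<noteq> {}})"
  have A: "countable A" "A \<noteq> {}" unfolding A_def using B(1) by (auto intro: countable_subset)
  have sub: "A \<subseteq> cmaps X S2"
  proof -
    have "(SOME f. f \<in> W) \<in> cmaps X S2" if "W \<in> B" "W \<noteq> {}" for W
      using openin_subset[OF B(2)[OF that(1)]] some_in_eq[of W] that(2) by auto
    then show ?thesis using realize_cmaps by (auto simp: A_def)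
  qed
  show ?thesis
  proof (rule that[of "from_nat_into A"])
    show "from_nat_into A i \<in> cmaps X S2" for i using from_nat_into[OF A(2)] sub by blast
    fix f n assume f: "f \<in> cmaps X S2"
    obtain F where F: "finite F" "F \<subseteq> subbase" "f \<in> \<Inter>F" "cmaps X S2 \<inter> \<Inter>F \<subseteq> nearby f n 1"
      by (rule nearby_contains_basic[OF f zero_less_one])
    have "openin (map_space X S2) (\<Inter>(insert (cmaps X S2) F))"
      using F openin_subbase openin_topspace[of "map_space X S2"] by (intro openin_Inter) auto
    then obtain W where W: "W \<in> B" "f \<in> W" "W \<subseteq> \<Inter>(insert (cmaps X S2) F)"
      using B(3)[of "\<Inter>(insert (cmaps X S2) F)" f] F(3) f by blast
    define k where "k = (SOME f. f \<in> W)"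
    have "k \<in> W" unfolding k_def using someI[of "\<lambda>f. f \<in> W", OF W(2)] .
    then have k: "k \<in> nearby f n 1" using W(3) F(4) by auto
    have "k \<in> A" using W unfolding A_def k_def by blast
    then obtain i where i: "from_nat_into A i = k" using from_nat_into_surj[OF A(1)] by blast
    have "0 < k x \<bullet> f x" if x: "x \<in> Xs n" for x
    proof -
      have "norm (f x - k x) < 1" using k x by (simp add: nearby_def dist_norm)
      then have "(norm (f x - k x))\<^sup>2 < 1" by (simp add: power_less_one_iff)
      moreover have "norm (f x) = 1" "norm (k x) = 1"
        using f k Xs_sub x by (auto simp: cmaps_def nearby_def PiE_iff)
      ultimately show ?thesis
        unfolding power2_norm_eq_inner inner_diff_left inner_diff_right
        by (simp add: norm_eq_1 inner_commute)
    qed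
    then show "\<exists>i. \<forall>x\<in>Xs n. 0 < from_nat_into A i x \<bullet> f x" using i by (intro exI[of _ i]) simp
  qed
qed

definition centre :: "nat \<Rightarrow> 'a \<Rightarrow> real^3" where
  "centre = (SOME q. (\<forall>i. q i \<in> cmaps X S2) \<and> (\<forall>f\<in>cmaps X S2. \<forall>n. \<exists>i. \<forall>x\<in>Xs n. 0 < q i x \<bullet> f x))"

lemma centre: "centre i \<in> cmaps X S2" "f \<in> cmaps X S2 \<Longrightarrow> \<exists>i. \<forall>x\<in>Xs n. 0 < centre i x \<bullet> f x"
proof -
  obtain q :: "nat \<Rightarrow> 'a \<Rightarrow> real^3" where q: "\<And>i. q i \<in> cmaps X S2"
    "\<And>f n. f \<in> cmaps X S2 \<Longrightarrow> \<exists>i. \<forall>x\<in>Xs n. 0 < q i x \<bullet> f x"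
    by (rule dense_sequence) (rule that)
  have "\<exists>q::nat \<Rightarrow> 'a \<Rightarrow> real^3. (\<forall>i. q i \<in> cmaps X S2) \<and> (\<forall>f\<in>cmaps X S2. \<forall>n. \<exists>i. \<forall>x\<in>Xs n. 0 < q i x \<bullet> f x)"
    by (intro exI[of _ q] conjI allI ballI q)
  from someI_ex[OF this] show "centre i \<in> cmaps X S2"
    "f \<in> cmaps X S2 \<Longrightarrow> \<exists>i. \<forall>x\<in>Xs n. 0 < centre i x \<bullet> f x"
    unfolding centre_def by blast+
qed

definition near_index :: "nat \<Rightarrow> ('a \<Rightarrow> real^3) \<Rightarrow> nat" where
  "near_index n f = (LEAST i. \<forall>x\<in>Xs n. 0 < centre i x \<bullet> f x)"

lemma near_index: "f \<in> cmaps X S2 \<Longrightarrow> x \<in> Xs n \<Longrightarrow> 0 < centre (near_index n f) x \<bullet> f x"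
  using LeastI_ex[OF centre(2)[of f n]] unfolding near_index_def by blast

lemma cmapsD:
  assumes "f \<in> cmaps X S2"
  shows "x \<in> X \<Longrightarrow> f x \<in> S2" "x \<in> X \<Longrightarrow> norm (f x) = 1" "continuous_on X f" "continuous_on (Xs n) f"
proof -
  show *: "x \<in> X \<Longrightarrow> f x \<in> S2" for x using assms by (auto simp: cmaps_def)
  show "x \<in> X \<Longrightarrow> norm (f x) = 1" using * by simp
  show "continuous_on X f" using assms by (simp add: cmaps_def)
  then show "continuous_on (Xs n) f" using Xs_sub by (rule continuous_on_subset)
qed

definition centre_lift :: "nat \<Rightarrow> nat \<Rightarrow> complex \<times> complex \<Rightarrow> complex \<times> complex" where
  "centre_lift n i = (SOME g. hopf_lift ST (\<lambda>y. centre i (j n y)) g)"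

lemma continuous_on_comp_j:
  assumes "f \<in> cmaps X S2" shows "continuous_on ST (\<lambda>y. f (j n y))"
  by (rule continuous_on_compose2[OF cmapsD(3)[OF assms] j(1)]) (use j_X in blast)

lemma comp_j_S2:
  assumes "f \<in> cmaps X S2" shows "(\<lambda>y. f (j n y)) ` ST \<subseteq> S2"
  by (intro image_subsetI cmapsD(1)[OF assms j_X])

lemma centre_lift: "hopf_lift ST (\<lambda>y. centre i (j n y)) (centre_lift n i)"
proof -
  have "\<exists>g. hopf_lift ST (\<lambda>y. centre i (j n y)) g"
    by (rule hopf_lift_exists[OF convex_cball compact_cball continuous_on_comp_j[OF centre(1)] comp_j_S2[OF centre(1)]])
      (rule exI)
  then show ?thesis unfolding centre_lift_def by (rule someI_ex)
qed

text \<open>Apart from the values of \<open>f\<close>, only the integer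
  \<open>near_index n f\<close> enters; the countably many lifts of the centres are fixed once and
  for all.\<close>

definition near_lift :: "nat \<Rightarrow> ('a \<Rightarrow> real^3) \<Rightarrow> complex \<times> complex \<Rightarrow> complex \<times> complex" where
  "near_lift n f y = transport (f (j n y)) (centre_lift n (near_index n f) y)"

lemma inner_pos_not_neg: "0 < a \<bullet> b \<Longrightarrow> b \<noteq> - a" for a b :: "real^3"
  using inner_ge_zero[of a] by (auto simp del: inner_ge_zero)

lemma near_lift:
  assumes f: "f \<in> cmaps X S2" shows "hopf_lift ST (\<lambda>y. f (j n y)) (near_lift n f)"
  unfolding near_lift_def
proof (rule hopf_lift_near[OF centre_lift continuous_on_comp_j[OF f] comp_j_S2[OF f]])
  show "f (j n y) \<noteq> - centre (near_index n f) (j n y)" if "y \<in> ST" for y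
    by (rule inner_pos_not_neg[OF near_index[OF f j_Xs[OF that]]])
qed

text \<open>The choice is harmless: by \<open>step_degree_unique\<close> only one degree is possible
  for the given lifts.\<close>

definition degree_seq :: "('a \<Rightarrow> real^3) \<Rightarrow> nat \<Rightarrow> int" where
  "degree_seq f n = (SOME d. step_degree (near_lift n f) (near_lift (Suc n) f) d)"

lemma step_degree_degree_seq:
  assumes "f \<in> cmaps X S2" shows "step_degree (near_lift n f) (near_lift (Suc n) f) (degree_seq f n)"
proof -
  have "\<exists>d. step_degree (near_lift n f) (near_lift (Suc n) f) d"
    by (rule step_degree_exists[OF assms near_lift[OF assms] near_lift[OF assms]]) (rule exI)
  then show ?thesis unfolding degree_seq_def by (rule someI_ex)
qed

lemma coherent_degree_seq: "f \<in> cmaps X S2 \<Longrightarrow> coherent f (degree_seq f)"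
  unfolding coherent_def using near_lift step_degree_degree_seq by (intro conjI exI[of _ "\<lambda>n. near_lift n f"]) auto

lemma degree_seq_eqI:
  assumes "f \<in> cmaps X S2" "step_degree (near_lift n f) (near_lift (Suc n) f) d"
  shows "degree_seq f n = d"
  using step_degree_unique[OF step_degree_degree_seq[OF assms(1)] assms(2) hopf_liftD(2)[OF near_lift[OF assms(1)]]] .

text \<open>The set of maps with prescribed indices is convex up to normalisation, hence the degree is
  constant on it.\<close>

lemma degree_seq_determined:
  assumes f: "f \<in> cmaps X S2" "f' \<in> cmaps X S2"
    and idx: "near_index n f = near_index n f'" "near_index (Suc n) f = near_index (Suc n) f'"
  shows "degree_seq f n = degree_seq f' n"
proof -
  define L where "L = (\<lambda>t x. (1 - t) *\<^sub>R f x + t *\<^sub>R f' x)"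
  define F where "F = (\<lambda>t x. L t x /\<^sub>R norm (L t x))"
  \<comment> \<open>Both maps lie in the open half-space given by the common centre, and so does the
    segment between them. It therefore avoids 0, and its normalisation avoids the antipode of the
    centre.\<close>
  have pos: "0 < centre (near_index m f) x \<bullet> L t x" if "t \<in> I01" "m \<in> {n, Suc n}" "x \<in> Xs m" for t m x
  proof -
    have a: "0 < centre (near_index m f) x \<bullet> f x" "0 < centre (near_index m f) x \<bullet> f' x"
      using near_index[OF f(1) that(3)] near_index[OF f(2) that(3)] idx that(2) by auto
    show ?thesis
    proof (cases "t = 0")
      case False
      then have "0 < t * (centre (near_index m f) x \<bullet> f' x)" using a that(1) by simp
      moreover have "0 \<le> (1 - t) * (centre (near_index m f) x \<bullet> f x)" using a that(1) by simp
      ultimately show ?thesis unfolding L_def by (simp add: inner_add_right)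
    qed (use a in \<open>simp add: L_def\<close>)
  qed
  have Lnz: "L t x \<noteq> 0" if "t \<in> I01" "m \<in> {n, Suc n}" "x \<in> Xs m" for t m x
    using pos[OF that] by auto
  \<comment> \<open>All maps of the family are lifted from the same lift of the centre, so at the
    two ends the lifts are exactly the near lifts of \<open>f\<close> and \<open>f'\<close>.\<close>
  define G where "G = (\<lambda>m y. transport (F (snd (snd y)) (j m (fst y, fst (snd y)))) (centre_lift m (near_index m f) (fst y, fst (snd y))))"
  let ?C = "D \<times> I01"
  have G: "hopf_lift (Circ \<times> ?C) (\<lambda>y. F (snd (snd y)) (j m (fst y, fst (snd y)))) (G m)" if m: "m \<in> {n, Suc n}" for m
    unfolding G_def
  proof (rule hopf_lift_near)
    have proj: "(fst y, fst (snd y)) \<in> ST" "snd (snd y) \<in> I01" if "y \<in> Circ \<times> ?C" for y :: "complex \<times> complex \<times> real"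
      using that by auto
    have cj: "continuous_on (Circ \<times> ?C) (\<lambda>y. (fst y, fst (snd y)))" by (intro continuous_intros)
    show "hopf_lift (Circ \<times> ?C) (\<lambda>y. centre (near_index m f) (j m (fst y, fst (snd y))))
        (\<lambda>y. centre_lift m (near_index m f) (fst y, fst (snd y)))"
      unfolding hopf_lift_def
    proof (intro conjI ballI)
      show "continuous_on (Circ \<times> ?C) (\<lambda>y. centre_lift m (near_index m f) (fst y, fst (snd y)))"
        by (rule continuous_on_compose2[OF hopf_liftD(1)[OF centre_lift] cj]) (use proj in blast)
      show "(\<lambda>y. centre_lift m (near_index m f) (fst y, fst (snd y))) ` (Circ \<times> ?C) \<subseteq> S3c"
        by (intro image_subsetI hopf_liftD(3)[OF centre_lift] proj)
      show "hopf (centre_lift m (near_index m f) (fst y, fst (snd y))) = centre (near_index m f) (j m (fst y, fst (snd y)))"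
        if "y \<in> Circ \<times> ?C" for y
        by (rule hopf_liftD(4)[OF centre_lift proj(1)[OF that]])
    qed
    have cL: "continuous_on (Circ \<times> ?C) (\<lambda>y. L (snd (snd y)) (j m (fst y, fst (snd y))))"
      unfolding L_def
      by (intro continuous_intros continuous_on_compose2[OF continuous_on_comp_j[OF f(1), of m] cj]
          continuous_on_compose2[OF continuous_on_comp_j[OF f(2), of m] cj]) (use proj in blast)+
    have nz: "L (snd (snd y)) (j m (fst y, fst (snd y))) \<noteq> 0" if "y \<in> Circ \<times> ?C" for y
      using Lnz[OF proj(2)[OF that] m j_Xs[OF proj(1)[OF that]]] .
    show "continuous_on (Circ \<times> ?C) (\<lambda>y. F (snd (snd y)) (j m (fst y, fst (snd y))))"
      unfolding F_def by (intro continuous_intros cL) (use nz in auto)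
    show "(\<lambda>y. F (snd (snd y)) (j m (fst y, fst (snd y)))) ` (Circ \<times> ?C) \<subseteq> S2"
    proof (rule image_subsetI)
      fix y assume "y \<in> Circ \<times> ?C"
      from nz[OF this] show "F (snd (snd y)) (j m (fst y, fst (snd y))) \<in> S2"
        unfolding F_def by simp
    qed
    show "F (snd (snd y)) (j m (fst y, fst (snd y))) \<noteq> - centre (near_index m f) (j m (fst y, fst (snd y)))"
      if "y \<in> Circ \<times> ?C" for y
    proof (rule inner_pos_not_neg)
      show "0 < centre (near_index m f) (j m (fst y, fst (snd y))) \<bullet> F (snd (snd y)) (j m (fst y, fst (snd y)))"
        unfolding F_def using pos[OF proj(2)[OF that] m j_Xs[OF proj(1)[OF that]]] nz[OF that] by simp
    qed
  qed
  obtain d where d: "\<And>t. t \<in> I01 \<Longrightarrow>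
      step_degree (\<lambda>y. G n (fst y, (snd y, t))) (\<lambda>y. G (Suc n) (fst y, (snd y, t))) d"
  proof (rule step_degree_homotopy[of "G n" "G (Suc n)"])
    show "continuous_on (Circ \<times> ?C) (G n)" "G n ` (Circ \<times> ?C) \<subseteq> S3c"
      "continuous_on (Circ \<times> ?C) (G (Suc n))" "G (Suc n) ` (Circ \<times> ?C) \<subseteq> S3c"
      by (rule hopf_liftD[OF G]; simp)+
    show "hopf (G (Suc n) (fst (e y), (snd (e y), t))) = hopf (G n (fst y, (snd y, t)))"
      if y: "y \<in> ST" and t: "t \<in> I01" for y t
    proof -
      have "(fst (e y), (snd (e y), t)) \<in> Circ \<times> ?C" "(fst y, (snd y, t)) \<in> Circ \<times> ?C"
        using e_ST[OF y] y t by (auto simp: mem_Times_iff)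
      then have "hopf (G (Suc n) (fst (e y), (snd (e y), t))) = F t (j (Suc n) (e y))"
        "hopf (G n (fst y, (snd y, t))) = F t (j n y)"
        using hopf_liftD(4)[OF G, of n] hopf_liftD(4)[OF G, of "Suc n"] by simp_all
      then show ?thesis using j_e[OF y] by simp
    qed
  qed (rule that)
  have G0: "G m (fst y, (snd y, 0)) = near_lift m f y" if "y \<in> ST" for m y
    unfolding G_def near_lift_def F_def L_def using cmapsD(2)[OF f(1) j_X[OF that]] by simp
  have G1: "G m (fst y, (snd y, 1)) = near_lift m f' y" if "y \<in> ST" "m \<in> {n, Suc n}" for m y
    unfolding G_def near_lift_def F_def L_def using cmapsD(2)[OF f(2) j_X[OF that(1)]] idx that(2) by auto
  have cong: "step_degree g g' d" if "step_degree k k' d" "\<And>y. y \<in> ST \<Longrightarrow> k y = g y" "\<And>y. y \<in> ST \<Longrightarrow> k' y = g' y" for g g' k k'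
    using that e_ST unfolding step_degree_def by metis
  have "degree_seq f n = d"
    by (rule degree_seq_eqI[OF f(1) cong[OF d[of 0]]]) (use G0 in auto)
  moreover have "degree_seq f' n = d"
    by (rule degree_seq_eqI[OF f(2) cong[OF d[of 1]]]) (use G1 in auto)
  ultimately show ?thesis by simp
qed

text \<open>Being positive against the \<open>i\<close>-th centre on a compact stage is an open
  condition; having least index \<open>i\<close> removes the finitely many earlier open
  sets.\<close>

lemma sets_near_index: "{f \<in> cmaps X S2. near_index n f = i} \<in> sets (borel_of (map_space X S2))"
proof -
  define A where "A = (\<lambda>i. {f \<in> cmaps X S2. \<forall>x\<in>Xs n. 0 < centre i x \<bullet> f x})"
  have "openin (map_space X S2) (A i)" for i
    unfolding openin_map_space_iff
  proof (intro conjI ballI)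
    show "A i \<subseteq> cmaps X S2" by (auto simp: A_def)
    fix f assume f: "f \<in> A i"
    then have fc: "f \<in> cmaps X S2" by (simp add: A_def)
    have ne: "Xs n \<noteq> {}" using j_Xs[of "(1, 0)" n] r by auto
    have "continuous_on (Xs n) (\<lambda>x. centre i x \<bullet> f x)"
      by (intro continuous_intros cmapsD(4) fc centre(1))
    from continuous_attains_inf[OF compact_Xs ne this]
    obtain z where z: "z \<in> Xs n" "\<forall>x\<in>Xs n. centre i z \<bullet> f z \<le> centre i x \<bullet> f x" by blast
    \<comment> \<open>The minimum over the stage. The centre has norm 1, so a perturbation smaller
      than this minimum keeps the inner product positive.\<close>
    define \<epsilon> where "\<epsilon> = centre i z \<bullet> f z"
    have "\<epsilon> > 0" using f z(1) by (simp add: A_def \<epsilon>_def)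
    moreover have "nearby f n \<epsilon> \<subseteq> A i"
    proof
      fix g assume g: "g \<in> nearby f n \<epsilon>"
      have "0 < centre i x \<bullet> g x" if x: "x \<in> Xs n" for x
      proof -
        have "\<bar>centre i x \<bullet> (f x - g x)\<bar> \<le> norm (centre i x) * norm (f x - g x)"
          by (rule Cauchy_Schwarz_ineq2)
        moreover have "norm (centre i x) = 1" using cmapsD(2)[OF centre(1)] Xs_sub x by blast
        moreover have "norm (f x - g x) < \<epsilon>" using g x by (simp add: nearby_def dist_norm)
        ultimately show ?thesis using bspec[OF z(2) x] by (simp add: inner_diff_right \<epsilon>_def)
      qed
      then show "g \<in> A i" using g by (simp add: A_def nearby_def)
    qed
    ultimately show "\<exists>n. \<exists>\<epsilon>>0. nearby f n \<epsilon> \<subseteq> A i" by blast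
  qed
  then have A: "A i \<in> sets (borel_of (map_space X S2))" for i by (rule openin_in_borel_of)
  have "{f \<in> cmaps X S2. near_index n f = i} = A i - (\<Union>k\<in>{..<i}. A k)"
  proof (intro set_eqI iffI)
    fix f assume f: "f \<in> {f \<in> cmaps X S2. near_index n f = i}"
    then have "f \<in> A i" using near_index[of f _ n] by (auto simp: A_def)
    moreover have "f \<notin> A k" if "k < i" for k
      using not_less_Least[of k "\<lambda>i. \<forall>x\<in>Xs n. 0 < centre i x \<bullet> f x"] that f by (auto simp: A_def near_index_def)
    ultimately show "f \<in> A i - (\<Union>k\<in>{..<i}. A k)" by blast
  next
    fix f assume f: "f \<in> A i - (\<Union>k\<in>{..<i}. A k)"
    have "near_index n f = i"
      unfolding near_index_def
      by (rule Least_equality) (use f in \<open>auto simp: A_def not_less[symmetric]\<close>)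
    then show "f \<in> {f \<in> cmaps X S2. near_index n f = i}" using f by (simp add: A_def)
  qed
  also have "\<dots> \<in> sets (borel_of (map_space X S2))"
    by (intro sets.Diff sets.finite_UN A) simp
  finally show ?thesis .
qed

text \<open>The \<open>n\<close>-th degree is constant on each of the countably many pieces cut out
  by the indices at stages \<open>n\<close> and \<open>n + 1\<close>.\<close>

lemma sets_degree_seq: "{f \<in> cmaps X S2. degree_seq f n = m} \<in> sets (borel_of (map_space X S2))"
proof -
  let ?S = "\<lambda>i k. {f \<in> cmaps X S2. near_index n f = i} \<inter> {f \<in> cmaps X S2. near_index (Suc n) f = k}"
  let ?P = "{(i, k). \<exists>f\<in>?S i k. degree_seq f n = m}"
  have "{f \<in> cmaps X S2. degree_seq f n = m} = (\<Union>(i, k)\<in>?P. ?S i k)"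
  proof (intro set_eqI iffI)
    fix f assume f: "f \<in> {f \<in> cmaps X S2. degree_seq f n = m}"
    then have "(near_index n f, near_index (Suc n) f) \<in> ?P" by auto
    then show "f \<in> (\<Union>(i, k)\<in>?P. ?S i k)" by (rule UN_I) (use f in simp)
  next
    fix f assume "f \<in> (\<Union>(i, k)\<in>?P. ?S i k)"
    then obtain i k f' where *: "f' \<in> ?S i k" "degree_seq f' n = m" "f \<in> ?S i k" by blast
    then have "degree_seq f n = degree_seq f' n" by (intro degree_seq_determined) simp_all
    then show "f \<in> {f \<in> cmaps X S2. degree_seq f n = m}" using * by simp
  qed
  also have "\<dots> \<in> sets (borel_of (map_space X S2))"
    by (rule sets.countable_UN'') (auto intro!: sets.Int sets_near_index)
  finally show ?thesis .
qed

section \<open>Homotopy classes in terms of degree sequences\<close>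

lemma homotopy_rel_iff:
  assumes "f \<in> cmaps X S2" "f' \<in> cmaps X S2"
  shows "(f, f') \<in> homotopy_rel X S2 \<longleftrightarrow> seq_equiv p (degree_seq f) (degree_seq f')"
proof
  assume "(f, f') \<in> homotopy_rel X S2"
  then obtain d where "coherent f d" "coherent f' d" by (rule coherent_homotopic)
  then show "seq_equiv p (degree_seq f) (degree_seq f')"
    using coherent_unique coherent_degree_seq assms seq_equiv_trans by meson
next
  assume "seq_equiv p (degree_seq f) (degree_seq f')"
  then have "coherent f (degree_seq f')" using coherent_shift coherent_degree_seq[OF assms(1)] by blast
  then show "(f, f') \<in> homotopy_rel X S2"
    using homotopic_coherent[OF coherent_degree_seq[OF assms(2)]] by blast
qed

lemma homotopy_rel_sub: "homotopy_rel X S2 \<subseteq> cmaps X S2 \<times> cmaps X S2"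
  by (auto simp: homotopy_rel_def)

lemma equiv_homotopy_rel: "equiv (cmaps X S2) (homotopy_rel X S2)"
proof (rule equivI)
  show "refl_on (cmaps X S2) (homotopy_rel X S2)"
    using homotopy_rel_iff seq_equiv_refl by (intro refl_onI) blast
  show "sym (homotopy_rel X S2)"
  proof (rule symI)
    fix f g assume fg: "(f, g) \<in> homotopy_rel X S2"
    then have c: "f \<in> cmaps X S2" "g \<in> cmaps X S2" by (auto simp: homotopy_rel_def)
    show "(g, f) \<in> homotopy_rel X S2"
      using fg seq_equiv_sym unfolding homotopy_rel_iff[OF c] homotopy_rel_iff[OF c(2,1)] by blast
  qed
  show "trans (homotopy_rel X S2)"
  proof (rule transI)
    fix f g h assume fg: "(f, g) \<in> homotopy_rel X S2" and gh: "(g, h) \<in> homotopy_rel X S2"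
    then have c: "f \<in> cmaps X S2" "g \<in> cmaps X S2" "h \<in> cmaps X S2" by (auto simp: homotopy_rel_def)
    show "(f, h) \<in> homotopy_rel X S2"
      using fg gh seq_equiv_trans
      unfolding homotopy_rel_iff[OF c(1,2)] homotopy_rel_iff[OF c(2,3)] homotopy_rel_iff[OF c(1,3)] by blast
  qed
qed (rule homotopy_rel_sub)

lemma degree_seq_realize: "seq_equiv p (degree_seq (realize d)) d"
  using coherent_unique[OF coherent_degree_seq[OF realize_cmaps] coherent_realize] .

text \<open>Each compact subset lies in one solid torus, on which every map to the two-sphere is
  inessential.\<close>

lemma phantom_cmaps: "f \<in> cmaps X S2 \<Longrightarrow> phantom X S2 f"
  unfolding phantom_def
proof (intro conjI allI impI)
  fix K assume f: "f \<in> cmaps X S2" and K: "compact K \<and> K \<subseteq> X"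
  then obtain n where n: "K \<subseteq> Xs n" using compact_sub_Xs by blast
  obtain c where c: "c \<in> S2" "homotopic_with_canon (\<lambda>_. True) ST S2 (\<lambda>y. f (j n y)) (\<lambda>_. c)"
    using homotopic_const_Circ_Times_convex[OF convex_cball continuous_on_comp_j[OF f] comp_j_S2[OF f]] by blast
  have "homotopic_with_canon (\<lambda>_. True) K S2 ((\<lambda>y. f (j n y)) \<circ> j_inv n) ((\<lambda>_. c) \<circ> j_inv n)"
    using homotopic_with_compose_continuous_right[OF c(2), of K "j_inv n"] continuous_on_subset[OF continuous_on_j_inv n]
      j_inv_ST(1) n by blast
  then have "homotopic_with_canon (\<lambda>_. True) K S2 f (\<lambda>_. c)"
    by (rule homotopic_with_eq) (use j_inv_ST(2) n in auto)
  then show "\<exists>c\<in>S2. homotopic_with_canon (\<lambda>_. True) K S2 f (\<lambda>_. c)" using c(1) by blast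
qed

lemma homotopy_classes_phantom: "homotopy_classes X S2 = phantom_classes X S2"
  unfolding homotopy_classes_def phantom_classes_def quotient_def
  using phantom_cmaps by (auto simp: phantom_def)

end

section \<open>Definability\<close>

context telescope begin

abbreviation MS where "MS \<equiv> map_space X S2"
abbreviation HR where "HR \<equiv> homotopy_rel X S2"

text \<open>By \<open>seq_equiv_iff_dvd\<close> the relation is a countable union, over the initial
  integer, of countable intersections of conditions on finitely many degrees.\<close>

lemma borel_homotopy_rel: "HR \<in> sets (borel_of (prod_topology MS MS))"
proof -
  let ?M = "borel_of (prod_topology MS MS)"
  define \<Delta> where "\<Delta> = (\<lambda>z n. degree_seq (fst z) n - degree_seq (snd z) n)"
  have fst: "{z \<in> space ?M. degree_seq (fst z) n = m} \<in> sets ?M" for n m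
  proof -
    have "{z \<in> space ?M. degree_seq (fst z) n = m} = fst -` {f \<in> cmaps X S2. degree_seq f n = m} \<inter> space ?M"
      by auto
    then show ?thesis
      using measurable_sets[OF continuous_map_measurable_borel_of[OF continuous_map_fst[of MS MS]] sets_degree_seq[of n m]]
      by simp
  qed
  have snd: "{z \<in> space ?M. degree_seq (snd z) n = m} \<in> sets ?M" for n m
  proof -
    have "{z \<in> space ?M. degree_seq (snd z) n = m} = snd -` {f \<in> cmaps X S2. degree_seq f n = m} \<inter> space ?M"
      by auto
    then show ?thesis
      using measurable_sets[OF continuous_map_measurable_borel_of[OF continuous_map_snd[of MS MS]] sets_degree_seq[of n m]]
      by simp
  qed
  have \<Delta>: "{z \<in> space ?M. \<Delta> z n = m} \<in> sets ?M" for n m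
  proof -
    have "{z \<in> space ?M. \<Delta> z n = m} =
      (\<Union>k. {z \<in> space ?M. degree_seq (fst z) n = k + m} \<inter> {z \<in> space ?M. degree_seq (snd z) n = k})"
      by (auto simp: \<Delta>_def)
    also have "\<dots> \<in> sets ?M" by (intro sets.countable_UN'' sets.Int fst snd) auto
    finally show ?thesis .
  qed
  have Q: "{z \<in> space ?M. int p ^ n dvd a + (\<Sum>i<n. int p ^ i * \<Delta> z i)} \<in> sets ?M" for a n
  proof (rule sets_initial_segment[OF \<Delta>, of "\<lambda>d. int p ^ n dvd a + (\<Sum>i<n. int p ^ i * d i)"])
    fix d assume "int p ^ n dvd a + (\<Sum>i<n. int p ^ i * d i)"
    then show "\<exists>k. \<forall>d'. (\<forall>i<k. d' i = d i) \<longrightarrow> int p ^ n dvd a + (\<Sum>i<n. int p ^ i * d' i)"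
      by (intro exI[of _ n]) auto
  qed
  have "HR = {z \<in> space ?M. seq_equiv p (degree_seq (fst z)) (degree_seq (snd z))}"
    using homotopy_rel_iff homotopy_rel_sub by auto
  also have "\<dots> = (\<Union>a. \<Inter>n. {z \<in> space ?M. int p ^ n dvd a + (\<Sum>i<n. int p ^ i * \<Delta> z i)})"
    using p by (auto simp: seq_equiv_iff_dvd \<Delta>_def)
  also have "\<dots> \<in> sets ?M"
    by (intro sets.countable_UN'' sets.countable_INT') (use Q in auto)
  finally show ?thesis .
qed

definition core :: "('a \<Rightarrow> real^3) \<Rightarrow> ('a \<Rightarrow> real^3) set" where
  "core f = range (\<lambda>i. realize (digits p i (degree_seq f)))"

lemma core_class:
  assumes "(f, f') \<in> HR" shows "core f = core f'"
proof -
  have c: "f \<in> cmaps X S2" "f' \<in> cmaps X S2" using assms homotopy_rel_sub by auto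
  have "range (\<lambda>i. digits p i (degree_seq f)) = range (\<lambda>i. digits p i (degree_seq f'))"
    using digits_class[of p] assms p unfolding homotopy_rel_iff[OF c] by simp
  then have "realize ` range (\<lambda>i. digits p i (degree_seq f)) = realize ` range (\<lambda>i. digits p i (degree_seq f'))"
    by simp
  then show ?thesis by (simp add: core_def image_image)
qed

lemma core_sub: assumes "f \<in> cmaps X S2" shows "core f \<subseteq> HR `` {f}"
proof
  fix k assume "k \<in> core f"
  then obtain i where k: "k = realize (digits p i (degree_seq f))" by (auto simp: core_def)
  have "seq_equiv p (degree_seq k) (degree_seq f)"
    unfolding k using degree_seq_realize digits_equiv by (rule seq_equiv_trans)
  then have "(f, k) \<in> HR"
    using homotopy_rel_iff[OF assms realize_cmaps] seq_equiv_sym unfolding k by blast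
  then show "k \<in> HR `` {f}" by blast
qed

text \<open>A class is given the filter of the supersets of its countable set of realized digit
  sequences; that set is enumerated measurably although it has no measurable selector.\<close>

lemma idealistic_homotopy_rel: "idealistic MS HR"
proof -
  \<comment> \<open>The chosen representative does not matter, by \<open>core_class\<close>; the
    filter thus belongs to the class itself.\<close>
  define N where "N = (\<lambda>c. core (SOME f. f \<in> c))"
  define F where "F = (\<lambda>c. {S. S \<subseteq> c \<and> N c \<subseteq> S})"
  have N: "N (HR `` {f}) = core f" if "f \<in> cmaps X S2" for f
  proof -
    have "f \<in> HR `` {f}" using equiv_class_self[OF equiv_homotopy_rel that] .
    then have "(SOME f'. f' \<in> HR `` {f}) \<in> HR `` {f}" by (rule someI[of "\<lambda>f'. f' \<in> HR `` {f}"])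
    then show ?thesis unfolding N_def using core_class by auto
  qed
  show ?thesis
    unfolding idealistic_def
  proof (intro exI[of _ F] exI[of _ "\<lambda>y. y"] conjI ballI)
    fix c assume "c \<in> topspace MS // HR"
    then obtain f where f: "f \<in> cmaps X S2" "c = HR `` {f}" by (auto elim: quotientE)
    have "N c \<subseteq> c" "N c \<noteq> {}" using core_sub[OF f(1)] N[OF f(1)] f(2) by (simp_all add: core_def)
    then show "sigma_filter c (F c)"
      unfolding sigma_filter_def F_def by (intro conjI) blast+
  next
    show "(\<lambda>y. y) \<in> measurable (borel_of MS) (borel_of MS)" by (rule measurable_ident_sets) simp
  next
    fix y assume "y \<in> topspace MS"
    then show "(y, y) \<in> HR" using equiv_homotopy_rel by (auto dest: equiv_class_self)
  next
    fix A assume A: "A \<in> sets (borel_of (prod_topology MS MS))"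
    \<comment> \<open>For a fixed initial carry the digits up to a place depend on the degrees up to
      that place, so each enumerating map is Borel.\<close>
    have meas: "(\<lambda>y. (y, realize (digits p i (degree_seq y)))) \<in> measurable (borel_of MS) (borel_of (prod_topology MS MS))" for i
    proof (rule measurable_Pair_borel_of[OF _ _ second_countable_map_space second_countable_map_space])
      show "(\<lambda>y. y) \<in> measurable (borel_of MS) (borel_of MS)" by (rule measurable_ident_sets) simp
      show "(\<lambda>y. realize (digits p i (degree_seq y))) \<in> measurable (borel_of MS) (borel_of MS)"
      proof (rule measurable_initial_segment[where F = "\<lambda>d. realize (digits p i d)"])
        show "{x \<in> space (borel_of MS). degree_seq x n = m} \<in> sets (borel_of MS)" for n m
          using sets_degree_seq[of n m] by simp
        show "realize (digits p i d) \<in> topspace MS" for d using realize_cmaps by simp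
        show "\<exists>n. \<forall>d'. (\<forall>i<n. d' i = d i) \<longrightarrow> realize (digits p i d') \<in> U"
          if "openin MS U" "realize (digits p i d) \<in> U" for U d
        proof -
          from realize_continuous[OF that] obtain n
            where n: "\<forall>d'. (\<forall>k<n. d' k = digits p i d k) \<longrightarrow> realize d' \<in> U" by blast
          have "realize (digits p i d') \<in> U" if "\<forall>i<n. d' i = d i" for d'
            using n digits_initial[OF that] by blast
          then show ?thesis by blast
        qed
      qed
    qed
    \<comment> \<open>A set belongs to the filter iff it contains the core. Since the core is
      enumerated by the integers, this is a countable intersection.\<close>
    have "{y \<in> topspace MS. {y' \<in> HR `` {y}. (y, y') \<in> A} \<in> F (HR `` {y})} =
      (\<Inter>i. (\<lambda>y. (y, realize (digits p i (degree_seq y)))) -` A \<inter> space (borel_of MS))"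
    proof (intro set_eqI)
      fix y
      show "y \<in> {y \<in> topspace MS. {y' \<in> HR `` {y}. (y, y') \<in> A} \<in> F (HR `` {y})} \<longleftrightarrow>
        y \<in> (\<Inter>i. (\<lambda>y. (y, realize (digits p i (degree_seq y)))) -` A \<inter> space (borel_of MS))"
      proof (cases "y \<in> cmaps X S2")
        case True
        have "{y' \<in> HR `` {y}. (y, y') \<in> A} \<in> F (HR `` {y}) \<longleftrightarrow> core y \<subseteq> {y' \<in> HR `` {y}. (y, y') \<in> A}"
          unfolding F_def N[OF True] by blast
        also have "\<dots> \<longleftrightarrow> (\<forall>k\<in>core y. (y, k) \<in> A)" using core_sub[OF True] by blast
        also have "\<dots> \<longleftrightarrow> (\<forall>i. (y, realize (digits p i (degree_seq y))) \<in> A)" by (auto simp: core_def)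
        finally show ?thesis using True by auto
      qed auto
    qed
    also have "\<dots> \<in> sets (borel_of MS)"
      by (rule sets.countable_INT') (use measurable_sets[OF meas A] in auto)
    finally show "{y \<in> topspace MS. {y' \<in> HR `` {y}. (y, y') \<in> A} \<in> F (HR `` {y})} \<in> sets (borel_of MS)" .
  qed
qed

lemma definable_set_homotopy_rel: "definable_set MS HR"
  unfolding definable_set_def
  using polish_map_space equiv_homotopy_rel borel_homotopy_rel idealistic_homotopy_rel by simp

text \<open>The same constant lift on all tori has degree 0 at every step; this settles the base
  point.\<close>

lemma degree_seq_const:
  assumes "c \<in> S2" shows "(\<lambda>x\<in>X. c) \<in> cmaps X S2" "seq_equiv p (degree_seq (\<lambda>x\<in>X. c)) (\<lambda>_. 0)"
proof -
  have "continuous_on X (\<lambda>x\<in>X. c)"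
    by (rule continuous_on_eq[OF continuous_on_const[of X c]]) simp
  then show *: "(\<lambda>x\<in>X. c) \<in> cmaps X S2" using assms by (auto simp: cmaps_def)
  obtain g where g: "g \<in> S3c" "hopf g = c" using hopf_surj[OF assms] .
  have "coherent (\<lambda>x\<in>X. c) (\<lambda>_. 0)"
    unfolding coherent_def
  proof (intro conjI * exI allI)
    fix n :: nat
    show "hopf_lift ST (\<lambda>y. (\<lambda>x\<in>X. c) (j n y)) (\<lambda>_. g)"
      unfolding hopf_lift_def
    proof (intro conjI ballI)
      show "hopf g = (\<lambda>x\<in>X. c) (j n y)" if "y \<in> ST" for y using j_X[OF that] g(2) by simp
    qed (use g(1) in auto)
    show "step_degree (\<lambda>_. g) (\<lambda>_. g) 0"
      unfolding step_degree_def
      by (rule exI[of _ "\<lambda>y. fst y powi 0"]) (use has_degree_powi[of D 0] in simp)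
  qed
  then show "seq_equiv p (degree_seq (\<lambda>x\<in>X. c)) (\<lambda>_. 0)"
    using coherent_unique[OF coherent_degree_seq[OF *]] by blast
qed

theorem definable_bijection_ext:
  "\<exists>\<phi>. definable_bijection MS HR (ext_space (Z_inv p) (UNIV :: int set)) (ext_rel (Z_inv p) (UNIV :: int set)) \<phi> \<and>
     (\<forall>c\<in>S2. \<phi> (HR `` {\<lambda>x\<in>X. c}) = ext_rel (Z_inv p) (UNIV :: int set) `` {\<lambda>u\<in>Z_inv p \<times> Z_inv p. 0})"
proof -
  interpret E: Z_inv_ext p by unfold_locales (rule p)
  let ?ES = "ext_space (Z_inv p) (UNIV :: int set)"
  let ?ER = "ext_rel (Z_inv p) (UNIV :: int set)"
  let ?EC = "ext_cocycles (Z_inv p) (UNIV :: int set)"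
  define \<Phi> where "\<Phi> = (\<lambda>f. E.ext_of (degree_seq f))"
  \<comment> \<open>\<open>rel\<close> below makes the choice of representative irrelevant and gives
    injectivity; surjectivity combines \<open>ext_of_surj\<close> with realised sequences.\<close>
  define \<phi> where "\<phi> = (\<lambda>c. ?ER `` {\<Phi> (SOME f. f \<in> c)})"
  have rel: "(f, f') \<in> HR \<longleftrightarrow> (\<Phi> f, \<Phi> f') \<in> ?ER" if "f \<in> cmaps X S2" "f' \<in> cmaps X S2" for f f'
    unfolding homotopy_rel_iff[OF that] \<Phi>_def E.ext_rel_ext_of_iff ..
  have \<phi>: "\<phi> (HR `` {f}) = ?ER `` {\<Phi> f}" if f: "f \<in> cmaps X S2" for f
  proof -
    have "f \<in> HR `` {f}" using equiv_class_self[OF equiv_homotopy_rel f] .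
    then have "(SOME f'. f' \<in> HR `` {f}) \<in> HR `` {f}" by (rule someI[of "\<lambda>f'. f' \<in> HR `` {f}"])
    then have s: "(f, SOME f'. f' \<in> HR `` {f}) \<in> HR" by simp
    then have "(SOME f'. f' \<in> HR `` {f}) \<in> cmaps X S2" using homotopy_rel_sub by blast
    then have "(\<Phi> f, \<Phi> (SOME f'. f' \<in> HR `` {f})) \<in> ?ER" using s rel[OF f] by blast
    then show ?thesis unfolding \<phi>_def using equiv_class_eq[OF E.equiv_ext_rel] by metis
  qed
  have "\<Phi> \<in> measurable (borel_of MS) (borel_of ?ES)"
    unfolding \<Phi>_def
  proof (rule measurable_initial_segment)
    show "{x \<in> space (borel_of MS). degree_seq x n = m} \<in> sets (borel_of MS)" for n m
      using sets_degree_seq[of n m] by simp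
  qed (use E.ext_of_cocycle E.topspace_ext_space E.ext_of_continuous in auto)
  moreover have "\<phi> \<in> topspace MS // HR \<rightarrow> topspace ?ES // ?ER"
  proof
    fix c assume "c \<in> topspace MS // HR"
    then obtain f where f: "f \<in> cmaps X S2" "c = HR `` {f}" by (auto elim: quotientE)
    then show "\<phi> c \<in> topspace ?ES // ?ER"
      unfolding E.topspace_ext_space using \<phi>[OF f(1)] E.ext_of_cocycle by (auto simp: \<Phi>_def intro: quotientI)
  qed
  ultimately have "definable_map MS HR ?ES ?ER \<phi>"
    unfolding definable_map_def using \<phi> by (intro conjI bexI[of _ \<Phi>]) auto
  moreover have "bij_betw \<phi> (topspace MS // HR) (topspace ?ES // ?ER)"
    unfolding bij_betw_def
  proof
    show "inj_on \<phi> (topspace MS // HR)"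
    proof (rule inj_onI)
      fix c c' assume cc: "c \<in> topspace MS // HR" "c' \<in> topspace MS // HR" and eq: "\<phi> c = \<phi> c'"
      obtain f where f: "f \<in> cmaps X S2" "c = HR `` {f}" using cc(1) by (auto elim: quotientE)
      obtain f' where f': "f' \<in> cmaps X S2" "c' = HR `` {f'}" using cc(2) by (auto elim: quotientE)
      have "?ER `` {\<Phi> f} = ?ER `` {\<Phi> f'}" using eq \<phi> f f' by simp
      then have "(\<Phi> f, \<Phi> f') \<in> ?ER"
        by (rule eq_equiv_class[OF _ E.equiv_ext_rel]) (simp add: \<Phi>_def E.ext_of_cocycle)
      then have "(f, f') \<in> HR" using rel[OF f(1) f'(1)] by blast
      then show "c = c'" unfolding f(2) f'(2) by (rule equiv_class_eq[OF equiv_homotopy_rel])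
    qed
    show "\<phi> ` (topspace MS // HR) = topspace ?ES // ?ER"
    proof
      show "\<phi> ` (topspace MS // HR) \<subseteq> topspace ?ES // ?ER"
        using \<open>\<phi> \<in> topspace MS // HR \<rightarrow> topspace ?ES // ?ER\<close> by blast
      show "topspace ?ES // ?ER \<subseteq> \<phi> ` (topspace MS // HR)"
      proof
        fix C assume "C \<in> topspace ?ES // ?ER"
        then obtain g where g: "g \<in> ?EC" "C = ?ER `` {g}"
          unfolding E.topspace_ext_space by (auto elim: quotientE)
        obtain d where d: "(g, E.ext_of d) \<in> ?ER" using E.ext_of_surj[OF g(1)] .
        have "(E.ext_of (degree_seq (realize d)), E.ext_of d) \<in> ?ER"
          unfolding E.ext_rel_ext_of_iff by (rule degree_seq_realize)
        then have "?ER `` {\<Phi> (realize d)} = ?ER `` {E.ext_of d}"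
          unfolding \<Phi>_def by (rule equiv_class_eq[OF E.equiv_ext_rel])
        also have "\<dots> = C" unfolding g(2) using equiv_class_eq[OF E.equiv_ext_rel d] by simp
        finally have "C = \<phi> (HR `` {realize d})" using \<phi>[OF realize_cmaps] by simp
        moreover have "HR `` {realize d} \<in> topspace MS // HR"
          using realize_cmaps by (intro quotientI) simp
        ultimately show "C \<in> \<phi> ` (topspace MS // HR)" by (rule image_eqI)
      qed
    qed
  qed
  moreover have "\<phi> (HR `` {\<lambda>x\<in>X. c}) = ?ER `` {\<lambda>u\<in>Z_inv p \<times> Z_inv p. 0}" if "c \<in> S2" for c
    unfolding \<phi>[OF degree_seq_const(1)[OF that]] E.ext_of_zero [symmetric]
    by (rule equiv_class_eq[OF E.equiv_ext_rel])
      (use degree_seq_const(2)[OF that] in \<open>simp add: \<Phi>_def E.ext_rel_ext_of_iff\<close>)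
  ultimately show ?thesis unfolding definable_bijection_def by blast
qed

end

section \<open>The solenoid complement as a telescope\<close>

lemma smooth_map_continuous_on:
  assumes "smooth_map X Y f" shows "continuous_on X f"
  unfolding continuous_on_eq_continuous_within
proof
  fix x assume x: "x \<in> X"
  then obtain U F where U: "open U" "x \<in> U" "\<forall>k. Ck_on k U F" "\<forall>y\<in>X \<inter> U. F y = f y"
    using assms unfolding smooth_map_def by blast
  have "continuous_on U F" using U(3) Ck_on.simps(1)[of U F] by blast
  then have "continuous_on (X \<inter> U) F" by (rule continuous_on_subset) blast
  then have "continuous_on (X \<inter> U) f" by (rule continuous_on_eq) (use U(4) in blast)
  then have "continuous (at x within X \<inter> U) f"
    using x U(2) by (simp add: continuous_on_eq_continuous_within)
  moreover have "at x within X = at x within X \<inter> U"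
    by (rule at_within_nhd[OF U(2,1)]) blast
  ultimately show "continuous (at x within X) f" by simp
qed

lemma diffeomorphismD:
  assumes "diffeomorphism X Y f"
  shows "bij_betw f X Y" "continuous_on X f" "continuous_on Y (inv_into X f)"
  using assms smooth_map_continuous_on unfolding diffeomorphism_def by blast+

lemma continuous_on_solenoid_map: "continuous_on (Circ \<times> C) (solenoid_map p \<epsilon>)"
  unfolding solenoid_map_def case_prod_beta by (intro continuous_intros) auto

lemma fst_solenoid_map: "fst (solenoid_map p \<epsilon> y) = fst y ^ p"
  by (simp add: solenoid_map_def case_prod_beta)

text \<open>Invariance of domain needs Euclidean spaces of equal dimension. The omitted point
  \<open>a\<close> turns the sphere into a three-dimensional one, and the open torus is covered by
  pieces over arcs, which are parametrised by angle and disc coordinate.\<close>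

lemma openin_image_open_torus:
  fixes f :: "complex \<times> complex \<Rightarrow> real^4"
  assumes f: "continuous_on (Circ \<times> cball 0 r) f" "inj_on f (Circ \<times> cball 0 r)" "f ` (Circ \<times> cball 0 r) \<subseteq> S3"
    and a: "a \<in> S3" "a \<notin> f ` (Circ \<times> cball 0 r)"
  shows "openin (top_of_set S3) (f ` (Circ \<times> ball 0 r))"
proof -
  have "(S3 - {a}) homeomorphic (UNIV :: (real \<times> complex) set)"
    using a(1) by (intro homeomorphic_punctured_sphere_affine) auto
  then obtain k k' where k: "homeomorphism (S3 - {a}) (UNIV :: (real \<times> complex) set) k k'"
    unfolding homeomorphic_def by blast
  let ?E = "\<lambda>s::real \<times> complex. (cis (fst s), snd s)"
  \<comment> \<open>An arc of length 2 is shorter than a full turn, so the angle is injective on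
    it.\<close>
  have open_piece: "openin (top_of_set S3) (f ` ?E ` ({t-1<..<t+1} \<times> ball 0 r))" for t :: real
  proof -
    let ?U = "{t-1<..<t+1} \<times> ball (0::complex) r"
    have EU: "?E s \<in> Circ \<times> cball 0 r" if "s \<in> ?U" for s using that by auto
    have fS: "f (?E s) \<in> S3 - {a}" if "s \<in> ?U" for s
      using EU[OF that] f(3) a(2) by blast
    have cont: "continuous_on ?U (\<lambda>s. k (f (?E s)))"
    proof (rule continuous_on_compose2[OF homeomorphism_cont1[OF k]])
      show "continuous_on ?U (\<lambda>s. f (?E s))"
        by (rule continuous_on_compose2[OF f(1)]) (use EU in \<open>blast | intro continuous_intros\<close>)+
      show "(\<lambda>s. f (?E s)) ` ?U \<subseteq> S3 - {a}" using fS by blast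
    qed
    have inj: "inj_on (\<lambda>s. k (f (?E s))) ?U"
    proof (rule inj_onI)
      fix s s' assume s: "s \<in> ?U" "s' \<in> ?U" and eq: "k (f (?E s)) = k (f (?E s'))"
      have "f (?E s) = f (?E s')"
        using arg_cong[OF eq, of k'] unfolding homeomorphism_apply1[OF k fS[OF s(1)]] homeomorphism_apply1[OF k fS[OF s(2)]] .
      then have "?E s = ?E s'" by (rule inj_onD[OF f(2) _ EU[OF s(1)] EU[OF s(2)]])
      then have *: "cis (fst s) = cis (fst s')" "snd s = snd s'" by auto
      from *(1) obtain n :: int where n: "fst s - fst s' = of_int n * (2 * pi)"
        by (rule cis_eq_cis_imp)
      have "\<bar>fst s - fst s'\<bar> < 2" using s by auto
      then have "\<bar>real_of_int n\<bar> * (2 * pi) < 2"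
        unfolding n by (simp add: abs_mult)
      then have "\<bar>real_of_int n\<bar> * (2 * pi) < 1 * (2 * pi)" using pi_gt3 by linarith
      then have "\<bar>real_of_int n\<bar> < 1" by (rule mult_right_less_imp_less) simp
      then have "n = 0" by auto
      then show "s = s'" using n *(2) by (auto intro: prod_eqI)
    qed
    have "open ((\<lambda>s. k (f (?E s))) ` ?U)"
      by (rule invariance_of_domain[OF cont _ inj]) (intro open_Times open_greaterThanLessThan open_ball)
    then have "openin (top_of_set (S3 - {a})) ((S3 - {a}) \<inter> k -` ((\<lambda>s. k (f (?E s))) ` ?U))"
      by (rule continuous_openin_preimage_gen[OF homeomorphism_cont1[OF k]])
    moreover have "(S3 - {a}) \<inter> k -` ((\<lambda>s. k (f (?E s))) ` ?U) = f ` ?E ` ?U"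
    proof
      show "(S3 - {a}) \<inter> k -` ((\<lambda>s. k (f (?E s))) ` ?U) \<subseteq> f ` ?E ` ?U"
      proof
        fix x assume "x \<in> (S3 - {a}) \<inter> k -` ((\<lambda>s. k (f (?E s))) ` ?U)"
        then obtain s where s: "x \<in> S3 - {a}" "s \<in> ?U" "k x = k (f (?E s))" by blast
        have "x = f (?E s)"
          using arg_cong[OF s(3), of k'] unfolding homeomorphism_apply1[OF k s(1)] homeomorphism_apply1[OF k fS[OF s(2)]] .
        then show "x \<in> f ` ?E ` ?U" using s(2) by blast
      qed
      show "f ` ?E ` ?U \<subseteq> (S3 - {a}) \<inter> k -` ((\<lambda>s. k (f (?E s))) ` ?U)" using fS by blast
    qed
    ultimately have "openin (top_of_set (S3 - {a})) (f ` ?E ` ?U)" by simp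
    moreover have "openin (top_of_set S3) (S3 - {a})" by (simp add: openin_delete)
    ultimately show ?thesis by (rule openin_trans)
  qed
  have "f ` (Circ \<times> ball 0 r) = (\<Union>t. f ` ?E ` ({t-1<..<t+1} \<times> ball 0 r))"
  proof (intro subset_antisym subsetI)
    fix x assume "x \<in> f ` (Circ \<times> ball 0 r)"
    then obtain z w where zw: "z \<in> Circ" "w \<in> ball 0 r" "x = f (z, w)" by blast
    have "cis (Arg z) = z" using zw(1) cis_Arg[of z] by (cases "z = 0") (simp_all add: sgn_div_norm)
    then have "(z, w) = ?E (Arg z, w)" by simp
    moreover have "(Arg z, w) \<in> {Arg z - 1<..<Arg z + 1} \<times> ball 0 r" using zw(2) by simp
    ultimately have "(z, w) \<in> ?E ` ({Arg z - 1<..<Arg z + 1} \<times> ball 0 r)" by (rule image_eqI)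
    then show "x \<in> (\<Union>t. f ` ?E ` ({t-1<..<t+1} \<times> ball 0 r))" using zw(3) by blast
  qed auto
  then show ?thesis using open_piece by (auto intro!: openin_Union)
qed

theorem theorem8p19:
  fixes p :: nat and r \<epsilon> :: real
    and h :: "real^4 \<Rightarrow> real^4" and jp jm :: "complex \<times> complex \<Rightarrow> real^4"
    and Tp Tm X :: "(real^4) set"
  assumes "p \<ge> 2" and "r > 0" and "\<epsilon> > 0"
    and "solenoid_map p \<epsilon> ` solid_torus r \<subseteq> sphere 0 1 \<times> ball 0 r"
    and "inj_on (solenoid_map p \<epsilon>) (solid_torus r)"
    and "diffeomorphism S3 S3 h" and "orientation_preserving_S3 h"
    and "smooth_embedding (solid_torus r) S3 jp"
    and "\<forall>x\<in>solid_torus r. h (jp x) = jp (solenoid_map p \<epsilon> x)"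
    and "Tp = jp ` solid_torus r" and "Tm = closure (S3 - Tp)"
    and "diffeomorphism (solid_torus r) Tm jm"
    and "\<forall>x\<in>solid_torus r. inv_into S3 h (jm x) = jm (solenoid_map p \<epsilon> x)"
    and "X = S3 - solenoid h Tp"
  shows "homotopy_classes X S2 = phantom_classes X S2 \<and>
    definable_set (map_space X S2) (homotopy_rel X S2) \<and>
    (\<exists>\<phi>. definable_bijection
            (map_space X S2) (homotopy_rel X S2)
            (ext_space (Z_inv p) (UNIV :: int set)) (ext_rel (Z_inv p) (UNIV :: int set)) \<phi> \<and>
         (\<forall>c\<in>S2. \<phi> (homotopy_rel X S2 `` {\<lambda>x\<in>X. c}) =
            ext_rel (Z_inv p) (UNIV :: int set) `` {\<lambda>u\<in>Z_inv p \<times> Z_inv p. 0}))"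
proof -
  let ?e = "solenoid_map p \<epsilon>" and ?ST = "Circ \<times> cball (0::complex) r"
  note e = assms(4,5)[unfolded solid_torus_def]
  have hS: "bij_betw h S3 S3" "continuous_on S3 h" using diffeomorphismD[OF assms(6)] by blast+
  have jp: "bij_betw jp ?ST Tp" "continuous_on ?ST jp" "Tp \<subseteq> S3"
    using assms(8,10) diffeomorphismD[of ?ST "jp ` ?ST" jp]
    unfolding smooth_embedding_def solid_torus_def by auto
  have jm: "bij_betw jm ?ST Tm" "continuous_on ?ST jm"
    using diffeomorphismD[OF assms(12)[unfolded solid_torus_def]] by blast+
  have cST: "compact ?ST" by (intro compact_Times) auto
  have cTp: "compact Tp"
    using compact_continuous_image[OF jp(2) cST] bij_betw_imp_surj_on[OF jp(1)] by simp
  have TmS: "Tm \<subseteq> S3" unfolding assms(11) by (rule closure_minimal) auto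
  have ST1: "(1, 0) \<in> ?ST" using assms(2) by simp
  then have "jm (1, 0) \<in> Tm" using jm(1) bij_betwE by blast
  then have "S3 - Tp \<noteq> {}" unfolding assms(11) by force
  \<comment> \<open>\<open>Tm\<close> is the closure of the complement of \<open>Tp\<close> and is
    not empty, so \<open>Tp\<close> omits a point at which the sphere can be punctured.\<close>
  then obtain a where "a \<in> S3" "a \<notin> Tp" by blast
  then have a: "a \<in> S3" "a \<notin> jp ` ?ST" using assms(10) by (simp_all add: solid_torus_def)
  have e_ball: "?e y \<in> Circ \<times> ball 0 r" if "y \<in> ?ST" for y using e(1) that by blast
  have "openin (top_of_set S3) (jp ` (Circ \<times> ball 0 r))"
    using jp a by (intro openin_image_open_torus) (auto simp: bij_betw_def)
  then obtain W where W: "open W" "jp ` (Circ \<times> ball 0 r) = S3 \<inter> W" unfolding openin_open by blast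
  have "jp ` (Circ \<times> ball 0 r) \<subseteq> Tp"
    using assms(10) by (auto simp: solid_torus_def)
  then have "W \<inter> (S3 - Tp) = {}" using W(2) by blast
  \<comment> \<open>An open set disjoint from the complement of \<open>Tp\<close> is disjoint from
    its closure, so \<open>Tm\<close> does not meet the open torus.\<close>
  then have WTm: "W \<inter> Tm = {}" unfolding assms(11) using open_Int_closure_eq_empty[OF W(1)] by blast
  have hTp: "h ` Tp \<subseteq> S3 \<inter> W"
  proof
    fix x assume "x \<in> h ` Tp"
    then obtain y where y: "y \<in> ?ST" "x = h (jp y)" using assms(10) by (auto simp: solid_torus_def)
    then have "x = jp (?e y)" using assms(9) by (simp add: solid_torus_def)
    then show "x \<in> S3 \<inter> W" unfolding W(2)[symmetric] by (rule image_eqI[OF _ e_ball[OF y(1)]])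
  qed
  \<comment> \<open>The map sends the closed torus into the open one, which \<open>Tm\<close>
    avoids. Applying iterates of \<open>h\<close> gives the strict nesting of the stages.\<close>
  then have Tm_sub: "Tm \<subseteq> S3 - h ` Tp" using TmS WTm by blast
  have hn: "bij_betw (h ^^ n) S3 S3 \<and> continuous_on S3 (h ^^ n)" for n
  proof (induction n)
    case (Suc n)
    have "bij_betw (h \<circ> (h ^^ n)) S3 S3" using Suc hS(1) bij_betw_trans by blast
    moreover have "continuous_on S3 (h \<circ> (h ^^ n))"
    proof (rule continuous_on_compose)
      have "(h ^^ n) ` S3 = S3" using Suc bij_betw_imp_surj_on by blast
      then show "continuous_on ((h ^^ n) ` S3) h" using hS(2) by (simp only:)
    qed (use Suc in blast)
    ultimately show ?case unfolding funpow.simps by blast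
  next
    case 0
    show ?case using bij_betw_id[of S3] continuous_on_id[of S3] by (simp add: id_def)
  qed
  have hn_diff: "(h ^^ n) ` (S3 - A) = S3 - (h ^^ n) ` A" if "A \<subseteq> S3" for n A
    using inj_on_image_set_diff[of "h ^^ n" S3 S3 A] hn[of n] that by (auto simp: bij_betw_def)
  have solenoid: "solenoid h Tp = (\<Inter>n. (h ^^ n) ` Tp)" by (simp add: solenoid_def)
  \<comment> \<open>Open sets and compact stages interleave: \<open>V n\<close> lies in
    \<open>Xs n\<close>, and \<open>Xs n\<close> lies in \<open>V (Suc n)\<close>.\<close>
  define V where "V = (\<lambda>n. S3 - (h ^^ n) ` Tp)"
  define Xs where "Xs = (\<lambda>n. (h ^^ n) ` Tm)"
  define j where "j = (\<lambda>n y. (h ^^ n) (jm y))"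
  have VX: "V n \<subseteq> X" for n unfolding V_def assms(14) solenoid by blast
  have Xs_V: "Xs n \<subseteq> V (Suc n)" for n
  proof -
    have "(h ^^ n) ` Tm \<subseteq> (h ^^ n) ` (S3 - h ` Tp)" using Tm_sub by blast
    also have "\<dots> = S3 - (h ^^ n) ` h ` Tp" using hTp by (intro hn_diff) blast
    also have "(h ^^ n) ` h ` Tp = (h ^^ Suc n) ` Tp" by (simp only: funpow_Suc_right image_comp)
    finally show ?thesis by (simp only: Xs_def V_def)
  qed
  have V_Xs: "V n \<subseteq> Xs n" for n
  proof -
    have "V n = (h ^^ n) ` (S3 - Tp)" unfolding V_def using hn_diff[OF jp(3)] by simp
    then show ?thesis unfolding Xs_def assms(11) using closure_subset by blast
  qed
  have X_V: "X \<subseteq> (\<Union>n. V n)" unfolding V_def assms(14) solenoid by blast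
  \<comment> \<open>The relation for the inverse of \<open>h\<close> says that \<open>h\<close>
    undoes \<open>?e\<close> on \<open>Tm\<close>; the additional iterate in
    \<open>j (Suc n)\<close> absorbs it.\<close>
  have j_e: "j n y = j (Suc n) (?e y)" if y: "y \<in> ?ST" for n y
  proof -
    have "jm y \<in> S3" using y jm(1) TmS bij_betwE by blast
    then have "h (jm (?e y)) = jm y"
      using assms(13) y bij_betw_inv_into_right[OF hS(1)] by (metis solid_torus_def)
    then show ?thesis by (simp add: j_def funpow_Suc_right del: funpow.simps)
  qed
  have e_ST: "?e ` ?ST \<subseteq> ?ST" using e(1) by force
  have j_im: "j n ` ?ST = Xs n" for n
    unfolding j_def Xs_def bij_betw_imp_surj_on[OF jm(1), symmetric] image_image ..
  have cTm: "compact Tm"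
    using compact_continuous_image[OF jm(2) cST] bij_betw_imp_surj_on[OF jm(1)] by simp
  interpret telescope X Xs V p r ?e j
  proof
    show "compact (Xs n)" for n
      unfolding Xs_def using hn[of n] TmS cTm by (intro compact_continuous_image) (auto intro: continuous_on_subset)
    show "Xs n \<subseteq> Xs (Suc n)" for n using Xs_V V_Xs by blast
    show "X = (\<Union>n. Xs n)"
    proof (rule subset_antisym)
      show "X \<subseteq> (\<Union>n. Xs n)" using X_V by (rule order_trans) (rule UN_mono[OF subset_refl V_Xs])
      show "(\<Union>n. Xs n) \<subseteq> X" by (rule UN_least) (rule order_trans[OF Xs_V VX])
    qed
    show "openin (top_of_set X) (V n)" for n
    proof -
      have "compact ((h ^^ n) ` Tp)"
        using hn[of n] jp(3) cTp by (intro compact_continuous_image) (auto intro: continuous_on_subset)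
      then have "open (- (h ^^ n) ` Tp)" using compact_imp_closed by blast
      moreover have "V n = X \<inter> (- (h ^^ n) ` Tp)" using VX unfolding V_def assms(14) by blast
      ultimately show ?thesis unfolding openin_open by blast
    qed
    show "V n \<subseteq> Xs n" for n by (rule V_Xs)
    show "X \<subseteq> (\<Union>n. V n)" by (rule X_V)
    show "X \<noteq> {}"
      using \<open>jm (1, 0) \<in> Tm\<close> Xs_V[of 0] VX[of "Suc 0"] by (auto simp: Xs_def)
    show "2 \<le> p" "0 < r" by (rule assms(1), rule assms(2))
    show "continuous_on ?ST ?e" by (rule continuous_on_solenoid_map)
    show "inj_on ?e ?ST" by (rule e(2))
    show "?e ` ?ST \<subseteq> ?ST" by (rule e_ST)
    show "fst (?e y) = fst y ^ p" for y by (rule fst_solenoid_map)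
    have jmS: "jm ` ?ST \<subseteq> S3" unfolding bij_betw_imp_surj_on[OF jm(1)] by (rule TmS)
    show "continuous_on ?ST (j n)" for n
      unfolding j_def by (rule continuous_on_compose2[OF conjunct2[OF hn] jm(2) jmS])
    show "inj_on (j n) ?ST" for n
      unfolding j_def
      using comp_inj_on[OF bij_betw_imp_inj_on[OF jm(1)] inj_on_subset[OF bij_betw_imp_inj_on[OF conjunct1[OF hn]] jmS], of n]
      by (simp only: o_def)
    show "j n ` ?ST = Xs n" for n by (rule j_im)
    show "j n y = j (Suc n) (?e y)" if "y \<in> ?ST" for n y by (rule j_e[OF that])
  qed
  show ?thesis
    using homotopy_classes_phantom definable_set_homotopy_rel definable_bijection_ext by blast
qed

end
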